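(* There exists no graph on $12$ vertices whose Laplacian spectrum is $\{0,1,2,\ldots,11\}$ (each eigenvalue having multiplicity one).
   Context: All graphs are finite, simple, undirected, unweighted, and loopless. The Laplacian spectrum of a graph $G$ is the multiset of eigenvalues of its Laplacian matrix $L(G) = D(G) - A(G)$ (diagonal degree matrix minus adjacency matrix). *)

theory Defs
  imports "Graph_Theory.Pair_Digraph" "Jordan_Normal_Form.Char_Poly"
begin

text \<open>
  A finite simple undirected graph is a \<^locale>\<open>pair_graph\<close>: finite, loop-free and symmetric,
  with arcs given as pairs of vertices (hence no parallel arcs). An undirected edge
  \<open>{u, v}\<close> is represented by the two arcs \<open>(u, v)\<close> and \<open>(v, u)\<close>, so the degree of a vertex
  is its out-degree.

  Rows and columns of a \<^typ>\<open>real mat\<close> are numbered, so the matrices below are taken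
  with respect to an enumeration \<open>vs\<close> of the vertices.
\<close>

definition degree_matrix :: "'a pair_pre_digraph \<Rightarrow> 'a list \<Rightarrow> real mat" where
  "degree_matrix G vs = mat (length vs) (length vs)
     (\<lambda>(i, j). if i = j then real (out_degree (with_proj G) (vs ! i)) else 0)"

definition adjacency_matrix :: "'a pair_pre_digraph \<Rightarrow> 'a list \<Rightarrow> real mat" where
  "adjacency_matrix G vs = mat (length vs) (length vs)
     (\<lambda>(i, j). if (vs ! i, vs ! j) \<in> parcs G then 1 else 0)"

definition laplacian_matrix :: "'a pair_pre_digraph \<Rightarrow> 'a list \<Rightarrow> real mat" where
  "laplacian_matrix G vs = degree_matrix G vs - adjacency_matrix G vs"

definition vertex_enum :: "'a pair_pre_digraph \<Rightarrow> 'a list \<Rightarrow> bool" where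
  "vertex_enum G vs \<longleftrightarrow> distinct vs \<and> set vs = pverts G"

text \<open>
  Eigenvalues are counted with algebraic multiplicity, as roots of the characteristic polynomial.
  They may be taken in the reals because the Laplacian matrix of a graph is real symmetric.
  The choice of the enumeration is irrelevant, see \<open>laplacian_spectrum_eq\<close> below.
\<close>

definition laplacian_spectrum :: "'a pair_pre_digraph \<Rightarrow> real multiset" where
  "laplacian_spectrum G = proots (char_poly (laplacian_matrix G (SOME vs. vertex_enum G vs)))"

lemma sum_nth_delta:
  fixes g :: "'a \<Rightarrow> 'b :: comm_monoid_add"
  assumes "distinct vs" and "x \<in> set vs"
  shows "(\<Sum>k = 0..<length vs. if vs ! k = x then g (vs ! k) else 0) = g x"
proof -
  have "bij_betw ((!) vs) {0..<length vs} (set vs)"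
    using assms(1) by (auto intro!: bij_betw_nth)
  then have "(\<Sum>k = 0..<length vs. if vs ! k = x then g (vs ! k) else 0)
      = (\<Sum>y\<in>set vs. if y = x then g y else 0)"
    by (rule sum.reindex_bij_betw)
  then show ?thesis using assms(2) by simp
qed

lemma similar_mat_reenumerate:
  fixes f :: "'a \<Rightarrow> 'a \<Rightarrow> 'b :: comm_ring_1"
  assumes dv: "distinct vs" and dw: "distinct ws" and eq: "set vs = set ws"
  shows "similar_mat (mat (length vs) (length vs) (\<lambda>(i, j). f (vs ! i) (vs ! j)))
                     (mat (length ws) (length ws) (\<lambda>(i, j). f (ws ! i) (ws ! j)))"
proof -
  define n where "n = length vs"
  have nw: "length ws = n"
    unfolding n_def using dv dw eq by (metis distinct_card)
  define M where "M = (\<lambda>us :: 'a list. mat n n (\<lambda>(i, j). f (us ! i) (us ! j)))"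
  define P where "P = (\<lambda>us us' :: 'a list.
    mat n n (\<lambda>(i, j). if us ! i = us' ! j then 1 else 0 :: 'b))"
  have carr: "M us \<in> carrier_mat n n" "P us us' \<in> carrier_mat n n" for us us'
    by (simp_all add: M_def P_def)
  have left: "P us us' * mat n n (\<lambda>(i, j). g (us' ! i) j) = mat n n (\<lambda>(i, j). g (us ! i) j)"
    if "distinct us'" "length us = n" "length us' = n" "set us = set us'"
    for us us' and g :: "'a \<Rightarrow> nat \<Rightarrow> 'b"
  proof (rule eq_matI, goal_cases)
    case (1 i j)
    then have ij: "i < n" "j < n" by auto
    have "us ! i \<in> set us'" using ij that by (metis nth_mem)
    have "(P us us' * mat n n (\<lambda>(i, j). g (us' ! i) j)) $$ (i, j)
        = (\<Sum>k = 0..<n. (if us ! i = us' ! k then 1 else 0) * g (us' ! k) j)"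
      using ij by (simp add: P_def scalar_prod_def)
    also have "\<dots> = (\<Sum>k = 0..<length us'. if us' ! k = us ! i then g (us' ! k) j else 0)"
      using that by (intro sum.cong) auto
    also have "\<dots> = g (us ! i) j"
      using sum_nth_delta[OF that(1) \<open>us ! i \<in> set us'\<close>, of "\<lambda>y. g y j"] by simp
    finally show ?case using ij by simp
  qed (simp_all add: P_def)
  have right: "M vs * P vs ws = mat n n (\<lambda>(i, j). f (vs ! i) (ws ! j))"
  proof (rule eq_matI, goal_cases)
    case (1 i j)
    then have ij: "i < n" "j < n" by auto
    have "ws ! j \<in> set vs" using ij nw eq by (metis nth_mem)
    have "(M vs * P vs ws) $$ (i, j)
        = (\<Sum>k = 0..<n. f (vs ! i) (vs ! k) * (if vs ! k = ws ! j then 1 else 0))"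
      using ij by (simp add: M_def P_def scalar_prod_def)
    also have "\<dots> = (\<Sum>k = 0..<length vs. if vs ! k = ws ! j then f (vs ! i) (vs ! k) else 0)"
      by (intro sum.cong) (auto simp: n_def)
    also have "\<dots> = f (vs ! i) (ws ! j)"
      using sum_nth_delta[OF dv \<open>ws ! j \<in> set vs\<close>, of "f (vs ! i)"] by simp
    finally show ?case using ij by simp
  qed (simp_all add: M_def P_def)
  have comm: "M vs * P vs ws = P vs ws * M ws"
    unfolding right using left[of ws vs "\<lambda>x j. f x (ws ! j)"] dw nw eq
    by (simp add: M_def n_def)
  have inv: "P us us' * P us' us = 1\<^sub>m n"
    if "distinct us" "distinct us'" "length us = n" "length us' = n" "set us = set us'"
    for us us'
  proof -
    have "P us us' * P us' us = mat n n (\<lambda>(i, j). if us ! i = us ! j then 1 else 0)"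
      using left[of us' us "\<lambda>x j. if x = us ! j then 1 else 0"] that by (simp add: P_def)
    also have "\<dots> = 1\<^sub>m n"
      using that by (intro eq_matI) (auto simp: nth_eq_iff_index_eq)
    finally show ?thesis .
  qed
  have "M vs = M vs * (P vs ws * P ws vs)"
    using inv[of vs ws] dv dw nw eq carr(1)[of vs] by (simp add: n_def)
  also have "\<dots> = P vs ws * M ws * P ws vs"
    unfolding comm[symmetric] using carr by (simp add: assoc_mult_mat[of _ n n _ n _ n])
  finally have sim: "M vs = P vs ws * M ws * P ws vs" .
  have "similar_mat (M vs) (M ws)"
  proof (rule similar_matI[OF _ _ _ sim])
    show "{M vs, M ws, P vs ws, P ws vs} \<subseteq> carrier_mat n n"
      using carr by simp
    show "P vs ws * P ws vs = 1\<^sub>m n"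
      by (rule inv[OF dv dw n_def[symmetric] nw eq])
    show "P ws vs * P vs ws = 1\<^sub>m n"
      by (rule inv[OF dw dv nw n_def[symmetric] eq[symmetric]])
  qed
  then show ?thesis by (simp add: M_def nw n_def[symmetric])
qed

lemma laplacian_matrix_eq_mat:
  assumes "distinct vs"
  shows "laplacian_matrix G vs = mat (length vs) (length vs) (\<lambda>(i, j).
    (\<lambda>u v. (if u = v then real (out_degree (with_proj G) u) else 0)
            - (if (u, v) \<in> parcs G then 1 else 0)) (vs ! i) (vs ! j))"
  using assms unfolding laplacian_matrix_def degree_matrix_def adjacency_matrix_def
  by (intro eq_matI) (auto simp: nth_eq_iff_index_eq)

lemma laplacian_spectrum_eq:
  assumes "vertex_enum G vs"
  shows "laplacian_spectrum G = proots (char_poly (laplacian_matrix G vs))"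
proof -
  define ws where "ws = (SOME vs. vertex_enum G vs)"
  have ws: "vertex_enum G ws" unfolding ws_def using assms by (rule someI)
  have "similar_mat (laplacian_matrix G ws) (laplacian_matrix G vs)"
    using ws assms unfolding vertex_enum_def
    by (simp only: laplacian_matrix_eq_mat) (rule similar_mat_reenumerate, auto)
  then have "char_poly (laplacian_matrix G ws) = char_poly (laplacian_matrix G vs)"
    by (rule char_poly_similar)
  then show ?thesis by (simp add: laplacian_spectrum_def ws_def)
qed

end

theory Submission
  imports Defs
begin

text \<open>
  Suppose that a graph on 12 vertices has the Laplacian spectrum \<open>0, 1, \<dots>, 11\<close>. The main
  consequence that is used is the following. If a real quadratic polynomial \<open>p\<close> is nonnegative at
  the eleven points \<open>1, \<dots>, 11\<close>, then \<open>p(L)\<close> is positive semidefinite on the orthogonal complement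
  of the all-ones vector, where the eigenvalue \<open>0\<close> lives. For an integer \<open>a\<close> the polynomial
  \<open>(t - a) (t - a - 1)\<close> has this property, since no integer lies strictly between \<open>a\<close> and \<open>a + 1\<close>,
  and so has \<open>(t - 1) (11 - t)\<close>. Together these forms say that \<open>L\<close> has no eigenvalue in a gap
  between consecutive integers. The point of using quadratic polynomials is locality: the entry of
  \<open>p(L)\<close> at \<open>u, v\<close> depends on the neighbourhoods of \<open>u\<close> and \<open>v\<close> only. Hence a vector supported on
  few vertices whose neighbourhoods are known can already refute a graph, whatever its remaining
  edges are. The traces of \<open>L\<close> and of its square moreover fix the sum and the sum of squares of the
  degrees, at \<open>66\<close> and \<open>440\<close>, and the form of \<open>(t - 1) (11 - t)\<close> at one basis vector
  keeps all degrees between \<open>2\<close> and \<open>9\<close> (\<open>degree_bounds\<close>).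

  These are 36 degree sequences. The hypotheses are invariant under complementation
  (\<open>nonneg_forms_complement\<close>), because \<open>L\<close> becomes \<open>12 - L\<close> on the vectors of sum zero, so that
  18 sequences remain. For each of them the neighbourhoods are revealed vertex by vertex. Vertices
  that are not yet explored and have the same explored neighbours are interchangeable, so a
  partial graph is recorded as a list of cells with their sizes, and the neighbourhood of the next
  vertex is described by the number of neighbours in each cell. When the next vertex \<open>v\<close> is added
  to an old vector \<open>x\<close> with coefficient \<open>\<xi>\<close>, the form is an affine function of these numbers:
  the cross term involves only the sum of \<open>L x\<close> over the neighbours of \<open>v\<close>, and \<open>L x\<close> is constant
  on every cell (\<open>cut_valid\<close>). So one vector gives one linear inequality which
  excludes many neighbourhoods at once. It turns out that every branch dies, mostly after four
  to six vertices. The certificates below list the choice of the next vertex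
  and the vectors; \<open>check\<close> replays the search by rewriting, and \<open>check_sound\<close> shows that a
  sequence with an accepted certificate is not the degree sequence of a graph with
  nonnegative forms.
\<close>

section \<open>Quadratic forms that the spectrum makes nonnegative\<close>

definition vdeg :: "'a set \<Rightarrow> ('a \<Rightarrow> 'a \<Rightarrow> bool) \<Rightarrow> 'a \<Rightarrow> nat" where
  "vdeg V adj u = card {w \<in> V. adj u w}"

definition lap :: "'a set \<Rightarrow> ('a \<Rightarrow> 'a \<Rightarrow> bool) \<Rightarrow> ('a \<Rightarrow> int) \<Rightarrow> 'a \<Rightarrow> int" where
  "lap V adj x u = int (vdeg V adj u) * x u - (\<Sum>w\<in>V. if adj u w then x w else 0)"

text \<open>
  Twelve times the value of \<open>q L\<^sup>2 + l L + k\<close> at \<open>x\<close>, with the contribution of the all-ones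
  direction removed. On 12 vertices that contribution is \<open>k\<close> times the squared sum of \<open>x\<close>, divided by 12; the
  factor 12 keeps everything integral.
\<close>
definition form :: "int \<Rightarrow> int \<Rightarrow> int \<Rightarrow> 'a set \<Rightarrow> ('a \<Rightarrow> 'a \<Rightarrow> bool) \<Rightarrow> ('a \<Rightarrow> int) \<Rightarrow> int" where
  "form q l k V adj x = 12 * (q * (\<Sum>u\<in>V. (lap V adj x u)\<^sup>2) + l * (\<Sum>u\<in>V. x u * lap V adj x u)
     + k * (\<Sum>u\<in>V. (x u)\<^sup>2)) - k * (\<Sum>u\<in>V. x u)\<^sup>2"

text \<open>
  The polynomials used by the search: \<open>(t - a) (t - a - 1)\<close>, except that the index \<open>0\<close> stands for
  \<open>(t - 1) (11 - t)\<close>.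
\<close>
definition "coef2 a = (if a = 0 then - 1 else 1 :: int)"

definition "coef1 a = (if a = 0 then 12 else - (2 * a + 1) :: int)"

definition "coef0 a = (if a = 0 then - 11 else a * (a + 1) :: int)"

locale nonneg_forms =
  fixes V :: "'a set" and adj :: "'a \<Rightarrow> 'a \<Rightarrow> bool"
  assumes fin: "finite V"
    and adj_sym: "adj u v \<Longrightarrow> adj v u"
    and adj_irrefl: "\<not> adj u u"
    and form_nonneg: "\<forall>t\<in>{1..11}. 0 \<le> q * t\<^sup>2 + l * t + k \<Longrightarrow> 0 \<le> form q l k V adj x"
begin

lemma form_nonneg': "0 \<le> form (coef2 a) (coef1 a) (coef0 a) V adj x"
proof (rule form_nonneg, rule ballI)
  fix t :: int assume t: "t \<in> {1..11}"
  show "0 \<le> coef2 a * t\<^sup>2 + coef1 a * t + coef0 a"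
  proof (cases "a = 0")
    case True
    have "0 \<le> (t - 1) * (11 - t)" using t by simp
    then show ?thesis by (simp add: True coef2_def coef1_def coef0_def power2_eq_square algebra_simps)
  next
    case False
    have "0 \<le> (t - a) * (t - a - 1)"
      by (cases "t \<le> a") (simp_all add: mult_nonpos_nonpos)
    then show ?thesis using False by (simp add: coef2_def coef1_def coef0_def power2_eq_square algebra_simps)
  qed
qed

abbreviation "dg \<equiv> vdeg V adj"

abbreviation "lp \<equiv> lap V adj"

lemma adj_commute: "adj u v \<longleftrightarrow> adj v u"
  using adj_sym by blast

end

context nonneg_forms
begin

text \<open>
  The polarisation that drives the search. The cross term only sees the old vector through its
  image under the Laplacian at \<open>v\<close> and at the neighbours of \<open>v\<close>.
\<close>
lemma form_add_vertex:
  assumes v: "v \<in> V" "x v = 0"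
  shows "form q l k V adj (\<lambda>u. x u + (if u = v then c else 0)) = form q l k V adj x
    + 2 * c * (12 * (q * (int (dg v) * lp x v - (\<Sum>u\<in>V. if adj v u then lp x u else 0)) + l * lp x v) - k * (\<Sum>u\<in>V. x u))
    + c * c * (12 * (q * ((int (dg v))\<^sup>2 + int (dg v)) + l * int (dg v)) + 11 * k)"
proof -
  let ?e = "\<lambda>u. if u = v then c else 0" and ?d = "int (dg v)"
  let ?z = "\<lambda>u. x u + ?e u"
  let ?g = "\<lambda>u. (if u = v then ?d * c else 0) - (if adj v u then c else 0)"
  have lapz: "lp ?z u = lp x u + ?g u" for u
  proof -
    have "(\<Sum>w\<in>V. if adj u w then ?z w else 0) = (\<Sum>w\<in>V. (if adj u w then x w else 0) + (if w = v then (if adj u v then c else 0) else 0))"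
      by (intro sum.cong) auto
    also have "\<dots> = (\<Sum>w\<in>V. if adj u w then x w else 0) + (if adj u v then c else 0)"
      using v fin by (simp add: sum.distrib)
    finally show ?thesis using adj_commute[of u v] by (auto simp: lap_def algebra_simps)
  qed
  have cardN: "(\<Sum>u\<in>V. if adj v u then 1 else 0 :: int) = ?d"
    using fin by (simp add: vdeg_def sum.If_cases Int_def)
  have S1: "(\<Sum>u\<in>V. f u * (if adj v u then c else 0)) = c * (\<Sum>u\<in>V. if adj v u then f u else 0)" for f :: "'a \<Rightarrow> int"
    by (auto simp: sum_distrib_left intro!: sum.cong)
  have yy: "(\<Sum>u\<in>V. (lp ?z u)\<^sup>2) = (\<Sum>u\<in>V. (lp x u)\<^sup>2) + 2 * c * (?d * lp x v - (\<Sum>u\<in>V. if adj v u then lp x u else 0)) + c * c * (?d\<^sup>2 + ?d)"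
  proof -
    have "(lp ?z u)\<^sup>2 = (lp x u)\<^sup>2 + (if u = v then 2 * ?d * c * lp x v + ?d\<^sup>2 * c * c else 0) - 2 * (lp x u * (if adj v u then c else 0)) + c * c * (if adj v u then 1 else 0)" for u
      using adj_irrefl[of v] by (simp add: lapz power2_eq_square algebra_simps)
    then have "(\<Sum>u\<in>V. (lp ?z u)\<^sup>2) = (\<Sum>u\<in>V. (lp x u)\<^sup>2) + (2 * ?d * c * lp x v + ?d\<^sup>2 * c * c)
        - 2 * (\<Sum>u\<in>V. lp x u * (if adj v u then c else 0)) + c * c * (\<Sum>u\<in>V. (if adj v u then 1 else 0))"
      using v fin by (simp add: sum.distrib sum_subtractf sum_distrib_left)
    then show ?thesis unfolding S1 cardN by (simp add: algebra_simps)
  qed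
  have xy: "(\<Sum>u\<in>V. ?z u * lp ?z u) = (\<Sum>u\<in>V. x u * lp x u) + 2 * c * lp x v + c * c * ?d"
  proof -
    have "?z u * lp ?z u = x u * lp x u - x u * (if adj v u then c else 0) + (if u = v then c * lp x v + c * c * ?d else 0)" for u
      using adj_irrefl[of v] v by (simp add: lapz algebra_simps)
    then have "(\<Sum>u\<in>V. ?z u * lp ?z u) = (\<Sum>u\<in>V. x u * lp x u) - (\<Sum>u\<in>V. x u * (if adj v u then c else 0)) + (c * lp x v + c * c * ?d)"
      using v fin by (simp add: sum.distrib sum_subtractf)
    moreover have "(\<Sum>u\<in>V. if adj v u then x u else 0) = - lp x v"
      using v by (simp add: lap_def)
    ultimately show ?thesis unfolding S1 by simp
  qed
  have xx: "(\<Sum>u\<in>V. (?z u)\<^sup>2) = (\<Sum>u\<in>V. (x u)\<^sup>2) + c * c"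
  proof -
    have "(?z u)\<^sup>2 = (x u)\<^sup>2 + (if u = v then c * c else 0)" for u
      using v by (simp add: power2_eq_square)
    then show ?thesis using v fin by (simp add: sum.distrib)
  qed
  have s: "(\<Sum>u\<in>V. ?z u) = (\<Sum>u\<in>V. x u) + c" using v fin by (simp add: sum.distrib)
  show ?thesis unfolding form_def yy xy xx s by (simp add: power2_eq_square algebra_simps)
qed

end

definition complement :: "'a set \<Rightarrow> ('a \<Rightarrow> 'a \<Rightarrow> bool) \<Rightarrow> 'a \<Rightarrow> 'a \<Rightarrow> bool" where
  "complement V adj u w \<longleftrightarrow> u \<noteq> w \<and> \<not> adj u w"

context nonneg_forms
begin

lemma vdeg_complement:
  assumes "u \<in> V" shows "vdeg V (complement V adj) u + dg u + 1 = card V"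
proof -
  have "V = {w \<in> V. complement V adj u w} \<union> {w \<in> V. adj u w} \<union> {u}"
    using assms by (auto simp: complement_def)
  moreover have "card ({w \<in> V. complement V adj u w} \<union> {w \<in> V. adj u w} \<union> {u}) = vdeg V (complement V adj) u + dg u + 1"
    unfolding vdeg_def using fin adj_irrefl[of u] by (subst card_Un_disjoint; (subst card_Un_disjoint)?) (auto simp: complement_def)
  ultimately show ?thesis by simp
qed

lemma lap_complement:
  assumes "u \<in> V"
  shows "lap V (complement V adj) x u = int (card V) * x u - (\<Sum>w\<in>V. x w) - lp x u"
proof -
  have "(\<Sum>w\<in>V. x w) = (\<Sum>w\<in>V. (if complement V adj u w then x w else 0) + (if adj u w then x w else 0) + (if w = u then x u else 0))"
    using adj_irrefl[of u] by (intro sum.cong) (auto simp: complement_def)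
  also have "\<dots> = (\<Sum>w\<in>V. if complement V adj u w then x w else 0) + (\<Sum>w\<in>V. if adj u w then x w else 0) + x u"
    using assms fin by (simp add: sum.distrib)
  finally show ?thesis
    unfolding lap_def vdeg_complement[OF assms, symmetric] by (simp add: algebra_simps)
qed

lemma sum_lap: "(\<Sum>u\<in>V. lp x u) = 0"
proof -
  have "(\<Sum>u\<in>V. \<Sum>w\<in>V. if adj u w then x w else 0) = (\<Sum>w\<in>V. \<Sum>u\<in>V. if adj w u then x w else 0)"
    by (subst sum.swap) (simp add: adj_commute)
  also have "\<dots> = (\<Sum>w\<in>V. int (dg w) * x w)"
    using fin by (simp add: vdeg_def sum.If_cases Int_def)
  finally show ?thesis by (simp add: lap_def sum_subtractf)
qed

text \<open>
  Complementation replaces \<open>L\<close> by \<open>12 - L\<close> on the vectors of sum zero, hence \<open>p(t)\<close> by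
  \<open>p(12 - t)\<close>.
\<close>
lemma form_complement:
  assumes "card V = 12"
  shows "form q l k V (complement V adj) x = form q (- 24 * q - l) (144 * q + 12 * l + k) V adj x"
proof -
  let ?s = "\<Sum>u\<in>V. x u"
  have L: "lap V (complement V adj) x u = 12 * x u - ?s - lp x u" if "u \<in> V" for u
    using lap_complement[OF that] assms by simp
  have "(\<Sum>u\<in>V. (lap V (complement V adj) x u)\<^sup>2) = (\<Sum>u\<in>V. 144 * (x u)\<^sup>2 + ?s\<^sup>2 + (lp x u)\<^sup>2 - 24 * ?s * x u - 24 * (x u * lp x u) + 2 * ?s * lp x u)"
    by (intro sum.cong refl) (simp add: L power2_eq_square algebra_simps)
  also have "\<dots> = 144 * (\<Sum>u\<in>V. (x u)\<^sup>2) - 12 * ?s\<^sup>2 + (\<Sum>u\<in>V. (lp x u)\<^sup>2) - 24 * (\<Sum>u\<in>V. x u * lp x u)"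
    using assms by (simp add: sum.distrib sum_subtractf sum_distrib_left[symmetric] sum_lap power2_eq_square)
  finally have yy: "(\<Sum>u\<in>V. (lap V (complement V adj) x u)\<^sup>2) = \<dots>" .
  have "(\<Sum>u\<in>V. x u * lap V (complement V adj) x u) = (\<Sum>u\<in>V. 12 * (x u)\<^sup>2 - ?s * x u - x u * lp x u)"
    by (intro sum.cong refl) (simp add: L power2_eq_square algebra_simps)
  also have "\<dots> = 12 * (\<Sum>u\<in>V. (x u)\<^sup>2) - ?s\<^sup>2 - (\<Sum>u\<in>V. x u * lp x u)"
    by (simp add: sum_subtractf sum_distrib_left[symmetric] power2_eq_square)
  finally have xy: "(\<Sum>u\<in>V. x u * lap V (complement V adj) x u) = \<dots>" .
  show ?thesis unfolding form_def yy xy by (simp add: algebra_simps)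
qed

lemma nonneg_forms_complement:
  assumes "card V = 12" shows "nonneg_forms V (complement V adj)"
proof
  show "finite V" by (rule fin)
  show "complement V adj u v \<Longrightarrow> complement V adj v u" for u v using adj_sym[of v u] by (auto simp: complement_def)
  show "\<not> complement V adj u u" for u by (simp add: complement_def)
next
  fix q l k x assume p: "\<forall>t\<in>{1..11}. 0 \<le> q * t\<^sup>2 + l * t + (k :: int)"
  have "0 \<le> form q (- 24 * q - l) (144 * q + 12 * l + k) V adj x"
  proof (rule form_nonneg, rule ballI)
    fix t :: int assume "t \<in> {1..11}"
    then have "12 - t \<in> {1..11}" by simp
    then have "0 \<le> q * (12 - t)\<^sup>2 + l * (12 - t) + k" using p by blast
    then show "0 \<le> q * t\<^sup>2 + (- 24 * q - l) * t + (144 * q + 12 * l + k)"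
      by (simp add: power2_eq_square algebra_simps)
  qed
  then show "0 \<le> form q l k V (complement V adj) x" by (simp add: form_complement[OF assms])
qed

text \<open>
  At a basis vector the form of \<open>(t - 1) (11 - t)\<close> equals \<open>12 d (11 - d) - 121\<close>, which is negative
  for \<open>d\<close> in \<open>{0, 1, 10, 11}\<close>.
\<close>
lemma degree_bounds:
  assumes "card V = 12" "v \<in> V"
  shows "dg v \<in> {2..9}"
proof -
  have f0: "form q l k V adj (\<lambda>_. 0) = 0" for q l k by (simp add: form_def lap_def)
  have lap0: "lp (\<lambda>_. 0) u = 0" for u by (simp add: lap_def)
  have "0 \<le> form (- 1) 12 (- 11) V adj (\<lambda>u. 0 + (if u = v then 1 else 0))"
    using form_nonneg'[of 0] by (simp add: coef2_def coef1_def coef0_def)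
  also have "\<dots> = 12 * (- ((int (dg v))\<^sup>2 + int (dg v)) + 12 * int (dg v)) - 121"
    using form_add_vertex[of v "\<lambda>_. 0" "- 1" 12 "- 11" 1] assms(2) by (simp add: f0 lap0 cong: if_cong)
  finally have *: "121 \<le> 12 * (- ((int (dg v))\<^sup>2 + int (dg v)) + 12 * int (dg v))" by simp
  have "dg v \<le> 11" using vdeg_complement[OF assms(2)] assms(1) by simp
  moreover have "dg v \<noteq> 0" using * by (cases "dg v = 0") simp_all
  moreover have "dg v \<noteq> 1" "dg v \<noteq> 10" "dg v \<noteq> 11" using * by (auto simp: power2_eq_square)
  ultimately show ?thesis by auto
qed

end

section \<open>From the spectrum to the forms\<close>

text \<open>
  The last assumption, the resolution of the identity, is what makes the orthonormal family
  \<open>g\<close> a basis.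
\<close>
locale eigenbasis =
  fixes a g :: "nat \<Rightarrow> nat \<Rightarrow> real"
  assumes a_sym: "i < 12 \<Longrightarrow> j < 12 \<Longrightarrow> a i j = a j i"
    and eig: "k < 12 \<Longrightarrow> i < 12 \<Longrightarrow> (\<Sum>j<12. a i j * g k j) = real k * g k i"
    and norm: "k < 12 \<Longrightarrow> (\<Sum>i<12. g k i * g k i) = 1"
    and compl: "i < 12 \<Longrightarrow> j < 12 \<Longrightarrow> (\<Sum>k<12. g k i * g k j) = (if i = j then 1 else 0)"
begin

definition coord :: "(nat \<Rightarrow> real) \<Rightarrow> nat \<Rightarrow> real" where "coord x k = (\<Sum>i<12. g k i * x i)"

lemma parseval: "(\<Sum>i<12. x i * y i) = (\<Sum>k<12. coord x k * coord y k)"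
proof -
  have "(\<Sum>k<12. coord x k * coord y k) = (\<Sum>k<12. \<Sum>i<12. \<Sum>j<12. x i * y j * (g k i * g k j))"
    unfolding coord_def sum_product by (intro sum.cong refl) (simp add: algebra_simps)
  also have "\<dots> = (\<Sum>i<12. \<Sum>k<12. \<Sum>j<12. x i * y j * (g k i * g k j))" by (rule sum.swap)
  also have "\<dots> = (\<Sum>i<12. \<Sum>j<12. \<Sum>k<12. x i * y j * (g k i * g k j))"
    by (intro sum.cong refl sum.swap)
  also have "\<dots> = (\<Sum>i<12. \<Sum>j<12. x i * y j * (if i = j then 1 else 0))"
    unfolding sum_distrib_left[symmetric] by (intro sum.cong refl) (simp add: compl)
  also have "\<dots> = (\<Sum>i<12. x i * y i)" by (intro sum.cong refl) (simp add: if_distrib cong: if_cong)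
  finally show ?thesis ..
qed

definition act :: "(nat \<Rightarrow> real) \<Rightarrow> nat \<Rightarrow> real" where "act x i = (\<Sum>j<12. a i j * x j)"

lemma coord_act: assumes "k < 12" shows "coord (act x) k = real k * coord x k"
proof -
  have "coord (act x) k = (\<Sum>i<12. \<Sum>j<12. g k i * (a i j * x j))"
    by (simp add: coord_def act_def sum_distrib_left)
  also have "\<dots> = (\<Sum>j<12. \<Sum>i<12. g k i * (a i j * x j))" by (rule sum.swap)
  also have "\<dots> = (\<Sum>j<12. x j * (\<Sum>i<12. a j i * g k i))"
    unfolding sum_distrib_left by (intro sum.cong refl) (simp add: a_sym)
  also have "\<dots> = (\<Sum>j<12. x j * (real k * g k j))"
    using assms by (intro sum.cong refl) (simp add: eig)
  also have "\<dots> = real k * coord x k"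
    unfolding coord_def sum_distrib_left by (intro sum.cong refl) simp
  finally show ?thesis .
qed

lemma act_act: "(\<Sum>i<12. act x i * act x i) = (\<Sum>k<12. (real k)\<^sup>2 * (coord x k)\<^sup>2)"
  by (subst parseval, intro sum.cong refl) (simp add: coord_act power2_eq_square)

lemma inner_act: "(\<Sum>i<12. x i * act x i) = (\<Sum>k<12. real k * (coord x k)\<^sup>2)"
  by (subst parseval, intro sum.cong refl) (simp add: coord_act power2_eq_square)

lemma traces:
  shows "(\<Sum>i<12. a i i) = 66" and "(\<Sum>i<12. \<Sum>j<12. (a j i)\<^sup>2) = 506"
proof -
  let ?e = "\<lambda>i j. if j = i then 1 else 0 :: real"
  have c: "coord (?e i) k = g k i" if "i < 12" for i k
    using that by (simp add: coord_def if_distrib cong: if_cong)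
  have ap: "act (?e i) j = a j i" if "i < 12" for i j
    using that by (simp add: act_def if_distrib cong: if_cong)
  have below12: "{..<12 :: nat} = {0, 1, 2, 3, 4, 5, 6, 7, 8, 9, 10, 11}" by (auto, presburger)
  have e: "?e i j * y = (if j = i then y else 0)" for i j y by simp
  have n: "(\<Sum>i<12. f k * (g k i)\<^sup>2) = f k" if "k < 12" for k and f :: "nat \<Rightarrow> real"
    using norm[OF that] by (simp add: sum_distrib_left[symmetric] power2_eq_square)
  have "(\<Sum>i<12. a i i) = (\<Sum>i<12. \<Sum>j<12. ?e i j * act (?e i) j)"
    unfolding e by (intro sum.cong refl) (simp add: ap)
  also have "\<dots> = (\<Sum>i<12. \<Sum>k<12. real k * (g k i)\<^sup>2)"
    unfolding inner_act by (intro sum.cong refl) (simp add: c)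
  also have "\<dots> = (\<Sum>k<12. real k)" by (subst sum.swap) (intro sum.cong refl, simp add: n)
  also have "\<dots> = 66" by (simp add: below12)
  finally show "(\<Sum>i<12. a i i) = 66" .
  have "(\<Sum>i<12. \<Sum>j<12. (a j i)\<^sup>2) = (\<Sum>i<12. \<Sum>j<12. act (?e i) j * act (?e i) j)"
    by (intro sum.cong refl) (simp add: ap power2_eq_square)
  also have "\<dots> = (\<Sum>i<12. \<Sum>k<12. (real k)\<^sup>2 * (g k i)\<^sup>2)"
    unfolding act_act by (intro sum.cong refl) (simp add: c)
  also have "\<dots> = (\<Sum>k<12. (real k)\<^sup>2)" by (subst sum.swap) (intro sum.cong refl, simp add: n[of _ "\<lambda>k. (real k)\<^sup>2"])
  also have "\<dots> = 506" by (simp add: below12)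
  finally show "(\<Sum>i<12. \<Sum>j<12. (a j i)\<^sup>2) = 506" .
qed

text \<open>
  Since the rows of \<open>a\<close> sum to zero, the all-ones vector has coordinates only along the eigenvector
  for the eigenvalue \<open>0\<close>. Therefore the subtracted square of the sum is exactly the summand
  for \<open>k = 0\<close>, where the polynomial may be negative.
\<close>
lemma form_real:
  assumes splits: "\<And>i. i < 12 \<Longrightarrow> (\<Sum>j<12. a i j) = 0"
    and p: "\<And>t. t \<in> {1..<12} \<Longrightarrow> 0 \<le> q * (real t)\<^sup>2 + l * real t + r"
  shows "0 \<le> 12 * (q * (\<Sum>i<12. act x i * act x i) + l * (\<Sum>i<12. x i * act x i) + r * (\<Sum>i<12. x i * x i)) - r * (\<Sum>i<12. x i)\<^sup>2"
proof -
  let ?one = "\<lambda>_. 1 :: real"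
  have "coord (act ?one) k = 0" for k
    unfolding coord_def act_def by (intro sum.neutral ballI) (simp add: splits)
  then have one: "coord ?one k = 0" if "k < 12" "k \<noteq> 0" for k
    using coord_act[of k ?one] that by simp
  have s: "(\<Sum>k<12. coord ?one k * f k) = coord ?one 0 * f 0" for f
    by (subst sum.remove[of _ 0]) (auto simp: one intro!: sum.neutral)
  have "12 = (coord ?one 0)\<^sup>2"
    using parseval[of ?one ?one] s[of "coord ?one"] by (simp add: power2_eq_square)
  moreover have "(\<Sum>i<12. x i) = coord ?one 0 * coord x 0"
    using parseval[of ?one x] s[of "coord x"] by simp
  ultimately have sum2: "(\<Sum>i<12. x i)\<^sup>2 = 12 * (coord x 0)\<^sup>2" by (simp add: power_mult_distrib)
  have "0 \<le> (\<Sum>k\<in>{1..<12}. (q * (real k)\<^sup>2 + l * real k + r) * (coord x k)\<^sup>2)"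
    using p by (intro sum_nonneg mult_nonneg_nonneg) auto
  also have "\<dots> = (\<Sum>k<12. (q * (real k)\<^sup>2 + l * real k + r) * (coord x k)\<^sup>2) - r * (coord x 0)\<^sup>2"
    by (simp add: lessThan_atLeast0 sum.atLeast_Suc_lessThan)
  also have "\<dots> = q * (\<Sum>i<12. act x i * act x i) + l * (\<Sum>i<12. x i * act x i) + r * (\<Sum>i<12. x i * x i) - r * (coord x 0)\<^sup>2"
    unfolding act_act inner_act parseval[of x x] by (simp add: algebra_simps sum.distrib sum_distrib_left power2_eq_square)
  finally show ?thesis unfolding sum2 by simp
qed

end

text \<open>
  Twelve distinct eigenvalues of a symmetric matrix come with twelve orthogonal eigenvectors, and a
  square matrix with orthonormal rows has orthonormal columns.
\<close>
lemma eigenbasis_exists: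
  fixes A :: "real mat"
  assumes A: "A \<in> carrier_mat 12 12"
    and sym: "\<And>i j. i < 12 \<Longrightarrow> j < 12 \<Longrightarrow> A $$ (i, j) = A $$ (j, i)"
    and roots: "\<And>k. k < (12::nat) \<Longrightarrow> poly (char_poly A) (real k) = 0"
  shows "\<exists>g. eigenbasis (\<lambda>i j. A $$ (i, j)) g"
proof -
  have "\<exists>v. eigenvector A v (real k)" if "k < 12" for k
    using eigenvalue_root_char_poly[OF A] roots[OF that] by (auto simp: eigenvalue_def)
  then obtain w where w: "\<And>k. k < 12 \<Longrightarrow> eigenvector A (w k) (real k)" by metis
  define f where "f k i = w k $ i" for k i
  have wc: "w k \<in> carrier_vec 12" "w k \<noteq> 0\<^sub>v 12" "A *\<^sub>v w k = real k \<cdot>\<^sub>v w k" if "k < 12" for k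
    using w[OF that] A by (auto simp: eigenvector_def)
  have eig: "(\<Sum>j<12. A $$ (i, j) * f k j) = real k * f k i" if "k < 12" "i < 12" for k i
  proof -
    have "(A *\<^sub>v w k) $ i = (\<Sum>j<12. A $$ (i, j) * f k j)"
      using that A wc(1)[OF that(1)] by (auto simp: scalar_prod_def f_def atLeast0LessThan intro!: sum.cong)
    moreover have "(real k \<cdot>\<^sub>v w k) $ i = real k * f k i"
      using that wc(1)[OF that(1)] by (simp add: f_def)
    ultimately show ?thesis using wc(3)[OF that(1)] by simp
  qed
  define N where "N k = (\<Sum>i<12. f k i * f k i)" for k
  have Npos: "N k > 0" if "k < 12" for k
  proof -
    have "\<exists>i<12. f k i \<noteq> 0"
    proof (rule ccontr)
      assume "\<not> ?thesis"
      then have "w k = 0\<^sub>v 12" using wc(1)[OF that] by (intro eq_vecI) (auto simp: f_def)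
      then show False using wc(2)[OF that] by simp
    qed
    then obtain i where "i < 12" "f k i \<noteq> 0" by blast
    then show ?thesis unfolding N_def by (intro sum_pos2[of _ i]) (auto simp: zero_less_mult_iff linorder_neq_iff)
  qed
  have orth: "(\<Sum>i<12. f k i * f l i) = 0" if "k < 12" "l < 12" "k \<noteq> l" for k l
  proof -
    have "real k * (\<Sum>i<12. f k i * f l i) = (\<Sum>i<12. \<Sum>j<12. A $$ (i, j) * f k j * f l i)"
      using that by (simp add: sum_distrib_left mult.assoc[symmetric] eig[symmetric] sum_distrib_right)
    also have "\<dots> = (\<Sum>j<12. \<Sum>i<12. A $$ (i, j) * f k j * f l i)" by (rule sum.swap)
    also have "\<dots> = (\<Sum>j<12. f k j * (\<Sum>i<12. A $$ (j, i) * f l i))"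
      unfolding sum_distrib_left by (intro sum.cong refl) (simp add: sym)
    also have "\<dots> = (\<Sum>j<12. real l * (f k j * f l j))"
      using that by (intro sum.cong refl) (simp add: eig)
    also have "\<dots> = real l * (\<Sum>i<12. f k i * f l i)"
      by (simp add: sum_distrib_left)
    finally show ?thesis using that by simp
  qed
  define g where "g k i = f k i / sqrt (N k)" for k i
  have gg: "(\<Sum>i<12. g k i * g l i) = (if k = l then 1 else 0)" if "k < 12" "l < 12" for k l
  proof -
    have "(\<Sum>i<12. g k i * g l i) = (\<Sum>i<12. f k i * f l i) / (sqrt (N k) * sqrt (N l))"
      by (simp add: g_def sum_divide_distrib)
    then show ?thesis using orth[OF that] Npos[OF that(1)] by (auto simp: N_def[symmetric])
  qed
  define M where "M = mat 12 12 (\<lambda>(k, i). g k i)"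
  have M: "M \<in> carrier_mat 12 12" by (simp add: M_def)
  have "M * transpose_mat M = 1\<^sub>m 12"
    by (rule eq_matI) (auto simp: M_def scalar_prod_def gg atLeast0LessThan)
  moreover have "transpose_mat M \<in> carrier_mat 12 12" using M by simp
  ultimately have "transpose_mat M * M = 1\<^sub>m 12"
    using mat_mult_left_right_inverse[OF M] by blast
  then have "(transpose_mat M * M) $$ (i, j) = (if i = j then 1 else 0)" if "i < 12" "j < 12" for i j
    using that by simp
  then have compl: "(\<Sum>k<12. g k i * g k j) = (if i = j then 1 else 0)" if "i < 12" "j < 12" for i j
    using that by (simp add: M_def scalar_prod_def atLeast0LessThan)
  have "eigenbasis (\<lambda>i j. A $$ (i, j)) g"
  proof
    show "(\<Sum>j<12. A $$ (i, j) * g k j) = real k * g k i" if "k < 12" "i < 12" for k i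
      using eig[OF that] by (simp add: g_def sum_divide_distrib[symmetric])
  qed (use sym gg compl in auto)
  then show ?thesis by blast
qed

lemma laplacian_forms:
  assumes G: "pair_graph G" and vs: "vertex_enum G vs" and len: "length vs = 12"
    and spec: "\<And>k. k < (12::nat) \<Longrightarrow> poly (char_poly (laplacian_matrix G vs)) (real k) = 0"
    and adj: "adj = (\<lambda>i j. i < 12 \<and> j < 12 \<and> (vs ! i, vs ! j) \<in> parcs G)"
  shows "nonneg_forms {..<12} adj"
    "(\<Sum>i<12. int (vdeg {..<12} adj i)) = 66" "(\<Sum>i<12. (int (vdeg {..<12} adj i))\<^sup>2) = 440"
proof -
  interpret pair_graph G by (rule G)
  define A where "A = laplacian_matrix G vs"
  have dst: "distinct vs" and vset: "set vs = pverts G" using vs by (auto simp: vertex_enum_def)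
  have sym: "(u, v) \<in> parcs G \<longleftrightarrow> (v, u) \<in> parcs G" for u v
    using arcs_symmetric by auto
  have irr: "(u, u) \<notin> parcs G" for u using pair_no_loops[of "(u, u)"] by auto
  let ?d = "vdeg {..<12} adj"
  have outdeg: "out_degree (with_proj G) (vs ! i) = ?d i" if "i < 12" for i
  proof -
    have "bij_betw (\<lambda>j. (vs ! i, vs ! j)) {j \<in> {..<12}. adj i j} (out_arcs (with_proj G) (vs ! i))"
      unfolding bij_betw_def
    proof
      show "inj_on (\<lambda>j. (vs ! i, vs ! j)) {j \<in> {..<12}. adj i j}"
        using dst len by (auto simp: inj_on_def nth_eq_iff_index_eq)
      have "\<exists>j<12. vs ! j = v" if "(vs ! i, v) \<in> parcs G" for v
        using that wellformed len vset by (metis in_set_conv_nth snd_conv)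
      then show "(\<lambda>j. (vs ! i, vs ! j)) ` {j \<in> {..<12}. adj i j} = out_arcs (with_proj G) (vs ! i)"
        using that by (force simp: out_arcs_def adj)
    qed
    from bij_betw_same_card[OF this] show ?thesis by (simp add: out_degree_def vdeg_def)
  qed
  have Ac: "A \<in> carrier_mat 12 12"
    unfolding A_def laplacian_matrix_eq_mat[OF dst] by (simp add: len)
  have entry: "A $$ (i, j) = (if i = j then real (?d i) else 0) - (if adj i j then 1 else 0)" if "i < 12" "j < 12" for i j
    unfolding A_def laplacian_matrix_eq_mat[OF dst] using that dst
    by (simp add: len outdeg nth_eq_iff_index_eq adj)
  have asym: "adj i j \<longleftrightarrow> adj j i" for i j using sym by (auto simp: adj)
  have airr: "\<not> adj i i" for i using irr by (simp add: adj)
  have "A $$ (i, j) = A $$ (j, i)" if "i < 12" "j < 12" for i j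
    using entry[OF that] entry[OF that(2,1)] asym[of i j] by auto
  moreover have "poly (char_poly A) (real k) = 0" if "k < 12" for k
    using spec[OF that] by (simp add: A_def)
  ultimately obtain g where "eigenbasis (\<lambda>i j. A $$ (i, j)) g"
    using eigenbasis_exists[OF Ac] by blast
  then interpret eigenbasis "\<lambda>i j. A $$ (i, j)" g .
  have cardN: "(\<Sum>j<12. if adj i j then 1 else 0) = real (?d i)" for i
    by (simp add: vdeg_def sum.If_cases Int_def)
  have diag: "A $$ (i, i) = real (?d i)" if "i < 12" for i using that by (simp add: entry airr)
  have "(\<Sum>i<12. real (?d i)) = 66"
    using traces(1) by (simp add: diag)
  then have "real_of_int (\<Sum>i<12. int (?d i)) = 66" by simp
  then show t1: "(\<Sum>i<12. int (?d i)) = 66" by linarith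
  have "(\<Sum>j<12. (A $$ (j, i))\<^sup>2) = (real (?d i))\<^sup>2 + real (?d i)" if "i < 12" for i
  proof -
    have "(\<Sum>j<12. (A $$ (j, i))\<^sup>2) = (\<Sum>j<12. (if j = i then (real (?d i))\<^sup>2 else 0) + (if adj i j then 1 else 0))"
      using that airr asym[of i] by (intro sum.cong refl) (auto simp: entry)
    also have "\<dots> = (real (?d i))\<^sup>2 + real (?d i)" using that by (simp add: sum.distrib cardN)
    finally show ?thesis .
  qed
  then have "(\<Sum>i<12. (real (?d i))\<^sup>2 + real (?d i)) = 506"
    using traces(2) by simp
  then have "(\<Sum>i<12. (real (?d i))\<^sup>2) = 440"
    using \<open>(\<Sum>i<12. real (?d i)) = 66\<close> by (simp add: sum.distrib)
  then have "real_of_int (\<Sum>i<12. (int (?d i))\<^sup>2) = 440" by simp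
  then show "(\<Sum>i<12. (int (?d i))\<^sup>2) = 440" by linarith
  \<comment> \<open>On integer vectors the matrix acts as the integral Laplacian, so the forms transfer.\<close>
  have row: "(\<Sum>j<12. A $$ (i, j) * x j) = real (?d i) * x i - (\<Sum>j<12. if adj i j then x j else 0)" if "i < 12" for i x
  proof -
    have "(\<Sum>j<12. A $$ (i, j) * x j) = (\<Sum>j<12. (if j = i then real (?d i) * x i else 0) - (if adj i j then x j else 0))"
      using that by (intro sum.cong refl) (auto simp: entry airr)
    then show ?thesis using that by (simp add: sum_subtractf)
  qed
  show "nonneg_forms {..<12} adj"
  proof
    fix q l r :: int and x :: "nat \<Rightarrow> int"
    assume p: "\<forall>t\<in>{1..11}. 0 \<le> q * t\<^sup>2 + l * t + r"
    let ?X = "\<lambda>i. real_of_int (x i)"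
    have act: "act ?X i = real_of_int (lap {..<12} adj x i)" if "i < 12" for i
    proof -
      have "(\<Sum>j<12. if adj i j then ?X j else 0) = real_of_int (\<Sum>j<12. if adj i j then x j else 0)"
        unfolding of_int_sum by (intro sum.cong) auto
      then show ?thesis using row[OF that, of ?X] by (simp add: act_def lap_def)
    qed
    have "0 \<le> 12 * (real_of_int q * (\<Sum>i<12. act ?X i * act ?X i) + real_of_int l * (\<Sum>i<12. ?X i * act ?X i)
      + real_of_int r * (\<Sum>i<12. ?X i * ?X i)) - real_of_int r * (\<Sum>i<12. ?X i)\<^sup>2"
    proof (rule form_real)
      show "(\<Sum>j<12. A $$ (i, j)) = 0" if "i < 12" for i
        using row[OF that, of "\<lambda>_. 1"] by (simp add: cardN)
      show "0 \<le> real_of_int q * (real t)\<^sup>2 + real_of_int l * real t + real_of_int r" if "t \<in> {1..<12}" for t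
      proof -
        have "0 \<le> q * (int t)\<^sup>2 + l * int t + r" using p that by auto
        then have "0 \<le> real_of_int (q * (int t)\<^sup>2 + l * int t + r)" by linarith
        then show ?thesis by simp
      qed
    qed
    also have "\<dots> = real_of_int (form q l r {..<12} adj x)"
      by (simp add: form_def act power2_eq_square)
    finally show "0 \<le> form q l r {..<12} adj x" by linarith
  qed (use asym airr in auto)
qed

section \<open>A certified search over partial graphs\<close>

text \<open>
  A cut is a linear inequality for the numbers of neighbours that the next vertex has in the cells.
  \<open>H j\<close>: the vertices that have more than \<open>j\<close> explored neighbours must fit into the
  remaining degrees above \<open>j\<close>. \<open>L j\<close>: dually, the vertices with at most \<open>j\<close> explored neighbours must
  fit into the remaining degrees that they can still reach. \<open>Q a (\<xi> # xs)\<close>: the form with index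
  \<open>a\<close> is nonnegative at the vector with coefficient \<open>\<xi>\<close> at the next vertex and \<open>xs\<close> at the explored
  ones, latest first.
\<close>
datatype cut = H nat | L nat | Q int "int list"

text \<open>
  \<open>C i\<close> explores some vertex of the \<open>i\<close>-th cell, with a case distinction on its degree; \<open>D d\<close>
  explores some vertex of degree \<open>d\<close>, with a case distinction on its cell. The certificates of the
  partial graphs that survive the cuts follow in the order in which they are enumerated. The names
  of the constructors are short because they occur thousands of times.
\<close>
datatype cert = C nat "cut list" "cert list" | D nat "cut list" "cert list"

text \<open>
  A cut after the part of its evaluation that does not depend on the cell and the degree of the
  next vertex.
\<close>
datatype ready_cut = PH nat | PL nat | PQ int int int "int list" "int list"

text \<open>
  An explored vertex is given by its degree and its adjacency to the explored vertices, latest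
  first; a cell by its size and the adjacency of its members to the explored vertices; a weighted
  cell carries in addition the coefficients of its neighbour count in the cuts. The last component
  of a state holds the degrees of the unexplored vertices.

  All functions below are first-order recursions over lists and natural numbers, without
  \<open>let\<close> and with few abstractions, because the simplifier evaluates them: it brings
  the arguments into normal form before it unfolds a function.
\<close>
type_synonym procs = "(int \<times> bool list) list"
type_synonym cells = "(nat \<times> bool list) list"
type_synonym wcells = "(nat \<times> bool list \<times> int list) list"
type_synonym state = "procs \<times> cells \<times> nat list"

fun ones :: "bool list \<Rightarrow> nat" where
  "ones [] = 0" | "ones (True # m) = Suc (ones m)" | "ones (False # m) = ones m"

fun masked_sum :: "bool list \<Rightarrow> int list \<Rightarrow> int" where
  "masked_sum [] xs = 0" | "masked_sum (b # m) [] = 0"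
| "masked_sum (True # m) (x # xs) = x + masked_sum m xs" | "masked_sum (False # m) (x # xs) = masked_sum m xs"

fun list_inner :: "int list \<Rightarrow> int list \<Rightarrow> int" where
  "list_inner [] ys = 0" | "list_inner (x # xs) [] = 0" | "list_inner (x # xs) (y # ys) = x * y + list_inner xs ys"

fun list_comb :: "int \<Rightarrow> int list \<Rightarrow> int \<Rightarrow> int list \<Rightarrow> int list" where
  "list_comb a [] b ys = []" | "list_comb a (x # xs) b [] = []" | "list_comb a (x # xs) b (y # ys) = (a * x + b * y) # list_comb a xs b ys"

fun list_scale :: "int \<Rightarrow> int list \<Rightarrow> int list" where
  "list_scale a [] = []" | "list_scale a (x # xs) = a * x # list_scale a xs"

fun lap_list :: "procs \<Rightarrow> int list \<Rightarrow> int list \<Rightarrow> int list" where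
  "lap_list [] xs z = []" | "lap_list (p # P) [] z = []"
| "lap_list ((d, m) # P) (x # xs) z = (d * x - masked_sum m z) # lap_list P xs z"

fun nat_times :: "nat \<Rightarrow> int \<Rightarrow> int" where "nat_times 0 y = 0" | "nat_times (Suc n) y = y + nat_times n y"

fun cells_square :: "cells \<Rightarrow> int list \<Rightarrow> int" where
  "cells_square [] z = 0" | "cells_square ((k, m) # cs) z = nat_times k (masked_sum m z * masked_sum m z) + cells_square cs z"

text \<open>
  The expansion of \<open>form_add_vertex\<close> as a polynomial in the degree of the next vertex. The arguments
  \<open>y\<close> and \<open>s\<close> are the values of the Laplacian at the explored vertices and the sum
  of the vector.
\<close>
definition prepare_quad :: "cells \<Rightarrow> int \<Rightarrow> int list \<Rightarrow> int list \<Rightarrow> int \<Rightarrow> int \<Rightarrow> int \<Rightarrow> int \<Rightarrow> ready_cut" where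
  "prepare_quad cs xi xs y q l k s =
     PQ (12 * (q * (list_inner y y + cells_square cs xs) + l * list_inner xs y + k * list_inner xs xs) - k * (s * s) - 2 * xi * k * s + 11 * k * (xi * xi))
        (12 * xi * xi * q) (12 * xi * xi * (q + l)) (list_comb (24 * xi * q) y (24 * xi * l) xs) (list_scale (24 * xi * q) xs)"

text \<open>
  A vector of the wrong length is replaced by the cut \<open>H 12\<close>, which excludes nothing.
\<close>
fun prepare :: "procs \<Rightarrow> cells \<Rightarrow> cut \<Rightarrow> ready_cut" where
  "prepare P cs (H j) = PH j" | "prepare P cs (L j) = PL j" 
| "prepare P cs (Q a []) = PH 12"
| "prepare P cs (Q a (xi # xs)) = (if length xs = length P
    then prepare_quad cs xi xs (lap_list P xs xs) (coef2 a) (coef1 a) (coef0 a) (sum_list xs) else PH 12)"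

fun prepare_all where "prepare_all P cs [] = []" | "prepare_all P cs (c # cts) = prepare P cs c # prepare_all P cs cts"

fun slope :: "bool list \<Rightarrow> ready_cut \<Rightarrow> int" where
  "slope m (PH j) = (if ones m = j then - 1 else 0)"
| "slope m (PL j) = (if ones m = j then 1 else 0)"
| "slope m (PQ c0 c1 c2 w z) = masked_sum m z"

fun slopes where "slopes m [] = []" | "slopes m (c # cs) = slope m c # slopes m cs"

fun weigh :: "cells \<Rightarrow> ready_cut list \<Rightarrow> wcells" where "weigh [] pc = []" | "weigh ((k, m) # cs) pc = (k, m, slopes m pc) # weigh cs pc"

fun count_above :: "nat \<Rightarrow> nat list \<Rightarrow> nat" where
  "count_above j [] = 0" | "count_above j (r # R) = (if j < r then Suc (count_above j R) else count_above j R)"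

fun size_above :: "nat \<Rightarrow> wcells \<Rightarrow> nat" where
  "size_above j [] = 0" | "size_above j ((k, m, w) # cs) = (if j < ones m then k + size_above j cs else size_above j cs)"

fun count_below :: "nat \<Rightarrow> nat list \<Rightarrow> nat" where
  "count_below j [] = 0" | "count_below j (r # R) = (if r < j then Suc (count_below j R) else count_below j R)"

fun size_upto :: "nat \<Rightarrow> wcells \<Rightarrow> nat" where
  "size_upto j [] = 0" | "size_upto j ((k, m, w) # cs) = (if ones m \<le> j then k + size_upto j cs else size_upto j cs)"

fun base :: "wcells \<Rightarrow> bool list \<Rightarrow> int \<Rightarrow> nat list \<Rightarrow> ready_cut \<Rightarrow> int" where
  "base cs m d R (PH j) = int (count_above j R) - int (size_above j cs)"
| "base cs m d R (PL j) = int (count_below (j + length R) R) - int (size_upto j cs)"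
| "base cs m d R (PQ c0 c1 c2 w z) = c0 - masked_sum m w + d * (c1 * d + c2 - masked_sum m z)"

fun bases where "bases cs m d R [] = []" | "bases cs m d R (c # cts) = base cs m d R c # bases cs m d R cts"

fun nonneg :: "int list \<Rightarrow> bool" where "nonneg [] = True" | "nonneg (b # bs) = (if b < 0 then False else nonneg bs)"

fun list_add :: "int list \<Rightarrow> int list \<Rightarrow> int list" where
  "list_add [] ys = []" | "list_add (x # xs) [] = x # xs" | "list_add (x # xs) (y # ys) = (x + y) # list_add xs ys"

fun add_cell :: "nat \<Rightarrow> bool list \<Rightarrow> cells \<Rightarrow> cells" where
  "add_cell 0 m acc = acc" | "add_cell (Suc k) m acc = (Suc k, m) # acc"

fun total_size :: "wcells \<Rightarrow> nat" where "total_size [] = 0" | "total_size ((k, m, w) # cs) = k + total_size cs"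

text \<open>
  All ways to distribute the neighbours of the next vertex that are still \<open>left\<close> over the cells, as the lists of
  cells that result. The bases \<open>bs\<close> are the values of the cuts so far. The head cell is
  moved one vertex at a time: \<open>t\<close> counts its members that are already neighbours, and its first component counts
  the others. The comparisons with \<open>total_size\<close> cut off distributions that cannot place
  all neighbours.
\<close>
function splits :: "wcells \<Rightarrow> nat \<Rightarrow> int list \<Rightarrow> nat \<Rightarrow> cells \<Rightarrow> cells list" where
  "splits [] left bs t acc = (if left = 0 then if nonneg bs then [acc] else [] else [])"
| "splits ((k, m, w) # cs) 0 bs t acc = splits cs 0 bs 0 (add_cell k (False # m) (add_cell t (True # m) acc))"
| "splits ((0, m, w) # cs) (Suc l) bs t acc = splits cs (Suc l) bs 0 (add_cell t (True # m) acc)"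
| "splits ((Suc k, m, w) # cs) (Suc l) bs t acc = 
     (if total_size cs \<le> l then [] else splits cs (Suc l) bs 0 (add_cell (Suc k) (False # m) (add_cell t (True # m) acc)))
     @ (if k + total_size cs < l then [] else splits ((k, m, w) # cs) l (list_add bs w) (Suc t) acc)"
  by pat_completeness auto
termination by (relation "measure (\<lambda>(cs, l, _). length cs + l)") auto

fun extend_masks :: "procs \<Rightarrow> bool list \<Rightarrow> procs" where "extend_masks ((d, m') # P) (b # m) = (d, b # m') # extend_masks P m" | "extend_masks _ _ = []"

fun take_one :: "nat \<Rightarrow> wcells \<Rightarrow> wcells" where "take_one 0 ((k, m, w) # cs) = (k - 1, m, w) # cs" | "take_one (Suc i) (c # cs) = c # take_one i cs" | "take_one i [] = []"

fun with_cells where "with_cells P R [] = []" | "with_cells P R (c # cs) = (P, c, R) # with_cells P R cs"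

definition branch :: "procs \<Rightarrow> wcells \<Rightarrow> nat list \<Rightarrow> ready_cut list \<Rightarrow> nat \<Rightarrow> bool list \<Rightarrow> state list" where
 "branch P cs R pcs d m = (if d < ones m then [] else
    with_cells ((int d, False # m) # extend_masks P m) R (splits cs (d - ones m) (bases cs m (int d) R pcs) 0 []))"

fun expand :: "procs \<Rightarrow> cells \<Rightarrow> wcells \<Rightarrow> nat list \<Rightarrow> ready_cut list \<Rightarrow> (nat \<times> nat) list \<Rightarrow> state list" where
  "expand P cs ws R pcs [] = []"
| "expand P cs ws R pcs ((i, d) # ps) = branch P (take_one i ws) (remove1 d R) pcs d (snd (cs ! i)) @ expand P cs ws R pcs ps"

fun successors where "successors P cs R pcs ps = expand P cs (weigh cs pcs) R pcs ps"

fun with_cell where "with_cell i [] = []" | "with_cell i (d # ds) = (i, d) # with_cell i ds"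

fun with_degree where "with_degree d i [] = []" | "with_degree d i (c # cs) = (i, d) # with_degree d (Suc i) cs"

fun check :: "state \<Rightarrow> cert \<Rightarrow> bool" and checks :: "state list \<Rightarrow> cert list \<Rightarrow> bool" where
  "check (P, cs, R) (C i cuts subs) =
     (i < length cs \<and> 0 < fst (cs ! i) \<and> checks (successors P cs R (prepare_all P cs cuts) (with_cell i (remdups R))) subs)"
| "check (P, cs, R) (D d cuts subs) =
     (d \<in> set R \<and> checks (successors P cs R (prepare_all P cs cuts) (with_degree d 0 cs)) subs)"
| "checks [] subs = True"
| "checks (s # ss) [] = False"
| "checks (s # ss) (c # subs) = (check s c \<and> checks ss subs)"

section \<open>Vectors supported on the explored vertices\<close>

text \<open>
  On the cells, which are disjoint from the explored vertices \<open>ps\<close>, a supported vector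
  vanishes and its Laplacian depends on the adjacency to \<open>ps\<close> only.
\<close>
fun supported :: "'a list \<Rightarrow> int list \<Rightarrow> 'a \<Rightarrow> int" where
  "supported [] xs u = 0" | "supported (p # ps) [] u = 0"
| "supported (p # ps) (x # xs) u = (if u = p then x else supported ps xs u)"

lemma supported_outside: "u \<notin> set ps \<Longrightarrow> supported ps xs u = 0"
  by (induction ps xs u rule: supported.induct) auto

lemma map_supported: "distinct ps \<Longrightarrow> length xs = length ps \<Longrightarrow> map (supported ps xs) ps = xs"
proof (induction ps arbitrary: xs)
  case (Cons p ps)
  then obtain x ys where xs: "xs = x # ys" by (cases xs) auto
  have "map (supported (p # ps) xs) ps = map (supported ps ys) ps"
    using Cons.prems by (auto simp: xs)
  also have "\<dots> = ys" using Cons by (simp add: xs)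
  finally have "map (supported (p # ps) xs) ps = ys" .
  moreover have "supported (p # ps) xs p = x" by (simp add: xs)
  ultimately show ?case by (simp only: list.map xs)
qed simp

lemma sum_supported:
  assumes "finite V" "distinct ps" "set ps \<subseteq> V" "length xs = length ps"
  shows "(\<Sum>u\<in>V. f u * supported ps xs u) = list_inner (map f ps) xs"
  using assms(2-)
proof (induction ps arbitrary: xs)
  case (Cons p ps)
  then obtain x ys where xs: "xs = x # ys" by (cases xs) auto
  have *: "f u * supported (p # ps) xs u = (if u = p then f p * x else 0) + f u * supported ps ys u" for u
    using Cons.prems by (auto simp: xs supported_outside)
  have "(\<Sum>u\<in>V. f u * supported (p # ps) xs u) = f p * x + (\<Sum>u\<in>V. f u * supported ps ys u)"
    unfolding * sum.distrib using Cons.prems assms(1) by (simp add: sum.delta)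
  also have "\<dots> = list_inner (map f (p # ps)) xs"
    using Cons by (simp add: xs)
  finally show ?case .
qed simp

lemma masked_sum_inner: "masked_sum (map b ps) xs = list_inner (map (\<lambda>p. if b p then 1 else 0) ps) xs"
proof (induction ps arbitrary: xs)
  case (Cons p ps) then show ?case by (cases xs; cases "b p") auto
qed simp

lemma list_inner_map: "list_inner (map f ps) (map g ps) = sum_list (map (\<lambda>p. f p * g p) ps)"
  by (induction ps) auto

lemma masked_sum_scale: "masked_sum m (list_scale a xs) = a * masked_sum m xs"
proof (induction m arbitrary: xs)
  case (Cons b m) then show ?case by (cases xs; cases b) (auto simp: algebra_simps)
qed simp

lemma masked_sum_comb: "length xs = length ys \<Longrightarrow> masked_sum m (list_comb a xs b ys) = a * masked_sum m xs + b * masked_sum m ys"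
proof (induction m arbitrary: xs ys)
  case (Cons c m) then show ?case by (cases xs; cases ys; cases c) (auto simp: algebra_simps)
qed simp

lemma nat_times: "nat_times n y = int n * y"
  by (induction n) (auto simp: algebra_simps)

lemma masked_sum_map: "masked_sum (map b ps) (map f ps) = sum_list (map (\<lambda>p. if b p then f p else 0) ps)"
proof (induction ps)
  case (Cons p ps) then show ?case by (cases "b p") auto
qed simp

lemma ones_map: "distinct ps \<Longrightarrow> ones (map b ps) = card {p \<in> set ps. b p}"
proof (induction ps)
  case (Cons p ps)
  have "{q \<in> set (p # ps). b q} = (if b p then insert p {q \<in> set ps. b q} else {q \<in> set ps. b q})"
    by auto
  then show ?case using Cons by (cases "b p") auto
qed simp

definition cell :: "'a set \<Rightarrow> ('a \<Rightarrow> 'a \<Rightarrow> bool) \<Rightarrow> 'a list \<Rightarrow> 'a set \<Rightarrow> nat \<times> bool list \<Rightarrow> bool" where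
  "cell V adj ps A c \<longleftrightarrow> A \<subseteq> V \<and> card A = fst c \<and> (\<forall>u\<in>A. map (adj u) ps = snd c)"

definition processed :: "'a set \<Rightarrow> ('a \<Rightarrow> 'a \<Rightarrow> bool) \<Rightarrow> 'a list \<Rightarrow> 'a \<Rightarrow> int \<times> bool list \<Rightarrow> bool" where
  "processed V adj ps p c \<longleftrightarrow> fst c = int (vdeg V adj p) \<and> snd c = map (adj p) ps"

text \<open>
  The partition of \<open>V\<close> is stated as an equation between multisets. It makes the explored vertices distinct and
  the cells disjoint, and sums over \<open>V\<close> and the multiset of degrees split along it.
\<close>
fun represents :: "'a set \<Rightarrow> ('a \<Rightarrow> 'a \<Rightarrow> bool) \<Rightarrow> 'a list \<Rightarrow> 'a set list \<Rightarrow> state \<Rightarrow> bool" where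
  "represents V adj ps As (P, cs, R) \<longleftrightarrow> list_all2 (processed V adj ps) ps P \<and> list_all2 (cell V adj ps) As cs
     \<and> mset_set V = mset ps + sum_list (map mset_set As)
     \<and> mset R = image_mset (vdeg V adj) (sum_list (map mset_set As))"

lemma sum_mset_cells:
  "sum_mset (image_mset f (sum_list (map mset_set As))) = sum_list (map (sum f) As)"
  by (induction As) (auto simp: sum_unfold_sum_mset)

lemma sum_partition:
  assumes "mset_set V = mset ps + sum_list (map mset_set As)"
  shows "sum f V = sum_list (map f ps) + sum_list (map (sum f) As)"
proof -
  have "sum f V = sum_mset (image_mset f (mset ps + sum_list (map mset_set As)))"
    unfolding sum_unfold_sum_mset assms ..
  also have "\<dots> = sum_mset (mset (map f ps)) + sum_list (map (sum f) As)"
    by (simp only: image_mset_union sum_mset.union sum_mset_cells mset_map)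
  finally show ?thesis by (simp only: sum_mset_sum_list)
qed

lemma partition_distinct:
  assumes "finite V" "mset_set V = mset ps + sum_list (map mset_set As)"
  shows "distinct ps" "set ps \<subseteq> V" "sum_list (map mset_set As) = mset_set (V - set ps)"
proof -
  have "mset ps \<subseteq># mset_set V" using assms(2) by simp
  then have c: "count (mset ps) x \<le> count (mset_set V) x" for x by (simp add: mset_subset_eq_count)
  show sub: "set ps \<subseteq> V"
  proof
    fix x assume "x \<in> set ps"
    then have "count (mset ps) x > 0" by simp
    then have "count (mset_set V) x > 0" using c[of x] by linarith
    then show "x \<in> V" using assms(1) by (simp add: count_mset_set' split: if_splits)
  qed
  have "count (mset_set V) x \<le> 1" for x by (simp add: count_mset_set')
  then have "count (mset ps) x \<le> 1" for x using c[of x] le_trans by blast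
  then have "count (mset ps) x = (if x \<in> set ps then 1 else 0)" for x
    by (metis count_mset_0_iff le_antisym less_one not_le)
  then show d: "distinct ps" using distinct_count_atmost_1 by blast
  have "sum_list (map mset_set As) = mset_set V - mset ps" using assms(2) by simp
  also have "mset ps = mset_set (set ps)" using d by (simp add: mset_set_set)
  also have "mset_set V - mset_set (set ps) = mset_set (V - set ps)"
    using sub assms(1) by (simp add: mset_set_Diff)
  finally show "sum_list (map mset_set As) = mset_set (V - set ps)" .
qed

lemma lap_list:
  assumes "list_all2 (processed V adj qs) ps P"
  shows "lap_list P (map x ps) z = map (\<lambda>p. int (vdeg V adj p) * x p - masked_sum (map (adj p) qs) z) ps"
  using assms by (induction rule: list_all2_induct) (auto simp: processed_def split: prod.splits)

lemma cells_square:
  assumes "list_all2 (cell V adj ps) As cs" "finite V"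
  shows "cells_square cs xs = sum_list (map (\<lambda>A. \<Sum>u\<in>A. (masked_sum (map (adj u) ps) xs)\<^sup>2) As)"
  using assms(1)
proof (induction rule: list_all2_induct)
  case (Cons A As c cs)
  obtain k m where c: "c = (k, m)" by (cases c)
  have "(\<Sum>u\<in>A. (masked_sum (map (adj u) ps) xs)\<^sup>2) = (\<Sum>u\<in>A. (masked_sum m xs)\<^sup>2)"
    using Cons.hyps by (intro sum.cong) (auto simp: cell_def c)
  then show ?case using Cons by (simp add: c nat_times cell_def power2_eq_square)
qed simp

context nonneg_forms
begin

lemma lap_supported:
  assumes "distinct ps" "set ps \<subseteq> V" "length xs = length ps"
  shows "lp (supported ps xs) u = int (dg u) * supported ps xs u - masked_sum (map (adj u) ps) xs"
proof -
  have "(\<Sum>w\<in>V. if adj u w then supported ps xs w else 0) = (\<Sum>w\<in>V. (if adj u w then 1 else 0) * supported ps xs w)"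
    by (intro sum.cong) auto
  also have "\<dots> = masked_sum (map (adj u) ps) xs"
    using sum_supported[OF fin assms, of "\<lambda>w. if adj u w then 1 else 0"] by (simp add: masked_sum_inner)
  finally show ?thesis by (simp add: lap_def)
qed

end

section \<open>Completeness of the enumeration\<close>

lemma card_filter_cells:
  assumes "\<forall>A\<in>set As. finite A"
  shows "size (filter_mset P (image_mset f (sum_list (map mset_set As)))) = sum_list (map (\<lambda>A. card {u \<in> A. P (f u)}) As)"
  using assms
proof (induction As)
  case (Cons A As)
  have "size (filter_mset P (image_mset f (mset_set A))) = card {u \<in> A. P (f u)}"
    using Cons.prems by (simp add: filter_mset_image_mset)
  then show ?case using Cons by simp
qed simp

lemma count_above: "count_above j R = size (filter_mset (\<lambda>r. j < r) (mset R))"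
  by (induction R) auto

lemma count_below: "count_below j R = size (filter_mset (\<lambda>r. r < j) (mset R))"
  by (induction R) auto

fun split_cells :: "wcells \<Rightarrow> nat list \<Rightarrow> nat \<Rightarrow> cells \<Rightarrow> cells" where
  "split_cells ((k, m, w) # cs) (c # ts) t acc = split_cells cs ts 0 (add_cell (k - c) (False # m) (add_cell (t + c) (True # m) acc))"
| "split_cells _ _ t acc = acc"

fun add_weights :: "int list \<Rightarrow> wcells \<Rightarrow> nat list \<Rightarrow> int list" where
  "add_weights bs ((k, m, w) # cs) (c # ts) = add_weights (((\<lambda>b. list_add b w) ^^ c) bs) cs ts"
| "add_weights bs _ _ = bs"

abbreviation fits :: "wcells \<Rightarrow> nat list \<Rightarrow> bool" where "fits \<equiv> list_all2 (\<lambda>w c. c \<le> fst w)"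

lemma fits_total: "fits cs ts \<Longrightarrow> sum_list ts \<le> total_size cs"
  by (induction rule: list_all2_induct) auto

text \<open>
  The neighbour counts \<open>ts\<close> are relative: the head of \<open>ts\<close> counts what is still to be moved out of
  the head cell, on top of the \<open>t\<close> vertices that were moved before. With this reading the two
  recursive calls of \<open>splits\<close> match the cases \<open>0\<close> and \<open>Suc\<close> of the head of \<open>ts\<close>.
\<close>
lemma splits_complete:
  assumes "fits cs ts" "sum_list ts = left" "nonneg (add_weights bs cs ts)"
  shows "split_cells cs ts t acc \<in> set (splits cs left bs t acc)"
  using assms
proof (induction cs left bs t acc arbitrary: ts rule: splits.induct)
  case (1 left bs t acc)
  then show ?case by simp
next
  case (2 k m w cs bs t acc)
  then obtain c ts' where ts: "ts = c # ts'" by (cases ts) auto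
  then have "c = 0" "sum_list ts' = 0" using 2 by auto
  then show ?case using 2 by (auto simp: ts)
next
  case (3 m w cs l bs t acc)
  then obtain c ts' where ts: "ts = c # ts'" by (cases ts) auto
  then have "c = 0" using 3 by auto
  then show ?case using 3 by (auto simp: ts)
next
  case (4 k m w cs l bs t acc)
  then obtain c ts' where ts: "ts = c # ts'" by (cases ts) auto
  have f: "fits cs ts'" using 4 by (simp add: ts)
  show ?case
  proof (cases c)
    case 0
    then have s: "sum_list ts' = Suc l" using 4 by (simp add: ts)
    then have "\<not> total_size cs \<le> l" using fits_total[OF f] by simp
    moreover have "split_cells cs ts' 0 (add_cell (Suc k) (False # m) (add_cell t (True # m) acc))
        \<in> set (splits cs (Suc l) bs 0 (add_cell (Suc k) (False # m) (add_cell t (True # m) acc)))"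
      using 4 s f 0 \<open>\<not> total_size cs \<le> l\<close> by (simp add: ts)
    ultimately show ?thesis by (simp add: ts 0)
  next
    case (Suc c')
    then have s: "sum_list (c' # ts') = l" "c' \<le> k" using 4 by (simp_all add: ts)
    then have "\<not> k + total_size cs < l" using fits_total[OF f] by simp
    moreover have eq: "((\<lambda>b. list_add b w) ^^ c') (list_add bs w) = ((\<lambda>b. list_add b w) ^^ c) bs"
      using funpow_swap1[of "\<lambda>b. list_add b w" c' bs] by (simp add: Suc)
    moreover have "split_cells ((k, m, w) # cs) (c' # ts') (Suc t) acc \<in> set (splits ((k, m, w) # cs) l (list_add bs w) (Suc t) acc)"
      using 4 s f Suc \<open>\<not> k + total_size cs < l\<close> eq by (intro "4.IH"(2)) (simp_all add: ts del: funpow.simps)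
    ultimately show ?thesis by (simp add: ts Suc)
  qed
qed

lemma list_add_map: "list_add (map f xs) (map g xs) = map (\<lambda>x. f x + g x) xs"
  by (induction xs) auto

lemma list_add_funpow: "((\<lambda>b. list_add b (map g xs)) ^^ n) (map f xs) = map (\<lambda>x. f x + int n * g x) xs"
  by (induction n) (auto simp: list_add_map algebra_simps)

lemma slopes_map: "slopes m pcs = map (slope m) pcs" by (induction pcs) auto

lemma bases_map: "bases cs m d R pcs = map (base cs m d R) pcs" by (induction pcs) auto

lemma prepare_all_map: "prepare_all P cs cuts = map (prepare P cs) cuts" by (induction cuts) auto

lemma nonneg_all: "nonneg bs \<longleftrightarrow> (\<forall>b\<in>set bs. 0 \<le> b)" by (induction bs) auto

lemma weigh_map: "weigh cs pcs = map (\<lambda>(k, m). (k, m, slopes m pcs)) cs"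
  by (induction cs) auto

lemma with_cells_map: "with_cells P R css = map (\<lambda>cs. (P, cs, R)) css" by (induction css) auto

lemma with_cell_map: "with_cell i ds = map (Pair i) ds" by (induction ds) auto

lemma with_degree_map: "with_degree d i cs = map (\<lambda>j. (j, d)) [i..<i + length cs]"
  by (induction cs arbitrary: i) (simp_all add: upt_conv_Cons del: upt_Suc)

fun weight :: "ready_cut \<Rightarrow> wcells \<Rightarrow> nat list \<Rightarrow> int" where
  "weight pc ((k, m, w) # cs) (c # ts) = int c * slope m pc + weight pc cs ts"
| "weight pc _ _ = 0"

lemma add_weights:
  assumes "\<forall>(k, m, w)\<in>set cs. w = slopes m pcs"
  shows "add_weights (map f pcs) cs ts = map (\<lambda>pc. f pc + weight pc cs ts) pcs"
  using assms
proof (induction cs arbitrary: ts f)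
  case (Cons c cs)
  obtain k m w where c: "c = (k, m, w)" by (cases c)
  show ?case
  proof (cases ts)
    case (Cons t ts')
    have "add_weights (map f pcs) (c # cs) ts = add_weights (map (\<lambda>pc. f pc + int t * slope m pc) pcs) cs ts'"
      using Cons.prems by (simp add: c Cons slopes_map list_add_funpow)
    then show ?thesis using Cons.IH Cons.prems by (simp add: c Cons)
  qed simp
qed simp

definition wcell :: "'a set \<Rightarrow> ('a \<Rightarrow> 'a \<Rightarrow> bool) \<Rightarrow> 'a list \<Rightarrow> 'a set \<Rightarrow> nat \<times> bool list \<times> int list \<Rightarrow> bool" where
  "wcell V adj ps A c \<longleftrightarrow> A \<subseteq> V \<and> card A = fst c \<and> (\<forall>u\<in>A. map (adj u) ps = fst (snd c))"

lemma wcell_simp: "wcell V adj ps A (k, m, w) \<longleftrightarrow> cell V adj ps A (k, m)"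
  by (simp add: wcell_def cell_def)

lemma cell_weigh: "list_all2 (cell V adj ps) As cs \<Longrightarrow> list_all2 (wcell V adj ps) As (weigh cs pcs)"
  by (induction rule: list_all2_induct) (auto simp: wcell_simp)

lemma weigh_weights: "\<forall>(k, m, w)\<in>set (weigh cs pcs). w = slopes m pcs"
  by (auto simp: weigh_map)

lemma take_one_weights: "\<forall>(k, m, w)\<in>set ws. w = slopes m pcs \<Longrightarrow> \<forall>(k, m, w)\<in>set (take_one i ws). w = slopes m pcs"
  by (induction i ws rule: take_one.induct) auto

lemma take_one_wcell:
  assumes "list_all2 (wcell V adj ps) As ws" "i < length As" "v \<in> As ! i" "finite V"
  shows "list_all2 (wcell V adj ps) (As[i := As ! i - {v}]) (take_one i ws)"
  using assms
proof (induction As ws arbitrary: i rule: list_all2_induct)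
  case (Cons A As w ws)
  obtain k m z where w: "w = (k, m, z)" by (cases w)
  show ?case
  proof (cases i)
    case 0
    then have "wcell V adj ps (A - {v}) (k - 1, m, z)"
      using Cons by (auto simp: wcell_def w card_Diff_singleton_if finite_subset)
    then show ?thesis using Cons 0 by (simp add: w)
  next
    case (Suc j)
    then show ?thesis using Cons by simp
  qed
qed simp

lemma mset_cells_update:
  assumes "i < length As" "v \<in> As ! i" "\<forall>A\<in>set As. finite A"
  shows "sum_list (map mset_set As) = add_mset v (sum_list (map mset_set (As[i := As ! i - {v}])))"
  using assms
proof (induction As arbitrary: i)
  case (Cons A As)
  then show ?case
    by (cases i) (auto simp: mset_set.remove)
qed simp

fun add_set :: "'a set \<Rightarrow> 'a set list \<Rightarrow> 'a set list" where
  "add_set A As = (if A = {} then As else A # As)"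

fun split_sets :: "'a set \<Rightarrow> 'a set list \<Rightarrow> 'a set list \<Rightarrow> 'a set list" where
  "split_sets N [] acc = acc"
| "split_sets N (A # As) acc = split_sets N As (add_set (A - N) (add_set (A \<inter> N) acc))"

lemma add_cell_cell:
  assumes "cell V adj ps A (k, m)" "list_all2 (cell V adj ps) As cs" "finite V"
  shows "list_all2 (cell V adj ps) (add_set A As) (add_cell k m cs)"
proof (cases k)
  case 0
  then have "A = {}" using assms by (auto simp: cell_def finite_subset)
  then show ?thesis using assms 0 by simp
next
  case (Suc n)
  then have "A \<noteq> {}" using assms by (auto simp: cell_def)
  then show ?thesis using assms Suc by simp
qed

lemma split_cell:
  assumes "list_all2 (wcell V adj ps) As ws" "list_all2 (cell V adj (v # ps)) Bs acc" "finite V"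
    and sym: "\<And>u w. adj u w \<longleftrightarrow> adj w u"
  shows "list_all2 (cell V adj (v # ps)) (split_sets {u. adj v u} As Bs)
           (split_cells ws (map (\<lambda>A. card (A \<inter> {u. adj v u})) As) 0 acc)"
  using assms(1,2)
proof (induction As ws arbitrary: Bs acc rule: list_all2_induct)
  case (Cons A As w ws)
  let ?N = "{u. adj v u}"
  obtain k m z where w: "w = (k, m, z)" by (cases w)
  have A: "A \<subseteq> V" "card A = k" "\<forall>u\<in>A. map (adj u) ps = m" "finite A"
    using Cons.hyps assms(3) by (auto simp: wcell_def w finite_subset)
  have "card (A - ?N) = k - card (A \<inter> ?N)"
    using A card_Diff_subset_Int[of A ?N] by simp
  then have "cell V adj (v # ps) (A - ?N) (k - card (A \<inter> ?N), False # m)"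
    using A sym by (auto simp: cell_def)
  moreover have "cell V adj (v # ps) (A \<inter> ?N) (0 + card (A \<inter> ?N), True # m)"
    using A sym by (auto simp: cell_def)
  ultimately have "list_all2 (cell V adj (v # ps)) (add_set (A - ?N) (add_set (A \<inter> ?N) Bs))
      (add_cell (k - card (A \<inter> ?N)) (False # m) (add_cell (0 + card (A \<inter> ?N)) (True # m) acc))"
    using Cons.prems assms(3) by (intro add_cell_cell)
  then show ?case using Cons.IH by (simp add: w del: add_set.simps)
qed simp

lemma split_sets_mset:
  assumes "\<forall>A\<in>set As. finite A"
  shows "sum_list (map mset_set (split_sets N As Bs)) = sum_list (map mset_set As) + sum_list (map mset_set Bs)"
  using assms
proof (induction N As Bs rule: split_sets.induct)
  case (2 N A As acc)
  have "mset_set A = mset_set (A \<inter> N) + mset_set (A - N)"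
    using "2.prems" mset_set_Union[of "A \<inter> N" "A - N"] by (simp add: Int_Diff_Un Int_Diff_disjoint)
  moreover have "sum_list (map mset_set (add_set X Xs)) = mset_set X + sum_list (map mset_set Xs)"
    for X :: "'a set" and Xs by simp
  ultimately show ?case using 2 by (simp del: add_set.simps)
qed simp

lemma extend_masks:
  assumes "list_all2 (processed V adj qs) ps P" "\<And>u w. adj u w \<longleftrightarrow> adj w u"
  shows "list_all2 (processed V adj (v # qs)) ps (extend_masks P (map (adj v) ps))"
  using assms(1)
proof (induction rule: list_all2_induct)
  case (Cons p ps c P)
  then show ?case using assms(2)[of v p] by (cases c) (auto simp: processed_def)
qed simp

section \<open>Soundness of the search\<close>

lemma cells_finite: "list_all2 (cell V adj ps) As cs \<Longrightarrow> finite V \<Longrightarrow> \<forall>A\<in>set As. finite A"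
  by (induction rule: list_all2_induct) (auto simp: cell_def finite_subset)

lemma mset_cell_le: "A \<in> set As \<Longrightarrow> mset_set A \<subseteq># sum_list (map mset_set As)"
  by (induction As) (auto intro: subset_mset.add_increasing)

lemma mset_cellD: "v \<in># sum_list (map mset_set As) \<Longrightarrow> \<forall>A\<in>set As. finite A \<Longrightarrow> \<exists>A\<in>set As. v \<in> A"
  by (induction As) auto

lemma weight_sum:
  assumes "list_all2 (wcell V adj ps) As ws"
  shows "weight pc ws (map f As) = sum_list (map2 (\<lambda>A w. int (f A) * slope (fst (snd w)) pc) As ws)"
  using assms by (induction rule: list_all2_induct) auto

text \<open>
  Cell by cell: if the members have more than \<open>j\<close> explored neighbours, all of them count; if they have
  exactly \<open>j\<close>, those adjacent to \<open>v\<close> do.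
\<close>
lemma size_above_bound:
  assumes "list_all2 (wcell V adj ps) As ws"
    and "\<forall>A\<in>set As. \<forall>u\<in>A. ones (map (adj u) ps) + (if adj v u then 1 else 0) \<le> dg u" "finite V"
  shows "int (size_above j ws) - weight (PH j) ws (map (\<lambda>A. card (A \<inter> {u. adj v u})) As)
     \<le> int (sum_list (map (\<lambda>A. card {u \<in> A. j < dg u}) As))"
  using assms(1,2)
proof (induction rule: list_all2_induct)
  case (Cons A As w ws)
  obtain k m z where w: "w = (k, m, z)" by (cases w)
  have A: "finite A" "card A = k" "\<forall>u\<in>A. map (adj u) ps = m"
    using Cons.hyps assms(3) by (auto simp: wcell_def w finite_subset)
  have d: "ones m + (if adj v u then 1 else 0) \<le> dg u" if "u \<in> A" for u
    using Cons.prems A that by (metis list.set_intros(1))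
  have "(if j < ones m then k else 0) + (if ones m = j then card (A \<inter> {u. adj v u}) else 0) \<le> card {u \<in> A. j < dg u}"
  proof (cases "j < ones m")
    case True
    then have "{u \<in> A. j < dg u} = A" using d by fastforce
    then show ?thesis using True A by simp
  next
    case False
    have "card (A \<inter> {u. adj v u}) \<le> card {u \<in> A. j < dg u}" if "ones m = j"
      using d that A by (intro card_mono) fastforce+
    then show ?thesis using False by simp
  qed
  then show ?case using Cons by (simp add: w split: if_splits)
qed simp

text \<open>
  The dual bound. Here \<open>n\<close> is the number of unexplored vertices other than \<open>v\<close>; as a vertex is not
  its own neighbour, its degree stays strictly below the number of its explored neighbours plus \<open>n\<close>.
\<close>
lemma size_upto_bound:
  assumes "list_all2 (wcell V adj ps) As ws"
    and "\<forall>A\<in>set As. \<forall>u\<in>A. dg u < ones (map (adj u) ps) + (if adj v u then 1 else 0) + n" "finite V"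
  shows "int (size_upto j ws) - weight (PL j) ws (map (\<lambda>A. card (A \<inter> {u. adj v u})) As)
     \<le> int (sum_list (map (\<lambda>A. card {u \<in> A. dg u < j + n}) As))"
  using assms(1,2)
proof (induction rule: list_all2_induct)
  case (Cons A As w ws)
  obtain k m z where w: "w = (k, m, z)" by (cases w)
  have A: "finite A" "card A = k" "\<forall>u\<in>A. map (adj u) ps = m"
    using Cons.hyps assms(3) by (auto simp: wcell_def w finite_subset)
  have d: "dg u < ones m + (if adj v u then 1 else 0) + n" if "u \<in> A" for u
    using Cons.prems A that by (metis list.set_intros(1))
  have "(if ones m \<le> j then k else 0) \<le> card {u \<in> A. dg u < j + n} + (if ones m = j then card (A \<inter> {u. adj v u}) else 0)"
  proof (cases "ones m < j")
    case True
    have "dg u < j + n" if "u \<in> A" for u using d[OF that] True by (simp split: if_splits)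
    then have "{u \<in> A. dg u < j + n} = A" by blast
    then show ?thesis using True A by simp
  next
    case False
    have "card A \<le> card {u \<in> A. dg u < j + n} + card (A \<inter> {u. adj v u})" if "ones m = j"
    proof -
      have "A \<subseteq> {u \<in> A. dg u < j + n} \<union> (A \<inter> {u. adj v u})" using d that by fastforce
      then have "card A \<le> card ({u \<in> A. dg u < j + n} \<union> (A \<inter> {u. adj v u}))" using A by (intro card_mono) auto
      also have "\<dots> \<le> card {u \<in> A. dg u < j + n} + card (A \<inter> {u. adj v u})" by (rule card_Un_le)
      finally show ?thesis .
    qed
    then show ?thesis using False A by auto
  qed
  then show ?case using Cons by (simp add: w split: if_splits)
qed simp

context nonneg_forms
begin

lemma degree_split:
  assumes "distinct ps" "set ps \<subseteq> V"
  shows "dg u = ones (map (adj u) ps) + card {w \<in> V - set ps. adj u w}"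
proof -
  have "{w \<in> V. adj u w} = {w \<in> set ps. adj u w} \<union> {w \<in> V - set ps. adj u w}" using assms by auto
  then have "dg u = card ({w \<in> set ps. adj u w} \<union> {w \<in> V - set ps. adj u w})" by (simp add: vdeg_def)
  also have "\<dots> = card {w \<in> set ps. adj u w} + card {w \<in> V - set ps. adj u w}"
    using fin by (intro card_Un_disjoint) auto
  finally show ?thesis using assms by (simp add: ones_map)
qed

text \<open>
  Every cut is an inequality that holds in the graph, so it never removes the true neighbourhood of
  \<open>v\<close>. For a cut \<open>Q\<close>, the left-hand side is the form at the vector extended by \<open>\<xi>\<close> at \<open>v\<close>.
\<close>
lemma cut_valid:
  assumes represents: "represents V adj ps As (P, cs, R)" and i: "i < length As" and v: "v \<in> As ! i"
    and ws: "ws = weigh cs pcs" and c: "pc = prepare P cs c"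
  shows "0 \<le> base (take_one i ws) (snd (cs ! i)) (int (dg v)) (remove1 (dg v) R) pc
           + weight pc (take_one i ws) (map (\<lambda>A. card (A \<inter> {u. adj v u})) (As[i := As ! i - {v}]))"
proof -
  define As' where "As' = As[i := As ! i - {v}]"
  define m where "m = snd (cs ! i)"
  define R' where "R' = remove1 (dg v) R"
  let ?N = "{u. adj v u}"
  let ?ts = "map (\<lambda>A. card (A \<inter> ?N)) As'"
  have P: "list_all2 (processed V adj ps) ps P" and cells: "list_all2 (cell V adj ps) As cs"
    and part: "mset_set V = mset ps + sum_list (map mset_set As)"
    and R: "mset R = image_mset dg (sum_list (map mset_set As))"
    using represents by auto
  note dst = partition_distinct[OF fin part]
  have finA: "\<forall>A\<in>set As. finite A"
    using cells_finite[OF cells fin] .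
  then have finA': "\<forall>A\<in>set As'. finite A"
    using i set_update_subset_insert[of As i "As ! i - {v}"] unfolding As'_def by (auto dest!: subsetD)
  have part': "sum_list (map mset_set As) = add_mset v (sum_list (map mset_set As'))"
    unfolding As'_def by (rule mset_cells_update[OF i v finA])
  have part2: "mset_set V = mset (v # ps) + sum_list (map mset_set As')"
    using part part' by simp
  note dist2 = partition_distinct[OF fin part2]
  have vV: "v \<in> V" "v \<notin> set ps" using dist2 by auto
  have R': "mset R' = image_mset dg (sum_list (map mset_set As'))"
    by (simp add: R'_def R part')
  have mv: "map (adj v) ps = m"
    using cells i v by (auto simp: m_def list_all2_conv_all_nth cell_def)
  have wc: "list_all2 (wcell V adj ps) As' (take_one i ws)"
    unfolding As'_def ws by (rule take_one_wcell[OF cell_weigh[OF cells] i v fin])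
  have W: "sum_list (map mset_set As') = mset_set (V - set (v # ps))" by (rule dist2)
  have inW: "u \<in> V - set (v # ps)" if "A \<in> set As'" "u \<in> A" for u A
  proof -
    have "mset_set A \<subseteq># sum_list (map mset_set As')"
      using that(1) by (rule mset_cell_le)
    then have "u \<in># mset_set (V - set (v # ps))"
      using that finA' unfolding W by (metis finite_set_mset_mset_set mset_subset_eqD)
    then show ?thesis using fin by simp
  qed
  have vdeg_u: "dg u = ones (map (adj u) ps) + (if adj v u then 1 else 0) + card {w \<in> V - set (v # ps). adj u w}" for u
    using degree_split[OF dist2(1,2), of u] adj_commute[of u v] by simp
  show ?thesis
  proof (cases pc)
    case (PH j)
    have "int (size_above j (take_one i ws)) - weight (PH j) (take_one i ws) ?ts \<le> int (sum_list (map (\<lambda>A. card {u \<in> A. j < dg u}) As'))"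
      using vdeg_u by (intro size_above_bound[OF wc _ fin]) auto
    also have "\<dots> = int (count_above j R')"
      unfolding count_above R' card_filter_cells[OF finA'] ..
    finally show ?thesis by (simp add: PH As'_def R'_def)
  next
    case (PL j)
    have lenR: "length R' = card (V - set (v # ps))"
      using arg_cong[OF R', of size] by (simp add: W)
    have "dg u < ones (map (adj u) ps) + (if adj v u then 1 else 0) + length R'" if "A \<in> set As'" "u \<in> A" for u A
    proof -
      have "{w \<in> V - set (v # ps). adj u w} \<subset> V - set (v # ps)"
        using inW[OF that] adj_irrefl[of u] by auto
      then have "card {w \<in> V - set (v # ps). adj u w} < card (V - set (v # ps))"
        using fin by (intro psubset_card_mono) auto
      then show ?thesis using vdeg_u[of u] lenR by simp
    qed
    then have "int (size_upto j (take_one i ws)) - weight (PL j) (take_one i ws) ?ts \<le> int (sum_list (map (\<lambda>A. card {u \<in> A. dg u < j + length R'}) As'))"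
      by (intro size_upto_bound[OF wc _ fin]) auto
    also have "\<dots> = int (count_below (j + length R') R')"
      unfolding count_below R' card_filter_cells[OF finA'] ..
    finally show ?thesis by (simp add: PL As'_def R'_def)
  next
    case (PQ c0 c1 c2 w z)
    obtain a xi xs where Q: "c = Q a (xi # xs)" and len: "length xs = length P"
      and pc: "pc = prepare_quad cs xi xs (lap_list P xs xs) (coef2 a) (coef1 a) (coef0 a) (sum_list xs)"
      using c PQ by (cases "(P, cs, c)" rule: prepare.cases) (auto split: if_splits)
    have len': "length xs = length ps" using len list_all2_lengthD[OF P] by simp
    define x where "x = supported ps xs"
    let ?d = "int (dg v)" and ?q = "coef2 a" and ?l = "coef1 a" and ?k = "coef0 a" and ?A = "24 * xi * coef2 a"
    define y where "y = lap_list P xs xs"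
    have xs: "map x ps = xs" unfolding x_def by (rule map_supported[OF dst(1) len'])
    have lapx: "lp x u = int (dg u) * x u - masked_sum (map (adj u) ps) xs" for u
      unfolding x_def by (rule lap_supported[OF dst(1,2) len'])
    have y: "y = map (lp x) ps"
      using lap_list[OF P, of x xs] by (simp add: xs y_def lapx)
    have leny: "length y = length xs" using len' by (simp add: y)
    have x0: "x u = 0" if "u \<notin> set ps" for u unfolding x_def by (rule supported_outside[OF that])
    have sumA: "sum_list (map (sum f) As) = f v + sum_list (map (sum f) As')" for f :: "'a \<Rightarrow> int"
      using part' sum_mset_cells[of f As] sum_mset_cells[of f As'] by simp
    have notin: "u \<notin> set ps" if "A \<in> set As" "u \<in> A" for A u
    proof -
      have "mset_set A \<subseteq># sum_list (map mset_set As)"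
        using that(1) by (rule mset_cell_le)
      then have "u \<in># mset_set (V - set ps)"
        using that finA unfolding dst(3) by (metis finite_set_mset_mset_set mset_subset_eqD)
      then show ?thesis using fin by simp
    qed
    have ycell: "lp x u = - masked_sum (map (adj u) ps) xs" if "A \<in> set As" "u \<in> A" for A u
      using lapx[of u] x0[OF notin[OF that]] by simp
    have YY: "(\<Sum>u\<in>V. (lp x u)\<^sup>2) = list_inner y y + cells_square cs xs"
    proof -
      have "sum_list (map (sum (\<lambda>u. (lp x u)\<^sup>2)) As) = cells_square cs xs"
        unfolding cells_square[OF cells fin] using ycell by (intro arg_cong[of _ _ sum_list] map_cong sum.cong) auto
      moreover have "list_inner y y = sum_list (map (\<lambda>p. (lp x p)\<^sup>2) ps)"
        by (simp add: y list_inner_map power2_eq_square)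
      ultimately show ?thesis using sum_partition[OF part, of "\<lambda>u. (lp x u)\<^sup>2"] by simp
    qed
    have XY: "(\<Sum>u\<in>V. x u * lp x u) = list_inner xs y"
      using sum_supported[OF fin dst(1,2) len', of "lp x"] unfolding x_def[symmetric] y[symmetric]
      by (simp add: mult.commute list_inner_map y xs[symmetric])
    have XX: "(\<Sum>u\<in>V. (x u)\<^sup>2) = list_inner xs xs"
      using sum_supported[OF fin dst(1,2) len', of x] unfolding x_def[symmetric] xs by (simp add: power2_eq_square)
    have SX: "(\<Sum>u\<in>V. x u) = sum_list xs"
      using sum_supported[OF fin dst(1,2) len', of "\<lambda>_. 1"] unfolding x_def[symmetric]
      using list_inner_map[of "\<lambda>_. 1" ps x] by (simp add: xs)
    have yv: "lp x v = - masked_sum m xs" using lapx[of v] x0[OF vV(2)] by (simp add: mv)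
    \<comment> \<open>The Laplacian of \<open>x\<close> is constant on each cell, so only the neighbour counts enter.\<close>
    have NY: "(\<Sum>u\<in>V. if adj v u then lp x u else 0) = masked_sum m y
        - sum_list (map2 (\<lambda>A w. int (card (A \<inter> ?N)) * masked_sum (fst (snd w)) xs) As' (take_one i ws))"
    proof -
      let ?f = "\<lambda>u. if adj v u then lp x u else 0"
      have "sum ?f V = sum_list (map ?f (v # ps)) + sum_list (map (sum ?f) As')"
        by (rule sum_partition[OF part2])
      moreover have "sum_list (map ?f (v # ps)) = masked_sum m y"
        using adj_irrefl[of v] by (simp add: mv[symmetric] y masked_sum_map)
      moreover have "sum_list (map (sum ?f) Bs) = - sum_list (map2 (\<lambda>A w. int (card (A \<inter> ?N)) * masked_sum (fst (snd w)) xs) Bs us)"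
        if "list_all2 (wcell V adj ps) Bs us" "\<And>A u. A \<in> set Bs \<Longrightarrow> u \<in> A \<Longrightarrow> u \<notin> set ps" for Bs us
        using that
      proof (induction rule: list_all2_induct)
        case (Cons A Bs w us)
        have "sum ?f A = (\<Sum>u\<in>A. if adj v u then - masked_sum (fst (snd w)) xs else 0)"
        proof (intro sum.cong if_cong refl)
          fix u assume "u \<in> A"
          then have "u \<notin> set ps" "map (adj u) ps = fst (snd w)"
            using Cons.prems[of A u] Cons.hyps by (auto simp: wcell_def)
          then show "lp x u = - masked_sum (fst (snd w)) xs" using lapx[of u] x0[of u] by simp
        qed
        also have "\<dots> = - (int (card (A \<inter> ?N)) * masked_sum (fst (snd w)) xs)"
          using finite_subset[OF _ fin, of A] Cons.hyps by (simp add: sum.If_cases wcell_def)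
        finally show ?case using Cons.IH[OF Cons.prems[OF list.set_intros(2)]] by simp
      qed simp
      from this[OF wc] have "sum_list (map (sum ?f) As') = - sum_list (map2 (\<lambda>A w. int (card (A \<inter> ?N)) * masked_sum (fst (snd w)) xs) As' (take_one i ws))"
        using inW by simp
      ultimately show ?thesis by simp
    qed
    have zw: "z = list_scale ?A xs" "w = list_comb ?A y (24 * xi * ?l) xs"
      "c0 = 12 * (?q * (list_inner y y + cells_square cs xs) + ?l * list_inner xs y + ?k * list_inner xs xs) - ?k * (sum_list xs * sum_list xs) - 2 * xi * ?k * sum_list xs + 11 * ?k * (xi * xi)"
      "c1 = 12 * xi * xi * ?q" "c2 = 12 * xi * xi * (?q + ?l)"
      using pc PQ by (auto simp: prepare_quad_def y_def)
    have wt: "weight pc (take_one i ws) ?ts = ?A * sum_list (map2 (\<lambda>A w. int (card (A \<inter> ?N)) * masked_sum (fst (snd w)) xs) As' (take_one i ws))"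
      unfolding weight_sum[OF wc] PQ zw slope.simps masked_sum_scale sum_list_const_mult[symmetric]
      by (intro arg_cong[of _ _ sum_list] map_cong) (auto simp: algebra_simps)
    have "0 \<le> form ?q ?l ?k V adj (\<lambda>u. x u + (if u = v then xi else 0))" by (rule form_nonneg')
    also have "\<dots> = base (take_one i ws) m ?d R' pc + weight pc (take_one i ws) ?ts"
      unfolding wt
      unfolding form_add_vertex[where x = x and v = v, OF vV(1) x0[OF vV(2)]] PQ base.simps
      unfolding form_def YY XY XX SX NY yv zw masked_sum_scale masked_sum_comb[OF leny]
      by (simp add: power2_eq_square algebra_simps)
    finally show ?thesis by (simp add: m_def R'_def As'_def)
  qed
qed

end

context nonneg_forms
begin

text \<open>
  Whatever the graph is, exploring \<open>v\<close> in it leads to one of the enumerated states: the counts of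
  neighbours of \<open>v\<close> in the cells satisfy all cuts and are therefore among the enumerated ones.
\<close>
lemma successors_complete:
  assumes represents: "represents V adj ps As (P, cs, R)" and i: "i < length As" and v: "v \<in> As ! i"
    and pr: "(i, dg v) \<in> set prs"
  shows "\<exists>ps' As' s. s \<in> set (successors P cs R (prepare_all P cs cuts) prs) \<and> represents V adj ps' As' s"
proof -
  let ?N = "{u. adj v u}" and ?d = "dg v"
  define pcs where "pcs = prepare_all P cs cuts"
  define ws where "ws = weigh cs pcs"
  define As' where "As' = As[i := As ! i - {v}]"
  define m where "m = snd (cs ! i)"
  define R' where "R' = remove1 ?d R"
  define ts where "ts = map (\<lambda>A. card (A \<inter> ?N)) As'"
  have P: "list_all2 (processed V adj ps) ps P" and cells: "list_all2 (cell V adj ps) As cs"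
    and part: "mset_set V = mset ps + sum_list (map mset_set As)"
    and R: "mset R = image_mset dg (sum_list (map mset_set As))"
    using represents by auto
  have finA: "\<forall>A\<in>set As. finite A" by (rule cells_finite[OF cells fin])
  have part': "sum_list (map mset_set As) = add_mset v (sum_list (map mset_set As'))"
    unfolding As'_def by (rule mset_cells_update[OF i v finA])
  have part2: "mset_set V = mset (v # ps) + sum_list (map mset_set As')"
    using part part' by simp
  note dist2 = partition_distinct[OF fin part2]
  have R': "mset R' = image_mset dg (sum_list (map mset_set As'))"
    by (simp add: R'_def R part')
  have mv: "map (adj v) ps = m"
    using cells i v by (auto simp: m_def list_all2_conv_all_nth cell_def)
  have wc: "list_all2 (wcell V adj ps) As' (take_one i ws)"
    unfolding As'_def ws_def by (rule take_one_wcell[OF cell_weigh[OF cells] i v fin])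
  have finA': "\<forall>A\<in>set As'. finite A"
    using wc by (induction rule: list_all2_induct) (auto simp: wcell_def finite_subset[OF _ fin])
  have "card (?N \<inter> (V - set (v # ps))) = sum_list ts"
  proof -
    have "card (?N \<inter> (V - set (v # ps))) = size (filter_mset (adj v) (mset_set (V - set (v # ps))))"
      using fin by (simp add: Int_def conj_commute)
    also have "\<dots> = sum_list (map (\<lambda>A. card {u \<in> A. adj v u}) As')"
      using card_filter_cells[OF finA', of "adj v" "\<lambda>u. u"] unfolding dist2(3) by simp
    finally show ?thesis by (simp add: ts_def Int_def)
  qed
  moreover have "{w \<in> V - set (v # ps). adj v w} = ?N \<inter> (V - set (v # ps))" by auto
  ultimately have vdeg_v: "?d = ones m + sum_list ts"
    using degree_split[OF dist2(1,2), of v] adj_irrefl[of v] by (simp add: mv)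
  have fits: "fits (take_one i ws) ts"
    unfolding ts_def using wc fin
    by (induction rule: list_all2_induct) (auto simp: wcell_def intro!: card_mono intro: finite_subset[OF _ fin])
  have "\<forall>(k, m, w)\<in>set (take_one i ws). w = slopes m pcs"
    unfolding ws_def by (intro take_one_weights weigh_weights)
  then have "add_weights (bases (take_one i ws) m (int ?d) R' pcs) (take_one i ws) ts
      = map (\<lambda>pc. base (take_one i ws) m (int ?d) R' pc + weight pc (take_one i ws) ts) pcs"
    unfolding bases_map by (rule add_weights)
  moreover have "0 \<le> base (take_one i ws) m (int ?d) R' pc + weight pc (take_one i ws) ts" if pc: "pc \<in> set pcs" for pc
  proof -
    obtain c where "pc = prepare P cs c" using pc by (auto simp: pcs_def prepare_all_map)
    from cut_valid[OF represents i v ws_def this] show ?thesis by (simp add: ts_def m_def R'_def As'_def)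
  qed
  ultimately have "nonneg (add_weights (bases (take_one i ws) m (int ?d) R' pcs) (take_one i ws) ts)"
    by (simp add: nonneg_all)
  then have splits: "split_cells (take_one i ws) ts 0 [] \<in> set (splits (take_one i ws) (?d - ones m) (bases (take_one i ws) m (int ?d) R' pcs) 0 [])"
    using vdeg_v by (intro splits_complete[OF fits]) simp_all
  define cs' where "cs' = split_cells (take_one i ws) ts 0 []"
  define s where "s = ((int ?d, False # m) # extend_masks P m, cs', R')"
  have "s \<in> set (branch P (take_one i ws) R' pcs ?d m)"
    using splits vdeg_v by (auto simp: branch_def with_cells_map s_def cs'_def)
  then have "s \<in> set (expand P cs ws R pcs prs)"
    using pr
  proof (induction prs)
    case (Cons p prs)
    then show ?case by (cases p) (auto simp: R'_def m_def)
  qed simp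
  moreover have "represents V adj (v # ps) (split_sets ?N As' []) s"
  proof -
    have "list_all2 (processed V adj (v # ps)) (v # ps) ((int ?d, False # m) # extend_masks P m)"
      using extend_masks[OF P, of v] adj_commute adj_irrefl[of v] by (simp add: processed_def mv[symmetric])
    moreover have "list_all2 (cell V adj (v # ps)) (split_sets ?N As' []) cs'"
      unfolding cs'_def ts_def by (rule split_cell[OF wc _ fin]) (simp, rule adj_commute)
    ultimately show ?thesis
      using part2 R' split_sets_mset[OF finA', of ?N "[]"] by (simp add: s_def)
  qed
  ultimately show ?thesis unfolding successors.simps pcs_def ws_def by blast
qed

theorem check_sound:
  "check s c \<Longrightarrow> \<not> represents V adj ps As s"
  "checks ss cl \<Longrightarrow> s \<in> set ss \<Longrightarrow> \<not> represents V adj ps As s"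
proof (induction s c and ss cl arbitrary: ps As and ps As s rule: check_checks.induct)
  case (1 P cs R i cuts subs)
  show ?case
  proof
    assume represents: "represents V adj ps As (P, cs, R)"
    then have cells: "list_all2 (cell V adj ps) As cs" by simp
    then have i: "i < length As" "card (As ! i) > 0"
      using 1 by (auto simp: list_all2_conv_all_nth cell_def)
    then obtain v where v: "v \<in> As ! i" by (metis card.empty ex_in_conv less_irrefl)
    have "mset_set (As ! i) \<subseteq># sum_list (map mset_set As)"
      using i(1) by (intro mset_cell_le) simp
    then have "v \<in># sum_list (map mset_set As)"
      using v i(2) by (metis card_ge_0_finite finite_set_mset_mset_set mset_subset_eqD)
    then have "dg v \<in># mset R" using represents by auto
    then have "(i, dg v) \<in> set (with_cell i (remdups R))" by (simp add: with_cell_map)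
    from successors_complete[OF represents i(1) v this] show False using 1 by fastforce
  qed
next
  case (2 P cs R d cuts subs)
  show ?case
  proof
    assume represents: "represents V adj ps As (P, cs, R)"
    then have cells: "list_all2 (cell V adj ps) As cs" by simp
    have "mset R = image_mset dg (sum_list (map mset_set As))" using represents by simp
    moreover have "d \<in># mset R" using 2 by simp
    ultimately have "d \<in># image_mset dg (sum_list (map mset_set As))" by (simp only:)
    then obtain v where v: "v \<in># sum_list (map mset_set As)" "d = dg v" by auto
    then obtain A where "A \<in> set As" "v \<in> A"
      using mset_cellD[OF v(1) cells_finite[OF cells fin]] by blast
    then obtain i where i: "i < length As" "v \<in> As ! i" by (metis in_set_conv_nth)
    have "(i, dg v) \<in> set (with_degree d 0 cs)"
      using i v list_all2_lengthD[OF cells] by (simp add: with_degree_map)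
    from successors_complete[OF represents i this] show False using 2 by fastforce
  qed
qed auto

lemma root_represents:
  assumes "mset R = image_mset dg (mset_set V)"
  shows "represents V adj [] [V] ([], [(card V, [])], R)"
  using assms by (simp add: cell_def)

end

section \<open>Degree sequences\<close>

text \<open>
  Two necessary conditions for \<open>n\<close> numbers between \<open>2\<close> and \<open>d\<close> with sum \<open>s\<close> and sum of squares \<open>q\<close>:
  the sum of the products \<open>(x - 2) (d - x)\<close> is nonnegative, and Cauchy--Schwarz. They prune the
  enumeration of the degree sequences to about a thousand calls.
\<close>
definition admissible :: "nat \<Rightarrow> int \<Rightarrow> int \<Rightarrow> int \<Rightarrow> bool" where
  "admissible d n s q \<longleftrightarrow> q \<le> (2 + int d) * s - 2 * int d * n \<and> s * s \<le> n * q"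

fun degseqs :: "nat list \<Rightarrow> nat \<Rightarrow> int \<Rightarrow> int \<Rightarrow> nat list list" where
  "degseqs [] n s q = (if n = 0 then [[]] else [])"
| "degseqs (d # ds) 0 s q = (if admissible d 0 s q then degseqs ds 0 s q else [])"
| "degseqs (d # ds) (Suc n) s q = (if admissible d (int (Suc n)) s q then
     degseqs ds (Suc n) s q @ map ((#) d) (degseqs (d # ds) n (s - int d) (q - int d * int d))
     else [])"

lemma degseqs_skip: "admissible d (int n) s q \<Longrightarrow> set (degseqs ds n s q) \<subseteq> set (degseqs (d # ds) n s q)"
  by (cases n) auto

lemma square_le_if_deviation:
  fixes n q t :: int
  assumes "0 \<le> n * n * q - 2 * n * t * t + t * t * n" "0 < n"
  shows "t * t \<le> n * q"
proof -
  have "0 \<le> n * (n * q - t * t)" using assms(1) by (simp add: algebra_simps)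
  then show ?thesis using assms(2) by (simp add: zero_le_mult_iff)
qed

lemma degseqs_complete:
  assumes "set_mset M \<subseteq> set ds" "sorted_wrt (\<ge>) ds" "\<forall>d\<in>set ds. 2 \<le> d"
  shows "\<exists>R\<in>set (degseqs ds (size M) (\<Sum>d\<in>#M. int d) (\<Sum>d\<in>#M. int d * int d)). mset R = M"
  using assms
proof (induction "length ds + size M" arbitrary: ds M rule: less_induct)
  case less
  show ?case
  proof (cases ds)
    case Nil
    then show ?thesis using less.prems by simp
  next
    case (Cons d ds')
    let ?s = "\<lambda>M. \<Sum>d\<in>#M. int d" and ?q = "\<lambda>M. \<Sum>d\<in>#M. int d * int d"
    have range: "2 \<le> x \<and> x \<le> d" if "x \<in># M" for x
      using that less.prems by (auto simp: Cons)
    have "?q M \<le> (2 + int d) * ?s M - 2 * int d * int (size M)"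
      using range
    proof (induction M)
      case (add x M)
      have "0 \<le> (int x - 2) * (int d - int x)" using add.prems by simp
      then show ?case using add by (simp add: algebra_simps)
    qed simp
    \<comment> \<open>Cauchy--Schwarz from the sum of the squared deviations from the mean, scaled by the size of \<open>M\<close>.\<close>
    moreover have "?s M * ?s M \<le> int (size M) * ?q M"
    proof -
      have "0 \<le> (\<Sum>d\<in>#N. (int (size M) * int d - ?s M)\<^sup>2)" for N
        by (induction N) auto
      moreover have "(\<Sum>d\<in>#N. (a * int d - b)\<^sup>2) = a * a * ?q N - 2 * a * b * ?s N + b * b * int (size N)" for N a b
        by (induction N) (auto simp: algebra_simps power2_eq_square)
      ultimately have *: "0 \<le> int (size M) * int (size M) * ?q M - 2 * int (size M) * ?s M * ?s M + ?s M * ?s M * int (size M)"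
        by metis
      show ?thesis
      proof (cases "M = {#}")
        case False
        then show ?thesis by (intro square_le_if_deviation[OF *]) (simp add: nonempty_has_size)
      qed simp
    qed
    ultimately have adm: "admissible d (int (size M)) (?s M) (?q M)" by (simp add: admissible_def)
    show ?thesis
    proof (cases "d \<in># M")
      case True
      then obtain N where N: "M = add_mset d N" by (metis insert_DiffM)
      have "\<exists>R\<in>set (degseqs ds (size N) (?s N) (?q N)). mset R = N"
        using less.prems by (intro less.hyps) (auto simp: N)
      then obtain R where "R \<in> set (degseqs ds (size N) (?s N) (?q N))" "mset R = N" by blast
      then have "d # R \<in> set (degseqs ds (size M) (?s M) (?q M))" "mset (d # R) = M"
        using adm by (auto simp: Cons N)
      then show ?thesis by blast
    next
      case False
      then have "\<exists>R\<in>set (degseqs ds' (size M) (?s M) (?q M)). mset R = M"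
        using less.prems by (intro less.hyps) (auto simp: Cons)
      then show ?thesis using degseqs_skip[OF adm, of ds'] unfolding Cons by blast
    qed
  qed
qed

text \<open>
  A degree sequence may be refuted directly or through the sequence of the complement.
\<close>
lemma not_nonneg_forms:
  assumes certs: "\<And>R. R \<in> set (degseqs [9, 8, 7, 6, 5, 4, 3, 2] 12 66 440) \<Longrightarrow>
      \<exists>c. check ([], [(12, [])], R) c \<or> check ([], [(12, [])], map (\<lambda>d. 11 - d) (rev R)) c"
    and nn: "nonneg_forms {..<12 :: nat} adj"
    and s1: "(\<Sum>i<12. int (vdeg {..<12} adj i)) = 66" and s2: "(\<Sum>i<12. (int (vdeg {..<12} adj i))\<^sup>2) = 440"
  shows False
proof -
  let ?V = "{..<12 :: nat}"
  interpret nonneg_forms ?V adj by (rule nn)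
  interpret c: nonneg_forms ?V "complement ?V adj" by (rule nonneg_forms_complement) simp
  define M where "M = image_mset dg (mset_set ?V)"
  have "\<exists>R\<in>set (degseqs [9, 8, 7, 6, 5, 4, 3, 2] (size M) (\<Sum>d\<in>#M. int d) (\<Sum>d\<in>#M. int d * int d)). mset R = M"
  proof (rule degseqs_complete)
    show "set_mset M \<subseteq> set [9, 8, 7, 6, 5, 4, 3, 2]"
    proof
      fix d assume "d \<in># M"
      then obtain v where v: "v \<in> ?V" "d = dg v" by (auto simp: M_def)
      then have "d \<in> {2..9}" using degree_bounds[of v] by simp
      then show "d \<in> set [9, 8, 7, 6, 5, 4, 3, 2]" by (simp, presburger)
    qed
  qed auto
  moreover have "size M = 12" by (simp add: M_def)
  moreover have "(\<Sum>d\<in>#M. int d) = 66"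
    using s1 by (simp add: M_def sum_unfold_sum_mset multiset.map_comp comp_def)
  moreover have "(\<Sum>d\<in>#M. int d * int d) = 440"
    using s2 by (simp add: M_def sum_unfold_sum_mset multiset.map_comp comp_def power2_eq_square)
  ultimately obtain R where R: "R \<in> set (degseqs [9, 8, 7, 6, 5, 4, 3, 2] 12 66 440)" "mset R = M" by auto
  from certs[OF R(1)] obtain c where
    "check ([], [(12, [])], R) c \<or> check ([], [(12, [])], map (\<lambda>d. 11 - d) (rev R)) c" by blast
  then show False
  proof
    assume "check ([], [(12, [])], R) c"
    moreover have "represents ?V adj [] [?V] ([], [(12, [])], R)"
      using root_represents[of R] R(2) by (simp only: card_lessThan M_def)
    ultimately show False using check_sound(1) by blast
  next
    assume *: "check ([], [(12, [])], map (\<lambda>d. 11 - d) (rev R)) c"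
    have "vdeg ?V (complement ?V adj) v = 11 - dg v" if "v \<in> ?V" for v
      using vdeg_complement[OF that] by simp
    then have "image_mset (\<lambda>d. 11 - d) M = image_mset (vdeg ?V (complement ?V adj)) (mset_set ?V)"
      unfolding M_def multiset.map_comp comp_def by (intro image_mset_cong) simp
    then have "mset (map (\<lambda>d. 11 - d) (rev R)) = image_mset (vdeg ?V (complement ?V adj)) (mset_set ?V)"
      using R(2) by simp
    from c.root_represents[OF this] show False
      using c.check_sound(1)[OF *] by (simp only: card_lessThan)
  qed
qed

lemma no_integral_spectrum:
  assumes certs: "\<And>R. R \<in> set (degseqs [9, 8, 7, 6, 5, 4, 3, 2] 12 66 440) \<Longrightarrow>
      \<exists>c. check ([], [(12, [])], R) c \<or> check ([], [(12, [])], map (\<lambda>d. 11 - d) (rev R)) c"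
  shows "\<not> (\<exists>G :: 'a pair_pre_digraph. pair_graph G \<and> card (pverts G) = 12 \<and>
           laplacian_spectrum G = image_mset real (mset_set {0..11}))"
proof
  assume "\<exists>G :: 'a pair_pre_digraph. pair_graph G \<and> card (pverts G) = 12 \<and>
           laplacian_spectrum G = image_mset real (mset_set {0..11})"
  then obtain G :: "'a pair_pre_digraph" where G: "pair_graph G" "card (pverts G) = 12"
    "laplacian_spectrum G = image_mset real (mset_set {0..11})" by blast
  have "finite (pverts G)" using G(2) by (simp add: card_ge_0_finite)
  then obtain vs where vs: "vertex_enum G vs"
    unfolding vertex_enum_def using finite_distinct_list by blast
  then have len: "length vs = 12" using G(2) by (metis vertex_enum_def distinct_card)
  have roots: "poly (char_poly (laplacian_matrix G vs)) (real k) = 0" if "k < 12" for k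
  proof -
    have "real k \<in># proots (char_poly (laplacian_matrix G vs))"
      using that unfolding laplacian_spectrum_eq[OF vs, symmetric] G(3) by auto
    then show ?thesis
      by (cases "char_poly (laplacian_matrix G vs) = 0") (auto simp: set_count_proots)
  qed
  note forms = laplacian_forms[OF G(1) vs len roots refl, simplified]
  show False by (rule not_nonneg_forms[OF certs forms])
qed

section \<open>Certificates\<close>

text \<open>
  One certificate for each pair of complementary degree sequences, named after the sequence that it
  refutes. The vectors come from minimising a form over the coefficients of the explored vertices
  numerically and rounding a multiple of the minimiser to integers.
\<close>

definition "cert_977777772222 =
D 9[][C 0[][C 2[H 2,Q 10[1,2,6]][C 0[H 2,Q 1[18,-1,3,2]][],D 2[Q 10[2,9,22,60],Q 1[17,-3,3,2]][]],C 2[H 2,Q 10[2,2,6],Q 10[2,5,17]][C 0[H 2,Q 1[19,0,3,2]][],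
C 2[H 2,Q 10[1,7,7,23]][],C 1[Q 1[1,5,1,0],Q 10[2,-3,-7,-25]][]],C 2[Q 10[2,1,6],Q 10[1,1,8]][D 2[Q 10[2,22,9,60],Q 1[17,3,-3,2]][],C 0[Q 10[1,-2,-2,-15]][
C 2[Q 10[1,1,-4,-4,-31]][]],C 1[Q 10[1,-3,-3,-22]][]],C 2[Q 0[1,1,0],Q 10[1,1,9],Q 10[5,2,17]][C 0[Q 1[1,1,5,0],Q 10[2,-7,-3,-25]][]]]]"

definition "cert_888888433332 =
D 2[][C 1[][C 0[Q 1[9,4,19],Q 1[1,1,6]][D 4[][C 0[Q 1[1,-1,-2,-2,-11]][C 0[L 2,Q 1[1,-7,6,12,12,73]][],D 3[L 2][]],C 1[Q 1[7,1,-7,-7,-47]][C 1[H 3,Q 2[13,2,0,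
1,1,-6]][],C 3[L 2][],C 1[L 2,Q 9[18,2,4,-2,-2,3]][],D 3[L 2][]],C 1[][C 2[Q 9[6,37,8,-3,-3,6],Q 9[8,54,12,-7,-7,9]][],C 1[H 3,Q 9[3,15,4,-3,-3,3]][C 1[Q 9[1,
-5,-26,-6,5,5,-4]][]],C 0[H 3,Q 2[37,-1,19,0,0,-55]][C 2[H 3,Q 9[9,-9,-7,1,0,0,-1]][]],C 2[L 1,Q 9[15,3,4,-3,-3,3]][],C 1[L 1,Q 9[5,1,1,-1,-1,1]][],C 3[L 2,
Q 1[4,1,0,-4,-4,-27]][]],C 0[Q 1[2,1,-2,-2,-13]][D 8[H 3][],D 3[L 2,Q 1[2,2,2,-5,-5,-31]][],C 4[Q 1[5,6,6,-8,-8,-50]][],D 3[L 2][],C 3[L 2,Q 2[3,3,2,1,1,9],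
Q 10[8,2,2,6,7,1]][]],C 1[Q 1[4,5,-9,-9,-59]][C 3[L 2,Q 1[3,6,5,-7,-7,-44]][],C 3[Q 1[1,5,4,-5,-5,-34]][]],C 0[Q 1[1,4,-6,-6,-38]][]],C 0[Q 9[5,5,-5,1]][C 2[
H 3,Q 8[3,14,-9,8,2],Q 9[3,14,8,-4,2]][D 8[H 3,H 4][],C 3[H 3,Q 8[1,2,6,-4,3,1]][],C 4[Q 8[1,1,5,-3,4,1],H 3][],C 1[Q 2[3,18,0,1,1,-14],Q 2[5,6,1,1,1,-5]][],
C 3[Q 8[1,2,8,-4,6,1],H 3][]],C 2[Q 8[1,-5,5,0,-1],H 3][],C 0[Q 9[1,-1,-4,4,0]][D 8[H 3][],C 0[H 3,Q 8[1,5,1,3,-2,1]][]],C 1[Q 1[2,0,-3,-3,-21],Q 3[13,-12,0,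
-2,2]][D 3[L 2][],C 4[Q 9[1,0,-1,-4,4,0],Q 8[5,1,1,4,-3,1]][],C 3[L 2,Q 9[4,5,5,27,3,0],Q 10[15,3,2,12,9,2]][]],C 0[Q 9[1,-2,-8,7,0],Q 8[5,2,4,-2,1]][],C 0[
Q 9[1,-1,-4,4,0]][C 1[H 3,Q 2[19,3,-2,2,1,-9]][],C 1[H 3,Q 8[1,7,1,5,-5,1]][],C 0[H 3,Q 8[1,5,0,2,-3,1]][]],C 0[Q 9[1,-2,-9,8,0],Q 8[5,2,4,-4,1]][],C 0[Q 9[1,
-2,-9,9,0],Q 8[5,2,2,-4,1]][],C 1[Q 1[4,-3,-8,-9,-55]][C 2[L 2,Q 1[2,3,1,-4,-4,-27]][],D 3[L 2][],D 3[L 2][]],C 0[Q 9[1,-1,-8,6,0],Q 8[4,2,6,-4,1]][],C 0[Q 9[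
1,-1,-6,6,0]][C 2[Q 8[4,22,3,17,-19,4]][],C 1[Q 8[1,6,1,5,-4,1],H 3][],C 0[H 3,Q 8[1,9,1,9,-7,1],Q 2[7,6,45,0,6,-5]][]],C 0[Q 9[1,-1,-8,7,0],Q 8[5,2,4,-4,
1]][],C 0[Q 9[1,-1,-7,7,0],Q 8[5,2,4,-4,1]][]],C 2[Q 1[1,-6,-6,-40]][],C 1[Q 1[1,6,3,15]][C 1[Q 1[2,1,8,4,19]][],C 2[Q 1[3,2,12,6,28]][],C 2[Q 1[1,1,6,3,
14]][],C 2[Q 1[1,1,6,3,13],Q 1[5,2,9,4,16]][],D 3[L 1][],D 3[L 1][],C 2[L 1,Q 9[6,1,1,-2,1]][]],C 1[Q 1[1,6,3,16],Q 4[16,-25,-1,8]][],C 1[Q 1[1,6,2,8],Q 1[1,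
3,1,4],Q 1[7,16,6,22]][C 1[L 1,Q 9[13,3,2,-4,2]][],D 3[L 1][]]],C 0[Q 1[7,3,22],Q 1[1,1,8]][C 1[Q 1[2,-3,-3,-22]][D 8[H 3][],C 0[Q 1[2,3,-4,-4,-30]][],C 0[
Q 1[1,1,-2,-2,-15]][D 3[L 2][]]],C 2[Q 1[2,-8,-8,-61]][C 3[Q 1[2,5,-7,-7,-57],Q 4[4,-3,0,1,0]][D 3[L 2][]]],C 2[Q 1[1,-2,-1,-7]][C 0[Q 8[1,-5,0,4,-1],Q 7[2,2,
0,-3,1]][],C 0[Q 1[1,2,-4,-2,-14]][],C 0[L 1,Q 9[3,3,4,18,0],Q 8[5,-1,0,-4,1],Q 1[1,1,-2,-1,-7]][D 3[L 2][]],C 0[Q 9[5,5,7,33,0],Q 8[5,-1,0,-4,1],Q 1[1,1,-2,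
-1,-7]][],C 1[L 1,Q 1[1,-3,9,4,30],Q 9[5,0,-1,-4,1]][C 0[Q 1[3,-3,11,-26,-11,-85]][],D 3[L 2][]],C 0[Q 9[4,4,5,22,0]][]],C 2[Q 1[3,-16,-7,-54]][C 0[Q 9[3,4,4,
20,0],Q 8[4,0,-1,-4,1]][]],C 1[Q 1[29,222,59,463],Q 4[6,-7,2,3],Q 9[5,-1,-4,1]][C 1[Q 1[1,1,7,2,14]][],C 2[Q 1[4,3,19,5,35]][],D 3[L 1][],D 3[L 1][],C 3[L 1,
Q 9[28,5,3,-3,4]][],C 2[L 1,Q 9[14,3,1,-3,2]][],C 1[L 1,Q 1[1,1,6,2,12]][],D 3[L 1][],C 1[L 1,Q 1[1,1,9,3,20]][]],C 1[Q 1[4,21,6,45]][C 3[L 1,Q 4[1,6,-4,2,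
2]][],D 3[L 1][]]],C 0[Q 0[2,2,3],Q 1[1,2,5]][C 0[Q 1[1,3,6,15]][C 3[Q 1[1,1,3,6,14]][],C 3[Q 1[1,1,3,7,15],Q 1[5,2,4,9,16]][],C 4[Q 1[3,2,6,12,28]][],C 3[
Q 1[2,1,4,8,19]][],C 0[L 1,Q 9[6,1,-2,1,1]][],D 3[L 1][],D 3[L 1][]],C 1[Q 1[1,3,6,15],Q 4[16,-1,-25,8]][]],C 0[Q 1[1,2,7]][C 1[Q 1[1,-1,-2,-7]][C 1[Q 8[1,-5,
4,0,-1],Q 7[2,2,-3,0,1]][],C 2[Q 9[4,4,21,5,0]][],C 2[Q 9[5,5,30,7,0],Q 8[5,-1,-4,0,1],Q 1[1,1,-1,-2,-7]][],C 3[L 1,Q 1[1,-3,4,9,30],Q 9[5,0,-4,-1,1]][C 3[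
Q 1[3,-3,11,-11,-26,-85]][],D 3[L 2][]],C 2[L 1,Q 9[3,3,18,4,0],Q 8[5,-1,-4,0,1],Q 1[1,1,-1,-2,-7]][D 3[L 2][]],C 1[Q 1[1,4,-4,-9,-29]][]],C 2[Q 1[2,-5,-11,
-37]][C 3[Q 9[3,4,20,4,0],Q 8[4,0,-4,-1,1]][]],C 0[L 0,Q 3[1,-4,4,1]][],C 3[L 0][D 3[L 1][],C 1[L 1,Q 1[1,1,6,3,11]][],C 0[L 1,Q 9[3,15,0,3,2]][]],C 2[L 0,
Q 1[1,12,7,26],Q 1[1,4,2,8]][C 0[L 1,Q 1[1,1,7,2,10]][]]],C 0[Q 0[2,3,4],Q 1[1,3,5]][C 0[Q 1[1,2,6,10],Q 1[1,1,3,4],Q 1[5,4,11,15]][C 0[L 1,Q 9[13,3,-4,2,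
2]][],D 3[L 1][]]],C 0[Q 1[1,3,7]][C 0[Q 1[29,59,222,463],Q 4[6,2,-7,3],Q 9[5,-4,-1,1]][C 4[Q 1[4,3,6,22,41]][],C 3[Q 1[1,1,2,7,14]][],C 3[L 1,Q 1[1,2,2,8,
13]][],C 0[L 1,Q 9[28,5,-3,3,4]][],D 3[L 1][],C 0[L 1,Q 9[14,3,-3,1,2]][],D 3[L 1][],C 3[L 1,Q 1[1,2,2,6,11]][],D 3[L 1][]],C 1[Q 1[4,6,21,45]][C 3[L 1,Q 1[1,
3,2,9,15]][],D 3[L 1][]],C 2[L 0,Q 3[1,4,-4,1]][],C 0[L 0][C 2[L 1,Q 1[1,1,4,9,17]][],C 1[L 1,Q 9[3,15,3,0,2]][],D 3[L 1][]],C 0[L 0,Q 1[1,7,12,26],Q 1[1,2,4,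
8]][C 3[L 1,Q 1[1,1,3,8,14]][]],D 3[L 0][],D 3[L 0][D 3[L 1][]],D 3[L 0][D 3[L 1][],D 3[L 1][],D 3[L 1][]]]]]"

definition "cert_888777762222 =
D 2[][D 2[Q 0[1,1]][D 2[Q 0[1,1,1]][D 2[Q 0[1,1,0,0],Q 0[1,0,1,1]][D 6[L 0,L 1][C 2[L 2,L 1,Q 6[1,-8,-2,0,-2,-2]][],C 3[L 1,L 2][C 0[L 3,Q 1[7,7,-1,18,-4,18,
18]][]],C 3[L 1,L 2][]],D 6[L 0,L 1][C 2[Q 1[1,-1,5,-4,0,0]][],C 2[L 1,L 2][],C 2[Q 1[1,-2,7,-9,0,0]][],C 0[][C 4[][C 0[Q 2[2,2,2,2,0,-9,0,-7]][]]],C 0[][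
C 4[][C 0[Q 2[2,2,2,2,0,-9,0,-7]][]]],C 2[Q 6[7,-9,0,-2,0,-1]][],C 0[][C 4[][C 0[Q 2[2,2,2,2,0,-8,0,-8]][]]]],D 6[L 0][C 2[L 2,Q 9[5,2,1,1,0,0]][],C 2[L 2,
Q 9[14,5,2,2,1,1]][],C 0[][C 3[][C 0[Q 9[6,6,6,3,4,4,4,4]][]]],C 0[][C 3[][C 0[Q 9[6,6,6,3,4,4,4,4]][]]]],C 4[L 0,L 1][C 2[Q 1[7,7,48,-3,-3,-3],L 1][],C 2[
L 2,Q 1[1,1,6,-1,0,0]][],C 2[L 2,Q 1[3,3,22,-2,0,-1]][],C 4[Q 1[1,-1,-5,0,3,3]][],D 6[L 1,Q 6[7,-4,2,1,1,1]][],C 2[L 2,Q 1[3,4,21,-5,0,0]][],C 3[L 1,L 2][],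
C 3[L 1,Q 1[2,3,16,-2,-1,-1]][]],C 3[L 0][C 1[L 1,Q 8[1,9,2,2,2,2]][C 3[Q 8[2,11,12,5,5,5,5],Q 2[2,2,2,-7,-5,-4,-5],Q 2[2,2,2,-5,-7,-4,-5]][C 1[Q 2[1,-2,-2,
-2,9,9,5,5]][]],C 4[Q 8[6,4,-4,0,1,1,1]][],C 1[Q 8[6,4,-4,1,0,1,1]][]],C 1[Q 8[9,1,2,2,2,2]][],C 3[Q 6[7,-9,0,-2,0,-1]][],C 1[Q 8[9,1,2,2,2,2]][],C 0[Q 6[7,
-9,-2,0,0,-1]][]],C 2[L 0,Q 8[5,1,1,1,1]][C 1[Q 8[4,1,1,1,1,1]][],C 2[Q 6[7,-9,0,-2,0,-1]][],C 0[Q 6[7,-9,-2,0,0,-1]][]],D 7[L 1][C 1[L 2,Q 8[8,-13,-1,-2,-1,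
-1]][]],C 1[L 0,L 1,Q 0[1,4,4,-1,-1]][C 0[Q 2[1,-1,5,-5,0,0]][],C 2[L 2,Q 9[8,5,2,1,1,1]][],D 6[L 1,Q 6[4,-3,0,1,0,0]][]]],C 2[L 0][C 1[Q 1[1,-1,6,0,-6],
L 0][],C 1[Q 1[1,-1,5,-2,-3],L 1][C 3[L 1,L 0][]],C 1[Q 1[1,-1,6,-3,-3],L 1][],C 1[Q 1[1,-1,5,0,-5],L 1][D 7[L 2,Q 8[17,4,9,4,3,3]][]],C 1[L 1,Q 1[1,-1,6,0,
-6]][],C 1[Q 1[1,-1,5,-2,-3],L 1][],C 1[Q 1[1,-1,6,-3,-3],L 0][],C 1[L 1,Q 1[1,-1,5,-2,-3]][],D 2[L 0][],D 2[L 0,L 1][],D 2[L 0,L 1][],D 2[L 1,L 0][]],D 2[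
L 0][C 1[L 0,L 1][],D 6[L 0,L 1][C 3[L 1,L 2][C 0[L 3,Q 1[7,7,-1,-4,18,18,18]][]],C 3[L 1,L 2][],C 2[L 2,L 1,Q 6[1,-8,0,-2,-2,-2]][]]]],C 0[Q 0[1,0,1],Q 1[1,
-1,1]][C 0[Q 1[1,-1,7,-8],Q 1[1,0,1,-1]][],C 0[Q 1[1,-1,6,-8],Q 0[1,0,1,0]][C 2[Q 2[1,5,1,-3,5],L 1][]],C 0[Q 1[1,-1,7,-8],Q 1[1,0,1,-1]][],C 0[Q 1[1,-1,5,
-5],Q 0[1,0,1,0]][C 2[Q 2[2,9,1,-7,6],L 1][],C 0[Q 1[6,0,5,5,34],Q 1[6,7,4,13,26],Q 1[4,0,3,1,20],Q 1[5,4,3,7,18]][]],C 0[Q 1[1,-1,6,-6],Q 1[1,0,1,-1]][],C 0[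
Q 1[1,-1,5,-5],Q 0[1,0,1,0]][C 2[Q 2[1,5,1,-4,5],L 1][],D 2[L 1][]],C 0[Q 1[1,-1,7,-7],Q 1[1,0,1,-1]][],C 0[Q 1[1,-1,6,-6],Q 0[1,0,1,0]][C 2[Q 1[1,8,-1,8,-7],
L 1][],C 3[L 1,Q 2[1,7,1,-5,6]][]],C 0[Q 1[1,-2,8,-9],Q 1[1,0,1,-1]][],C 0[Q 1[1,-2,7,-9],Q 0[1,0,1,0]][C 2[Q 2[1,6,1,-4,5],L 0][],C 3[L 1,Q 2[1,8,1,-6,
7]][]],C 0[Q 1[1,-1,6,-5],Q 1[1,0,1,-1]][],C 0[Q 1[1,-1,5,-4],Q 0[1,0,1,0]][D 2[L 0,L 1][],D 2[L 1,L 0][]],C 2[Q 0[1,1,0,1]][D 2[L 1,Q 2[1,-2,-12,-6,8],Q 2[2,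
2,10,5,-6]][],D 8[Q 1[1,1,7,0,7],Q 2[1,1,7,6,-5],Q 9[28,-4,4,4,3]][],C 0[Q 1[1,1,7,0,7],L 1][],D 2[L 1,Q 2[1,-2,-9,-4,7],Q 2[2,9,44,20,-29]][],D 2[L 1][],D 8[
Q 2[1,-1,-7,0,7],Q 2[1,1,7,6,-5],Q 9[35,-3,5,5,4]][],C 0[Q 2[1,-1,-4,0,4],L 1][],D 2[L 1,L 0][],C 3[L 1,Q 2[1,2,8,6,-4]][],D 2[L 0,L 1][],C 0[Q 2[2,-2,-7,0,
9],L 0][]]],D 2[Q 0[1,0,1],Q 0[1,1,0]][C 3[Q 0[1,1,0,1]][D 2[L 1,Q 2[1,-2,8,-6,-12],Q 2[2,2,-6,5,10]][],C 1[Q 1[1,1,7,0,7],L 1][],D 8[Q 1[1,1,7,0,7],Q 2[1,1,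
-4,5,6],Q 9[28,-4,3,4,4]][],D 2[L 1][],D 2[L 1,Q 2[1,-2,6,-5,-9],Q 2[2,7,-24,16,34]][],C 2[Q 2[1,-1,4,0,-4],L 1][],D 8[Q 2[1,-1,7,0,-7],Q 2[1,2,-6,5,8],Q 9[
35,-3,4,5,5]][],C 3[L 1,Q 2[1,2,-4,6,8]][],D 2[L 1,L 0][],C 2[Q 2[2,-2,9,0,-7],L 0][],D 2[L 0,L 1][]],C 3[Q 0[1,1,0,1]][C 0[Q 2[1,-1,5,0,-5],L 1][],C 0[Q 2[1,
-1,5,0,-5],Q 0[1,0,1,0,1]][],C 0[Q 1[1,1,7,0,8],Q 0[1,0,1,0,1]][],D 2[L 1][],C 0[Q 2[1,-1,5,0,-5],L 1][],D 2[L 1][],C 0[Q 2[1,-1,5,0,-5],L 0][],C 0[Q 2[1,-1,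
4,0,-4],Q 0[1,0,1,0,1]][],C 0[Q 2[1,-1,6,0,-6],L 0][],D 2[L 1][],C 0[Q 2[1,-1,5,0,-4],L 0][],C 0[L 1,Q 2[1,-1,4,0,-3]][],C 0[Q 2[1,-1,5,0,-4],L 0][],C 0[L 0,
Q 2[1,-1,4,0,-3]][]],D 2[Q 0[1,1,1,0],Q 0[1,0,0,1]][D 6[L 0][C 2[L 2,Q 9[5,2,0,1,1,0]][],C 1[][C 2[][C 1[Q 9[6,6,6,3,4,4,4,4]][]]],C 2[][C 1[][C 2[Q 9[6,6,6,
3,4,4,4,4]][]]],C 2[L 2,Q 9[14,5,1,2,2,1]][]],C 2[L 0][C 2[L 1,Q 8[1,9,2,2,2,2]][C 2[Q 8[2,11,12,5,5,5,5],Q 2[2,2,2,-7,-4,-5,-5],Q 2[2,2,2,-5,-4,-5,-7]][C 2[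
Q 2[1,-2,-2,-2,9,5,5,9]][]],C 3[Q 8[6,4,-4,0,1,1,1]][],C 0[Q 8[6,4,-4,1,1,1,0]][]],C 4[Q 6[7,-9,0,0,-1,-2]][],C 2[Q 8[9,1,2,2,2,2]][],C 1[Q 6[7,-9,-2,0,-1,
0]][],C 3[Q 8[9,1,2,2,2,2]][]],C 1[L 0,Q 8[5,1,1,1,1]][C 3[Q 6[7,-9,0,0,-1,-2]][],C 1[Q 6[7,-9,-2,0,0,-1]][],C 3[Q 8[4,1,1,1,1,1]][]],D 6[L 0,L 1][C 0[L 1,
L 2][],C 3[L 2,Q 9[10,4,1,2,2,0]][],C 0[Q 1[1,-1,5,0,0,-4]][],C 4[Q 6[7,-9,0,0,-1,-2]][],C 2[][C 2[][C 2[Q 2[2,2,2,2,0,0,-8,-8]][]]],C 2[][C 2[][C 2[Q 2[2,2,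
2,2,0,0,-7,-9]][]]],C 2[][C 2[][C 2[Q 2[2,2,2,2,0,0,-7,-9]][]]]],C 2[L 0,L 1][C 0[Q 1[7,7,48,-3,-3,-3],L 1][],C 1[Q 1[1,-1,-5,3,3,0]][],D 6[L 1,Q 6[7,-4,2,1,
1,1]][],C 0[L 2,Q 1[1,1,6,0,0,-1]][],C 0[L 2,Q 1[3,4,23,0,-1,-3]][],C 0[L 1,L 2][],C 3[Q 8[12,6,2,3,3,1]][],C 0[L 2,Q 1[3,4,21,0,0,-3]][]],D 6[L 0,L 1][C 0[
L 2,L 1,Q 6[1,-8,-2,-2,-2,0]][],C 0[L 1,L 2][],C 1[L 1,L 2][C 0[Q 7[6,-1,5,2,2,2,1]][]]],C 0[L 0,L 1,Q 0[1,6,-1,-1,6]][C 1[Q 2[1,-1,5,0,0,-5]][],D 6[L 1,Q 6[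
4,-3,0,0,0,1]][],C 0[L 2,Q 9[8,5,2,1,1,1]][]],D 7[L 1][C 3[L 2,Q 8[8,-13,-1,-1,-1,-2]][]]],C 0[Q 0[1,0,1,0],Q 1[1,-1,1,0]][C 3[Q 1[2,2,-1,15,-1],Q 9[6,22,3,0,
4],Q 0[1,0,1,1,0]][],C 1[Q 1[1,-1,6,-6,0],Q 1[1,0,1,-1,0]][],C 1[Q 1[1,-1,5,-5,0],Q 0[1,0,1,0,0],Q 9[3,22,3,0,3]][C 3[Q 2[1,5,1,-5,5,0]][]],C 2[Q 1[1,-1,7,-8,
0],Q 1[1,0,1,-1,0]][],C 1[Q 1[1,-1,5,-6,0],Q 1[1,0,1,-1,0]][],C 1[Q 1[1,-1,4,-5,0],Q 0[1,0,1,0,0]][C 0[L 2,Q 1[2,0,2,1,13,-2]][],C 3[Q 2[1,5,1,-4,5,0]][]],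
C 2[Q 1[1,-1,5,-6,0],L 1][],C 1[Q 1[1,-1,6,-5,0],L 0][],C 1[Q 1[1,-1,5,-4,0],Q 0[1,0,1,0,0]][D 6[L 1,Q 8[5,2,8,2,1,2]][],D 7[L 2,Q 2[1,6,1,-4,6,1],Q 8[20,3,
-1,3,4,4]][],D 6[L 1,Q 6[7,1,-4,0,2,1]][]],C 2[Q 1[1,-1,8,-8,0],L 1][],C 2[Q 1[1,-1,5,-4,0],L 1][C 3[L 2,Q 9[32,4,-2,4,5,0]][],C 3[Q 2[1,8,1,-6,7,0]][]],C 1[
Q 1[1,-1,6,-5,0],L 1][],C 4[Q 1[1,2,-1,9,-2],L 0][],C 4[L 0,Q 1[2,2,1,12,-3],Q 1[6,7,3,37,-6],Q 1[6,8,-3,43,-7]][],C 2[Q 1[1,-1,5,-6,0],L 0][],C 2[L 1,Q 1[1,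
-1,4,-5,0]][C 4[Q 8[9,2,5,2,1,1]][],C 3[Q 2[1,6,1,-3,4,0]][]],C 1[Q 1[1,-1,5,-6,0],L 1][],C 1[Q 1[1,-1,6,-5,0],L 0][],C 1[L 0,Q 1[1,-1,5,-4,0]][],C 2[Q 1[1,
-2,8,-8,0],L 0][],C 2[L 0,Q 1[1,-1,5,-4,0],L 1][],C 1[Q 1[1,-1,6,-5,0],L 0][],D 2[L 1][],C 1[L 1,L 0,Q 2[1,5,3,-3,1]][C 2[Q 2[1,2,8,4,-5,2]][],D 6[L 1,Q 6[9,
-3,2,1,1,2]][],C 3[L 2,Q 1[1,2,7,-2,5,6]][],C 4[L 2,Q 1[1,2,5,-2,3,6]][]],C 2[L 0,Q 8[22,4,4,3,4]][C 4[Q 8[21,15,5,6,5,3]][],C 3[Q 8[8,5,2,1,2,2]][],C 1[Q 6[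
5,-8,-2,0,0,0]][],C 2[Q 8[5,1,1,1,1,1]][]]],D 8[Q 9[6,1,1,1]][C 3[Q 1[1,1,-1,7,-1],Q 9[2,5,1,0,1],Q 9[7,46,7,0,7]][],C 4[Q 1[2,2,-2,11,-2],Q 1[5,4,-4,24,0],
Q 1[4,3,0,18,-3],Q 0[1,0,0,1,0]][C 4[Q 1[1,-4,-3,3,-18,4]][]],C 1[Q 9[9,30,4,1,5],Q 9[7,15,2,1,3],Q 9[3,22,3,0,3],Q 0[1,0,1,0,0],Q 8[5,-5,-1,1,0]][D 2[Q 9[1,
5,7,1,1,2],Q 1[7,1,1,0,0,-1]][],D 2[Q 0[1,0,0,0,1,0],Q 1[7,1,1,0,0,-1]][],D 2[L 1,Q 9[1,6,15,2,1,3]][],D 2[L 1,Q 9[1,7,21,3,1,4]][],D 2[L 1,Q 9[4,28,82,12,5,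
15]][],C 4[Q 9[8,-11,-83,-10,0,-12]][]],C 0[Q 9[9,30,5,1,4],Q 9[7,14,3,1,2],Q 9[3,22,3,0,3],Q 0[1,0,0,0,1],Q 8[5,-5,0,1,-1]][D 2[Q 9[1,5,7,2,1,1],Q 1[7,1,1,
-1,0,0]][],D 2[Q 0[1,0,0,0,1,0],Q 1[7,1,1,-1,0,0]][],D 2[L 1,Q 9[1,6,16,3,1,2]][],D 2[L 1,Q 9[1,7,21,4,1,3]][],D 2[L 1,Q 9[3,24,71,13,4,10]][],C 3[Q 9[8,-11,
-82,-12,0,-10]][]],C 3[Q 9[9,30,1,4,5],Q 9[7,15,1,2,3],Q 9[3,22,0,3,3],Q 0[1,0,0,1,0],Q 8[5,-5,1,-1,0]][D 2[Q 0[1,0,0,1,0,0],Q 1[7,1,1,0,0,-1]][],D 2[Q 9[1,5,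
7,1,1,2],Q 1[7,1,1,0,0,-1]][],D 2[L 1,Q 9[4,28,82,5,12,15]][],D 2[L 1,Q 9[1,7,21,1,3,4]][],D 2[L 1,Q 9[1,6,15,1,2,3]][],C 4[Q 9[8,-11,-83,0,-10,-12]][]],C 1[
Q 1[2,2,11,-2,-2],Q 1[5,4,24,-4,0],Q 1[4,3,18,0,-3],Q 0[1,0,1,0,0]][C 4[Q 1[1,-4,-3,-18,3,4]][]],C 1[Q 1[4,3,24,-5,-3],Q 9[2,13,0,2,2],Q 9[2,5,0,1,1]][],C 0[
Q 9[9,29,1,5,4],Q 9[7,14,1,3,2],Q 9[3,22,0,3,3],Q 0[1,0,0,0,1],Q 8[5,-5,1,0,-1]][D 2[Q 0[1,0,0,1,0,0],Q 1[7,1,1,0,-1,0]][],D 2[Q 9[1,5,7,1,2,1],Q 1[7,1,1,0,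
-1,0]][],D 2[L 1,Q 9[1,6,16,1,3,2]][],D 2[L 1,Q 9[3,24,71,4,13,10]][],D 2[L 1,Q 9[1,7,21,1,4,3]][],C 1[Q 9[8,-11,-82,0,-12,-10]][]],C 3[Q 9[9,29,5,4,1],Q 9[7,
15,3,2,1],Q 9[3,22,3,3,0],Q 0[1,0,0,1,0],Q 8[5,-5,0,-1,1]][D 2[Q 0[1,0,0,0,0,1],Q 1[7,1,1,-1,0,0]][],D 2[Q 9[1,5,7,2,1,1],Q 1[7,1,1,-1,0,0]][],D 2[L 1,Q 9[5,
34,99,18,14,6]][],D 2[L 1,Q 9[1,7,21,4,3,1]][],D 2[L 1,Q 9[1,6,15,3,2,1]][],C 3[Q 9[8,-11,-83,-12,-10,0]][]],C 0[Q 1[2,2,-2,-2,11],Q 1[5,4,0,-4,24],Q 1[4,3,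
-3,0,18],Q 0[1,0,0,0,1]][C 0[Q 1[2,-7,-5,4,7,-32]][]],C 1[Q 9[9,29,4,5,1],Q 9[7,14,2,3,1],Q 9[3,22,3,3,0],Q 0[1,0,1,0,0],Q 8[5,-5,-1,0,1]][D 2[Q 0[1,0,0,0,0,
1],Q 1[7,1,1,0,-1,0]][],D 2[Q 9[1,5,7,1,2,1],Q 1[7,1,1,0,-1,0]][],D 2[L 1,Q 9[5,34,99,14,18,6]][],D 2[L 1,Q 9[1,6,16,2,3,1]][],D 2[L 1,Q 9[1,7,21,3,4,1]][],
C 1[Q 9[8,-11,-82,-10,-12,0]][]],C 0[Q 1[4,3,-3,-5,24],Q 9[2,13,2,2,0],Q 9[2,5,1,1,0]][]],C 3[Q 0[1,0,0,1],Q 1[1,-1,0,1]][C 2[Q 1[1,-1,6,0,-6]][],C 2[Q 1[1,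
-1,5,0,-5],Q 0[1,0,1,1,0]][],C 3[Q 1[1,-1,7,0,-6]][],C 0[Q 1[5,4,4,-5,32],Q 1[3,2,0,-2,17],Q 9[6,15,2,3,0],Q 1[8,9,-6,-1,67],Q 0[1,0,1,0,1]][],C 2[Q 1[1,-1,5,
0,-5],L 1][],C 3[Q 1[1,-1,7,0,-6]][],C 2[Q 1[1,-1,6,0,-6]][],C 3[Q 1[1,-1,5,0,-5],L 1][],C 2[Q 1[1,-1,5,0,-5],L 1][],D 8[Q 1[1,-1,9,0,-8],Q 1[3,4,-2,-2,22],
Q 1[1,1,-7,6,6],Q 1[6,7,0,-9,39],Q 1[2,2,2,-3,11],Q 9[51,-5,7,7,8]][],C 3[Q 1[1,-1,6,1,-6]][],C 4[L 0,L 1,Q 1[6,5,-37,37,29],Q 1[1,1,-7,7,5],Q 1[6,7,-43,41,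
40]][],C 2[Q 1[1,-1,5,0,-5],L 1][],C 4[L 0,Q 1[1,1,-7,6,6]][],C 4[L 0,Q 1[3,5,-26,20,26],L 1,Q 1[2,3,-16,14,16]][],C 3[Q 1[1,-1,5,0,-4],L 0][],C 3[Q 1[1,-2,8,
0,-9],L 0][],C 4[Q 1[3,5,-24,18,22],L 0][],C 0[Q 1[2,3,-1,-2,15],L 0,Q 1[2,2,2,-3,11]][],C 2[L 0,L 1,Q 2[1,5,3,-1,-4]][C 3[Q 2[1,-1,-5,0,0,5]][],C 3[Q 2[1,-1,
-4,0,0,4]][],D 6[L 1,Q 6[4,-3,1,0,0,0]][],D 7[L 2,Q 2[1,22,86,61,-19,-63]][]],C 0[Q 1[2,5,5,-5,7]][]],C 3[Q 0[1,0,0,1],Q 1[1,-1,0,1]][C 1[Q 1[1,-1,7,0,-6],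
Q 1[1,0,1,0,-1]][],C 1[Q 1[1,-1,7,0,-7],Q 1[1,0,1,0,-1]][],C 1[Q 1[1,-1,5,0,-5],Q 0[1,0,1,0,0],Q 9[3,22,3,3,0]][C 3[L 1,Q 2[3,-6,1,11,6,8],Q 1[3,5,2,8,-4,
12]][]],C 0[Q 1[2,2,-1,-1,15],Q 9[5,17,2,3,0],Q 0[1,0,1,0,1]][],C 1[Q 1[1,-1,6,0,-5],L 1][],C 1[Q 1[1,-1,6,0,-5],L 1][],C 1[Q 1[1,-1,5,0,-4],L 1][C 3[L 2,Q 1[
2,3,2,4,-3,9]][],C 0[L 2,Q 9[32,4,-2,4,0,5]][]],C 1[Q 1[1,-1,5,0,-6],L 1][],C 1[Q 1[1,-1,6,0,-5],L 0][],C 1[Q 1[1,-1,5,0,-4],Q 0[1,0,1,0,0]][D 6[L 1,Q 6[7,1,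
-4,0,1,2]][],D 6[L 1,Q 8[5,2,8,2,2,1]][],D 7[L 2,Q 2[1,6,1,-4,1,6],Q 8[20,3,-1,3,4,4]][]],C 1[Q 1[1,-1,5,0,-6],Q 1[1,0,1,0,-1]][],C 1[Q 1[1,-1,4,0,-5],Q 0[1,
0,1,0,0]][C 3[L 2,Q 1[1,1,1,2,-2,6]][],C 3[L 2,Q 1[2,0,2,1,-2,13]][]],C 1[Q 1[1,-1,6,0,-5],L 0][],D 2[L 1][],C 1[Q 1[1,-2,6,0,-9],L 1][],C 1[Q 1[1,-2,9,0,-8],
L 0][],C 1[L 0,Q 1[1,-1,5,0,-4],L 1][],C 1[Q 1[1,-2,6,0,-9],L 0][],C 1[L 1,Q 1[1,-1,4,0,-5]][C 3[L 2,Q 9[5,1,2,0,1,0]][],C 4[L 2,Q 9[5,1,2,0,1,0]][]],C 1[Q 1[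
1,-1,8,0,-7],L 0][],C 1[L 0,Q 1[1,-1,5,0,-4]][],C 0[Q 1[1,2,-1,-2,9],L 0][],C 0[L 0,Q 1[6,7,2,-7,38],Q 1[6,8,-3,-7,43]][],C 2[L 0,Q 8[22,4,4,4,3]][C 2[Q 8[5,
1,1,1,1,1]][],C 3[Q 8[8,5,2,1,2,2]][],C 1[Q 6[5,-8,-2,0,0,0]][],C 0[Q 8[21,15,5,6,3,5]][]],C 0[L 1,L 0,Q 2[1,-3,1,3,5]][C 1[Q 2[1,2,-4,2,5,8]][],D 6[L 1,Q 6[
9,-3,1,2,1,2]][],C 0[Q 1[1,1,7,0,0,7]][],C 0[Q 2[1,-1,4,0,0,-5]][]]],D 2[Q 0[1,0,1,0],Q 0[1,1,0,1]][D 7[L 1][C 0[L 2,Q 8[8,-13,-1,-1,-2,-1]][]],C 3[L 0,L 1,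
Q 0[1,4,-1,4,-1]][C 0[Q 2[1,-1,5,0,-5,0]][],C 2[L 2,Q 9[8,5,2,1,1,1]][],D 6[L 1,Q 6[4,-3,0,0,1,0]][]],D 6[L 0,L 1][C 3[L 1,L 2][C 0[L 3,Q 1[7,7,-1,18,18,-4,
18]][]],C 3[L 1,L 2][],C 2[L 2,L 1,Q 6[1,-8,-2,-2,0,-2]][]],C 3[L 0,L 1][C 2[Q 1[7,7,48,-3,-3,-3],L 1][],C 2[L 2,Q 1[1,1,6,0,-1,0]][],C 2[L 2,Q 1[3,4,23,0,-3,
-1]][],D 6[L 1,Q 6[7,-4,2,1,1,1]][],C 4[Q 1[1,-1,-8,4,0,4]][],C 2[L 2,Q 1[2,3,17,0,-3,0]][],C 3[L 1,L 2][],C 3[L 1,Q 1[3,4,23,0,-1,-1]][]],C 1[L 0,Q 8[5,1,1,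
1,1]][C 2[Q 8[4,1,1,1,1,1]][],C 1[Q 6[7,-9,-2,0,-1,0]][],C 0[Q 6[7,-9,0,0,-2,-1]][]],D 6[L 0,L 1][C 2[][C 2[][C 2[Q 2[2,2,2,2,0,-7,-9,0]][]]],C 2[][C 2[][C 2[
Q 2[2,2,2,2,0,-7,-9,0]][]]],C 1[Q 6[7,-9,0,0,-2,-1]][],C 2[][C 2[][C 2[Q 2[2,2,2,2,0,-8,-8,0]][]]],C 2[Q 1[1,-1,5,0,-4,0]][],C 2[L 1,L 2][],C 2[Q 1[1,-2,7,0,
-8,0]][]],C 1[L 0][C 3[L 1,Q 8[1,9,2,2,2,2]][C 1[Q 8[2,11,12,5,5,5,5],Q 2[2,2,2,-5,-4,-7,-5],Q 2[2,2,2,-7,-4,-5,-5]][C 0[Q 2[1,-2,-2,-2,9,5,9,5]][]],C 3[Q 8[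
6,4,-4,1,1,0,1]][],C 2[Q 8[6,4,-4,0,1,1,1]][]],C 3[Q 8[9,1,2,2,2,2]][],C 2[Q 6[7,-9,-2,0,0,-1]][],C 1[Q 6[7,-9,0,0,-2,-1]][],C 3[Q 8[9,1,2,2,2,2]][]],D 6[
L 0][C 2[L 2,Q 9[5,2,1,0,1,0]][],C 1[][C 2[][C 1[Q 9[6,6,6,3,4,4,4,4]][]]],C 2[][C 1[][C 2[Q 9[6,6,6,3,4,4,4,4]][]]],C 2[L 2,Q 9[14,5,2,1,2,1]][]]],C 0[Q 0[1,
1,1,0]][C 1[Q 2[1,-1,5,-5,0],Q 0[1,0,1,1,0]][],C 1[Q 1[1,1,7,8,0],Q 0[1,0,1,1,0]][],C 2[Q 2[1,-1,5,-5,0],L 1][],C 1[Q 2[1,-1,5,-5,0],L 0][],C 1[Q 2[1,-1,4,-4,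
0],Q 0[1,0,1,1,0]][],C 2[Q 2[1,-1,5,-5,0],L 1][],D 2[L 1][],D 2[L 1][],C 1[Q 2[1,-1,5,-4,0],L 0][],C 1[L 0,Q 2[1,-1,4,-3,0]][],C 2[Q 2[1,-1,5,-4,0],L 0][],
C 2[L 1,Q 2[1,-1,4,-3,0]][],C 1[Q 2[1,-1,5,-4,0],L 1][],D 2[L 1][]],C 0[Q 0[1,1,1,0]][D 8[Q 1[1,1,7,7,0],Q 2[1,1,-5,7,6],Q 9[28,-4,3,4,4]][],D 2[L 1,Q 2[1,-2,
8,-12,-6],Q 2[2,2,-6,10,5]][],C 0[Q 1[1,1,7,7,0],L 1][],D 8[Q 2[1,-1,5,-5,0],Q 2[1,1,-5,7,6],Q 9[35,-3,4,5,5]][],D 2[L 1,Q 2[1,-2,7,-9,-4],Q 2[2,7,-24,34,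
16]][],C 0[Q 2[1,-1,4,-4,0],L 1][],D 2[L 1][],D 2[L 0,L 1][],D 2[L 1,L 0][],C 0[Q 2[2,-2,9,-7,0],L 0][],C 1[L 1,Q 2[1,2,-4,8,6]][]]],C 0[Q 0[1,1,1]][C 0[Q 2[
1,-1,6,-7],Q 0[1,0,1,1]][],C 0[Q 1[1,1,7,8],Q 0[1,0,1,1]][],C 0[Q 2[1,-1,5,-5],Q 0[1,0,1,1]][],C 0[Q 2[1,-1,4,-4],Q 0[1,0,1,1]][],C 0[Q 2[1,-2,8,-8],Q 0[1,0,
1,1]][],C 0[Q 2[2,-2,9,-7],Q 0[1,0,1,1]][]]]]"

definition "cert_888887633322 =
D 2[][D 2[Q 0[1,1]][D 3[Q 0[1,1,1]][D 3[L 0][D 3[L 1][]],D 3[L 0][C 2[L 1,Q 2[1,7,-1,-4,-4]][],D 7[L 1][C 2[L 2,Q 8[4,-8,-1,-2,-1,-1]][]],D 7[L 1][C 2[L 2,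
Q 8[1,-5,-1,-1,-1,-1]][C 1[L 3,Q 9[7,6,0,1,1,1,1]][],D 3[L 3,Q 2[4,0,1,0,-1,-2,-3]][]]],C 3[L 1,Q 2[2,9,-2,-5,-5]][],D 3[L 1,L 0][C 6[L 2,Q 9[13,3,3,3,1,
1]][],C 0[L 2,Q 9[23,1,1,5,4,4]][],D 6[L 1,Q 7[10,4,4,4,3,3]][],C 5[L 2,Q 9[13,3,3,3,1,1]][],D 6[L 1][D 7[L 3,Q 8[9,4,4,2,4,3,3]][]],C 5[L 2,L 0][],C 4[L 2,
L 0][],C 0[L 2,Q 9[23,1,1,5,4,4]][],D 7[L 2,Q 2[2,6,7,-8,0,-8]][]],C 1[L 1,L 0,Q 9[31,6,1,5,5]][D 3[L 2,Q 2[3,2,-6,5,0,-1]][],D 3[L 2,Q 2[4,2,-6,5,0,0]][],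
C 0[L 2,Q 2[1,-1,5,-4,0,0]][],D 3[L 2][],D 3[L 2][],D 7[L 2,Q 8[24,0,6,6,5,5]][],D 3[L 2][],D 7[L 2,Q 8[20,0,5,5,4,4]][],D 6[L 1,Q 7[4,1,1,1,1,1]][]],D 3[
L 1][C 4[L 2,Q 9[13,3,3,3,1,1]][],C 5[L 2,Q 9[13,3,3,3,1,1]][],D 7[L 2,Q 8[17,5,2,5,4,4]][]],D 3[L 1][D 6[L 1,Q 7[4,1,1,1,1,1]][],D 6[L 1,Q 7[4,1,1,1,1,1]][],
D 7[L 2,Q 8[19,5,5,2,4,4]][],C 1[L 2,Q 9[16,3,1,1,3,3],Q 2[7,-22,20,12,-1,-2]][],C 4[L 2,Q 9[17,1,4,1,3,3]][],C 2[L 2,Q 9[16,3,1,1,3,3],Q 2[7,-22,12,20,-1,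
-2]][],D 7[L 2,Q 8[19,5,2,5,4,4]][],C 3[L 2,Q 9[13,3,3,3,1,1]][],C 5[L 2,Q 9[13,3,3,3,1,1]][],C 3[L 2,Q 9[13,3,3,3,1,1]][],D 6[L 1,Q 7[4,1,1,1,1,1]][],D 6[
L 1,Q 7[4,1,1,1,1,1]][]],D 3[L 1][],D 3[L 1,L 0][],D 3[L 1,L 0][D 6[L 1,Q 7[4,1,1,1,1,1]][]],D 3[L 1][D 6[L 1,Q 7[4,1,1,1,1,1]][],D 6[L 1,Q 7[4,1,1,1,1,
1]][]],D 3[L 1][]],D 3[L 0][D 3[L 1,L 0][],D 3[L 1,L 0][C 6[L 2,L 0][]],D 3[L 1,L 0][C 3[L 2,Q 9[23,5,1,1,4,4]][]],D 7[L 1][C 0[L 2,Q 8[4,-8,-2,-1,-1,-1]][]],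
D 3[L 1][C 5[L 2,L 0][],C 5[L 2,L 0][]],D 3[L 1][D 7[L 2,Q 2[2,-8,6,7,0,-8]][],D 7[L 2,Q 2[2,-8,7,6,0,-8]][]],D 3[L 1,L 0][C 4[L 2,Q 9[13,3,3,3,1,1]][],D 6[
L 1][D 7[L 3,Q 8[9,4,4,4,2,3,3]][]],D 6[L 1,Q 7[10,4,4,4,3,3]][],C 5[L 2,Q 9[13,3,3,3,1,1]][],C 4[L 2,Q 9[23,1,5,1,4,4]][],D 7[L 2,Q 2[2,6,-8,7,0,-8]][],C 4[
L 2,Q 9[23,1,5,1,4,4]][],C 5[L 2,L 0][],C 6[L 2,L 0][]],D 3[L 1][D 7[L 2,Q 8[17,5,5,2,4,4]][],C 4[L 2,Q 9[13,3,3,3,1,1]][],C 3[L 2,Q 9[13,3,3,3,1,1]][]],D 3[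
L 1,L 0][]],D 3[L 0][D 3[L 1,L 0][],C 1[L 1,Q 2[1,-1,7,-4,-4]][],C 1[L 1,Q 2[2,-2,9,-5,-5]][]]],C 0[][C 0[Q 1[1,-1,7,-8],Q 1[3,-1,8,-9]][],C 0[Q 1[1,-1,6,-8],
Q 1[2,-1,3,-6],Q 1[3,-1,6,-6]][],C 0[Q 1[1,-1,7,-8],Q 1[3,-1,8,-8]][],C 0[Q 1[1,-1,5,-5],Q 1[3,-1,6,-6]][D 3[L 1][],C 3[L 1,Q 1[1,5,-1,8,-6]][]],C 0[Q 1[1,-1,
6,-6],Q 1[3,-1,8,-9]][],C 0[Q 1[1,-1,5,-5],Q 1[2,-1,4,-5]][D 3[L 1][],D 3[L 1][]],C 0[Q 1[1,-1,7,-7],Q 1[3,-1,8,-8]][],C 0[Q 1[1,-1,6,-6],Q 1[2,-1,5,-5]][D 3[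
L 1][],C 2[L 1,Q 1[1,8,-2,15,-12]][],D 3[L 1][]],C 0[Q 1[1,-2,8,-9],Q 1[2,-1,6,-7]][],C 0[Q 1[1,-2,7,-9],Q 1[3,-2,6,-9]][D 3[L 1][],C 4[L 1,Q 1[1,4,-2,6,
-8]][],D 3[L 1][]],C 0[Q 1[1,-1,6,-5],Q 1[2,-1,6,-6]][],C 0[Q 1[1,-1,5,-4],Q 1[3,-2,7,-8]][D 3[L 1][],C 1[L 1,Q 1[1,-16,6,-34,27]][],D 3[L 1][]],D 3[L 0,Q 1[
1,-9,11,-16],Q 1[1,18,-23,31]][],C 0[L 0,Q 1[1,-3,6,-7]][C 1[L 1,Q 1[1,-1,5,-6,8]][],C 2[L 1,Q 1[1,-2,8,-12,15]][],D 3[L 1][],D 3[L 1][],C 1[L 1,Q 1[1,-2,5,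
-6,8]][],D 3[L 1][],C 1[L 1,Q 1[1,-2,4,-8,6]][],D 3[L 1][],D 3[L 1][]],C 2[L 0,Q 1[1,6,-5,9]][],C 2[Q 3[3,13,-1,-9],L 0][D 3[L 1][]]],D 8[][C 3[Q 1[8,7,-7,
53],Q 1[3,1,-1,7],Q 1[3,2,-2,17]][C 2[Q 1[1,-4,-4,6,-31],Q 3[5,0,1,-3,0],Q 1[4,-8,-7,10,-60]][],C 1[Q 1[1,-5,-5,5,-37]][],C 1[Q 9[4,9,20,4,0],Q 1[2,-8,-7,1,
-55],Q 10[7,3,7,2,1]][C 1[Q 2[3,0,2,2,4,13],Q 1[1,1,-8,-7,5,-57]][]],C 1[Q 1[2,-5,-4,2,-33],Q 9[2,5,8,2,0]][C 1[L 2,Q 1[1,6,-9,-8,5,-61]][]],C 1[Q 9[1,2,5,1,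
0],Q 7[4,0,-3,0,1]][],C 2[Q 9[3,7,22,4,0],Q 9[8,6,18,4,1],Q 8[5,-2,-4,0,1]][D 8[H 3][],C 0[H 3,Q 9[1,7,4,13,3,1]][]],C 2[Q 1[3,-7,-5,3,-40],Q 9[1,2,5,1,0],
Q 7[4,0,-3,0,1]][C 4[Q 9[2,8,14,35,7,0],Q 1[1,4,-9,-6,1,-48]][]],C 2[Q 9[8,8,45,7,0],Q 9[9,4,19,4,1],Q 1[2,-4,-1,0,-8]][C 2[Q 9[4,13,7,27,6,2]][],D 7[L 2,Q 8[
7,1,1,-2,1,1]][]],C 1[Q 1[1,8,3,0,19],L 1][],C 3[Q 1[1,-6,-2,6,-15],L 1][]],C 3[Q 1[6,5,-3,38],Q 1[10,3,-4,23]][C 1[Q 2[1,2,2,5,15]][D 3[L 2][]],D 3[Q 2[2,-1,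
-1,-3,-10],Q 3[4,0,1,-2,0],Q 2[4,3,4,7,26],Q 3[4,1,0,-2,0],Q 2[4,4,3,7,26]][D 3[L 2][]],C 3[Q 1[1,-4,-4,6,-31],Q 3[5,1,0,-3,0],Q 1[4,-7,-8,10,-60]][],C 1[Q 2[
1,3,3,8,21],Q 7[1,7,-5,0,0]][],C 3[Q 1[2,-8,-7,9,-55],Q 9[3,8,15,3,0],Q 1[2,-2,-2,2,-14]][D 3[L 2,Q 9[1,2,6,9,2,0]][],D 3[L 2][]],C 2[Q 1[2,-10,-8,7,-66],Q 3[
4,0,1,-2,0],Q 2[4,3,3,5,20]][C 3[L 2,Q 1[1,1,-5,-4,3,-33]][],D 3[L 2][]],C 3[Q 9[1,2,6,1,0],Q 1[2,-6,-5,4,-35],Q 8[5,0,-5,-1,1]][C 0[Q 1[3,3,-7,-5,8,-37]][],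
D 3[L 2,Q 9[1,4,9,23,4,0]][]],C 3[Q 1[1,-6,-4,5,-33],Q 9[1,2,5,1,0],Q 1[3,-2,-1,4,-9]][D 3[L 2,Q 1[1,5,-8,-5,5,-41]][],D 3[L 2][],D 3[L 2,Q 9[1,2,4,10,2,
0]][]],C 2[Q 1[1,-8,-5,5,-43],Q 3[4,0,1,-2,0],Q 1[1,-3,-2,2,-16]][D 3[L 2][]],C 3[Q 9[5,3,15,2,0],Q 9[9,11,60,8,-1],Q 9[13,6,29,4,1],L 1,Q 8[8,0,-8,-1,1]][
C 2[Q 9[4,18,8,34,5,2]][],C 0[L 2,Q 1[2,3,-3,-1,11,-6]][],D 3[L 2,Q 9[1,5,4,18,3,0]][]],C 3[L 1,Q 1[1,-6,-2,5,-14],Q 9[6,7,37,5,0]][]],C 3[Q 1[1,1,-1,6],Q 1[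
4,3,-3,18],Q 1[5,2,-2,10],Q 1[6,5,0,33],Q 1[7,6,-9,39]][D 8[Q 1[1,-6,-6,3,-39],Q 1[1,15,15,-6,98],Q 1[1,-10,-10,1,-67]][],C 1[Q 1[2,-6,-6,3,-38],Q 1[1,-2,-2,
1,-13]][C 2[L 2,Q 2[1,6,-1,-1,-7,-7],Q 1[2,3,-4,-4,0,-27]][],C 1[Q 1[2,4,-7,-7,8,-47]][]],C 1[Q 1[2,-7,-7,8,-47]][C 1[Q 1[4,4,-9,-9,9,-58],L 2][],C 2[Q 1[1,1,
-2,-2,2,-13]][]],C 1[Q 1[2,-6,-5,0,-34]][D 3[L 2][],C 3[L 2,Q 2[1,5,-1,-1,-6,-5]][],D 3[L 2][]],C 2[Q 1[2,-7,-6,12,-38],Q 3[5,0,1,-3,0],Q 1[3,-3,-2,5,-16]][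
C 2[H 3,Q 9[2,9,5,-5,0,1]][],D 3[L 2,Q 1[2,1,-6,-5,6,-33]][],C 2[L 2,Q 1[3,2,-6,-5,8,-33]][],C 0[L 2,Q 2[2,3,2,2,15,12]][],D 3[L 2,Q 1[1,0,-1,-1,0,-6]][]],
C 4[Q 1[3,-11,-9,11,-61],Q 1[1,-6,-5,8,-33]][D 3[L 2][]],C 1[Q 1[2,-4,-3,0,-17]][D 8[H 3][],D 3[L 2,Q 9[2,2,1,12,2,0]][],C 3[L 2,Q 2[1,6,-1,-1,-7,-5]][],D 3[
L 2,Q 9[7,7,2,43,7,1]][],C 2[Q 1[6,9,-17,-13,-5,-81]][],D 3[L 2,Q 9[7,7,2,46,7,1]][]],C 2[Q 1[4,-9,-7,0,-43],Q 1[1,-5,-4,0,-23]][C 1[L 2,Q 2[1,4,-1,-1,-5,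
-5]][],C 3[L 2,Q 2[1,5,-1,-1,-6,-5]][],D 3[L 2][]],C 3[Q 1[2,-7,-5,12,-33],Q 3[5,0,1,-3,0],Q 1[2,-2,-1,3,-8]][C 2[Q 1[1,-1,4,3,-6,18],Q 9[1,8,3,-3,0,1]][],
C 2[L 2,Q 1[1,-1,6,4,-5,25]][],C 2[L 2,Q 1[1,-1,8,6,-8,37]][],D 3[L 2,L 1][],D 3[L 2,Q 1[1,1,-4,-3,4,-18]][]],C 1[L 1,Q 3[2,9,1,0,-6]][]],C 4[Q 1[6,5,0,33],
Q 1[5,2,0,9],Q 1[1,1,-1,6],Q 1[4,3,-3,21]][C 2[Q 2[3,8,8,27,55],Q 9[5,5,-5,0,1],Q 3[4,0,1,-2,0],Q 2[5,4,5,9,27],Q 9[7,11,-9,0,1],Q 2[3,5,5,18,35]][C 0[Q 2[2,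
3,5,6,17,38]][],C 0[Q 2[2,3,5,5,15,34]][],C 1[Q 9[1,-2,-7,6,0,0]][],D 3[L 2,Q 9[3,3,18,0,2,0],Q 9[1,-1,-9,8,0,0]][]],C 3[Q 1[1,-2,-2,3,-13],Q 1[4,-3,-3,5,
-19]][C 1[Q 1[1,3,-6,-6,8,-39]][],C 0[L 2,Q 2[3,7,4,4,11,27]][],C 1[Q 1[6,1,-6,-6,0,-40],Q 6[5,0,-2,-2,0,1]][],C 0[Q 2[1,3,2,2,7,14],L 2][D 3[L 3,L 2][]]],
C 4[Q 1[3,-6,-6,5,-37],Q 1[56,-58,-57,83,-371],Q 1[56,-57,-58,83,-371]][C 1[L 2,Q 3[2,9,0,0,-6,1]][],C 4[L 2,Q 1[1,4,-7,-7,4,-46],Q 1[1,9,-14,-14,8,-91]][],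
C 3[L 2,Q 3[2,9,0,0,-6,1]][],D 3[L 2][]],C 1[Q 1[3,-8,-8,0,-55],Q 1[2,-3,-3,0,-19]][C 3[Q 2[1,6,-1,-1,-8,-6],L 2][]],D 8[Q 1[1,-6,-6,3,-39],Q 1[1,18,18,-7,
120],Q 1[1,-10,-10,1,-67]][],C 2[Q 1[2,-6,-6,3,-38],Q 1[1,-2,-2,1,-13]][C 3[L 2,Q 2[1,6,-1,-1,-7,-7],Q 1[2,3,-4,-4,0,-27]][],C 0[Q 1[2,4,-7,-7,8,-47]][]],C 1[
Q 6[17,-7,-6,1,4],Q 1[1,-1,-1,0,-6]][C 1[Q 2[5,0,3,3,7,17],Q 2[3,-4,9,8,33,54]][],C 1[H 3,Q 8[2,1,8,-8,0,0]][],D 3[L 2][],D 3[L 2][],C 0[L 2,Q 1[2,5,-9,-8,1,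
-52],Q 9[8,9,5,46,7,1]][D 3[L 3][]]],C 4[Q 1[2,-7,-6,3,-40],Q 2[7,6,5,14,36],Q 1[5,-7,-6,4,-37]][C 0[Q 2[1,1,1,1,6,6],L 2][],D 3[L 2][],D 3[L 2,Q 9[5,5,0,30,
4,0],Q 1[3,1,-6,-5,0,-34]][],D 3[L 2][],D 3[L 2][],D 3[L 2][]],C 4[Q 1[2,-5,-4,6,-27],Q 1[1,-1,-1,2,-6]][C 4[L 2,Q 9[6,0,3,-1,1,1],Q 8[5,4,28,-24,1,0]][],D 3[
L 2][],D 3[L 2,Q 1[3,4,-6,-5,5,-34]][],D 3[L 2,Q 9[4,4,0,29,4,0],Q 8[9,1,42,-49,0,1]][],D 3[L 2,Q 9[7,6,3,34,5,1]][],D 3[L 2][],C 0[L 2,Q 1[4,18,-9,-8,39,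
-50]][]],C 4[Q 1[3,-7,-6,6,-39]][D 3[L 2][],D 3[L 2][],D 3[L 2][],D 3[L 2][]],C 2[Q 1[3,-9,-8,0,-53]][C 1[L 2,Q 1[1,5,-9,-7,1,-49]][],D 3[L 2][],D 3[L 2][],
D 3[L 2][]],C 2[Q 1[2,-9,-8,6,-51]][D 3[L 2][]],C 2[Q 1[5,-7,-5,-3,-32]][C 0[H 3,Q 9[1,6,2,9,2,1]][],C 3[L 2,Q 2[1,6,-1,-1,-8,-5]][],C 0[L 2,Q 1[1,5,-7,-5,0,
-33]][],D 3[L 2][],D 3[L 2][],D 3[L 2,Q 9[6,6,2,34,5,1]][],D 3[L 2,Q 9[5,6,2,31,5,1]][]],C 4[Q 1[1,-5,-4,2,-24],Q 1[2,-7,-5,1,-32]][D 3[L 2][],D 3[L 2,L 1][],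
D 3[L 2][],D 3[L 2][],D 3[L 2][],D 3[L 2][],D 3[L 2][]],C 4[Q 1[1,-4,-3,5,-18],Q 1[2,-3,-2,2,-12]][D 3[L 2][],D 3[L 2,Q 1[1,5,-8,-6,5,-36]][],D 3[L 2,L 1][],
D 3[L 2,Q 1[2,1,-4,-3,1,-18]][],D 3[L 2][],C 4[L 2,Q 1[4,19,-21,-15,31,-96],Q 8[13,2,6,-5,2,2]][],D 3[L 2,Q 9[8,7,2,41,6,1]][]],C 4[Q 1[3,-8,-6,6,-37]][D 3[
L 2][]],C 2[Q 1[5,-16,-12,4,-77]][C 4[L 2,Q 2[1,5,-1,-1,-6,-5]][],D 3[L 2][],D 3[L 2][]],C 1[Q 1[1,6,2,0,9],L 1][],C 2[L 1,Q 1[1,6,2,1,9]][]],C 2[Q 1[6,5,0,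
33],Q 1[3,1,0,5]][D 8[Q 2[1,-33,-33,-101,-233],Q 2[1,7,7,18,47]][],C 3[Q 2[3,8,8,27,55],Q 9[5,-5,5,0,1],Q 3[4,1,0,-2,0],Q 2[5,5,4,9,27],Q 9[7,-9,11,0,1],Q 2[
3,5,5,18,34]][C 0[Q 2[2,3,7,6,22,46]][],C 3[Q 9[1,-2,6,-7,0,0]][],C 0[Q 2[2,3,5,5,15,35]][],D 3[L 2,Q 9[3,3,0,18,2,0],Q 9[1,-1,8,-9,0,0]][]],D 8[Q 1[1,-8,-8,
6,-51],Q 1[1,15,15,-6,98],Q 1[1,-10,-10,1,-67]][],C 0[Q 9[9,4,0,2,1],Q 6[7,-5,0,1,2],Q 2[7,0,1,-7,-1],Q 8[9,44,-54,0,1]][C 0[Q 2[1,-1,4,3,12,22],Q 3[8,2,0,0,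
-6,1]][],C 1[H 3,Q 2[1,0,1,1,3,7],Q 3[3,1,0,0,-2,0]][],D 3[L 2][]],C 2[Q 1[2,-8,-7,1,-45],Q 1[4,-6,-5,3,-31]][C 0[L 2,Q 2[1,1,1,1,6,6]][],D 3[L 2,Q 1[3,3,-7,
-6,1,-39]][],D 3[L 2][],D 3[L 2][],D 3[L 2][]],D 8[Q 9[6,2,-1,1,1]][C 2[Q 9[3,18,0,0,3,3],Q 9[3,4,1,0,1,1],Q 2[7,0,0,1,-7,-1]][D 3[L 3][],D 3[L 3][]],C 1[
Q 10[4,4,0,0,1,1],Q 9[3,5,0,-1,1,1],Q 9[5,26,-1,0,4,4]][D 3[L 3][],D 8[H 3][],D 3[L 3][]],C 0[Q 9[7,41,0,5,6,6],Q 9[4,9,0,0,1,2]][],C 0[H 3,Q 8[4,-24,-9,21,2,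
-3]][]],C 2[Q 1[1,-4,-3,1,-19]][D 3[L 2,L 1][],D 3[L 2][],D 3[L 2][],D 3[L 2][]],D 3[L 1][]],C 2[Q 9[8,24,4,3],Q 9[1,7,1,1],Q 9[7,17,3,2]][C 2[Q 8[8,23,-28,
-1,-4],Q 8[1,7,-8,0,-1],Q 10[5,13,12,3,2],Q 7[6,-7,6,0,2]][D 8[H 3,Q 7[1,3,-4,4,0,1],Q 1[3,3,0,0,18,-2]][],C 3[H 3,Q 1[4,-1,3,0,-2,19],Q 1[6,0,2,1,0,9]][],
D 3[Q 8[1,8,11,-16,-1,-2],Q 2[18,3,2,3,-3,-2]][],D 8[H 3,Q 1[3,-1,3,0,-4,21]][]],C 1[Q 8[3,6,-8,0,-1],Q 8[1,5,-5,0,-1],Q 7[2,-4,3,0,1],Q 10[8,18,16,5,3]][],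
C 0[Q 1[7,6,0,-5,48],Q 8[2,4,-5,0,-1],Q 8[1,4,-4,0,-1],Q 7[5,-6,6,1,1],Q 10[3,7,6,2,1]][],C 1[Q 9[1,7,14,3,2],Q 9[7,30,63,13,9]][D 8[H 3][],C 3[H 3,Q 1[7,0,3,
1,0,11]][],C 4[H 3,Q 1[5,0,6,0,0,33],Q 9[2,-2,-9,-20,-4,-3]][]],C 0[Q 1[2,2,0,-2,11],Q 1[5,6,0,0,33],Q 1[6,2,1,-1,8],Q 1[6,7,0,-9,39]][C 3[Q 1[3,-7,-8,1,5,
-44]][],C 0[L 2,Q 1[1,-5,-4,0,8,-22]][],C 0[H 3,Q 3[5,0,1,1,-2,0]][D 8[H 3,Q 9[7,-4,-2,2,5,2,1]][],C 3[Q 2[3,3,2,3,0,20,14]][]],C 0[Q 1[1,-21,-18,0,9,-97],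
L 2][]],C 0[Q 1[6,7,0,-6,46],Q 1[5,4,0,-2,27],Q 1[3,1,0,-1,7]][C 0[Q 1[1,-4,-3,0,4,-21]][],D 8[H 3][],C 2[Q 1[3,14,5,1,0,29]][]],C 0[Q 1[6,7,0,-3,33],Q 9[5,
-8,-27,-4,-4],Q 1[9,4,1,0,13]][C 4[H 3,Q 9[2,-6,17,57,9,8]][],C 1[Q 1[3,-5,-7,1,5,-32]][],C 1[Q 1[1,-5,-7,0,3,-33],Q 3[5,0,0,1,-3,0],Q 1[3,-6,-8,1,1,-37]][
D 3[L 3][]],C 0[Q 9[2,3,-8,-25,-4,-3]][],C 1[Q 1[5,-15,-18,1,3,-82]][]],C 0[Q 1[7,3,1,-2,9],Q 1[4,5,0,-3,23],Q 1[5,6,0,-8,27]][C 0[Q 1[2,-11,-13,0,14,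
-59]][]],C 0[Q 1[3,4,0,-3,21],Q 1[4,2,0,-2,10],Q 6[7,-9,3,0,1]][C 0[Q 1[1,-5,-6,0,5,-33]][],C 2[L 2,Q 1[1,6,2,1,0,10]][]],C 2[Q 3[2,9,0,1,-6],Q 9[1,-13,-85,
-13,-11]][D 3[L 2][]],C 3[Q 3[2,9,0,-1,-7],L 1][],C 4[Q 9[2,-5,-33,-5,-4]][D 3[L 2][],D 3[L 2][],D 3[L 2][]],C 0[Q 1[1,2,0,-2,6],L 1][]],C 1[Q 9[2,5,1,1],Q 9[
1,6,1,1],Q 10[4,4,1,1]][C 2[Q 9[1,6,9,2,2],Q 9[3,-11,-24,-5,-4]][D 8[H 3][],D 8[H 3][]],C 1[Q 9[4,18,29,7,7],Q 10[5,5,5,2,2]][C 3[H 3,Q 3[11,0,2,2,0,-5]][],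
C 2[H 3][D 3[Q 2[3,-14,-4,-2,-2,4,5],Q 2[3,-14,-4,-2,-2,5,4]][]],C 0[H 3,Q 3[11,0,2,2,-4,1]][]],C 0[Q 9[1,6,9,2,2],Q 9[3,-11,-24,-4,-5]][D 8[H 3][],D 8[
H 3][]],C 1[Q 9[1,6,16,3,3],Q 6[18,-28,9,-1,0]][D 8[H 3][],C 1[H 3,Q 6[2,-2,6,-2,0,1]][]],C 1[Q 2[5,0,1,-6,-1],Q 2[5,0,1,-1,-6],Q 9[7,35,88,17,17]][C 2[H 3,
Q 6[2,-2,6,-2,1,1]][],C 3[H 3,Q 8[1,6,2,-2,1,1]][],C 1[H 3,Q 6[1,14,-21,7,0,0]][],C 1[H 3,Q 8[2,9,1,-5,1,1]][],C 0[H 3,Q 8[1,6,2,-2,1,1]][],C 4[Q 9[1,1,4,8,2,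
2],H 3][],C 2[Q 9[3,2,9,21,5,5]][],C 3[Q 9[4,3,15,33,7,7],Q 6[3,-2,-8,3,0,-1]][],C 3[Q 9[1,1,4,9,2,2],Q 8[7,2,2,-4,1,1]][],C 3[Q 9[1,1,4,8,2,2],H 3][],C 2[
Q 9[4,3,18,42,9,9],Q 6[3,-2,-8,3,-1,0]][]],C 2[Q 9[1,6,16,3,3],Q 6[18,-28,9,0,-1]][D 8[H 3][],C 4[H 3,Q 6[2,-2,6,-2,1,0]][]],C 2[Q 2[1,6,0,-1,-7],Q 2[7,25,1,
0,-32],Q 2[9,43,1,-1,-53],Q 2[6,22,1,-7,-23],Q 2[9,43,1,-10,-44]][C 0[L 2,Q 2[1,-5,-25,0,5,27],Q 2[1,-2,-9,0,1,10]][],C 0[L 2,Q 2[7,-27,-106,-1,23,98]][D 3[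
L 3][]],C 0[L 2,Q 2[1,-5,-19,0,5,21],Q 2[1,-2,-7,0,1,8]][],D 3[L 2][],D 3[L 2,L 1,Q 9[1,0,9,51,8,8]][],D 3[L 2,Q 9[1,0,6,32,5,5],Q 2[5,0,-1,1,-6,0]][],D 3[
L 2,L 1][]],C 2[Q 2[1,-4,0,5,4],L 1][D 7[L 2,Q 8[10,2,1,-5,1,1]][]],C 1[Q 9[9,-31,-175,-26,-28]][D 3[L 2,Q 9[1,6,-8,-45,-6,-7],Q 9[3,-10,27,150,23,24]][D 3[
L 3][]],D 3[L 2,Q 9[1,7,-8,-44,-6,-7],Q 9[1,-6,8,45,6,7]][],D 3[L 2,Q 1[8,2,-2,1,0,17],Q 2[5,0,0,1,-1,-6],Q 1[6,2,0,1,-3,13]][D 3[L 3][],D 3[L 3][],D 3[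
L 3][],D 3[L 3][],D 3[L 3][]],C 0[Q 9[7,8,-16,-90,-13,-13]][D 8[H 3,Q 9[10,5,16,-25,-138,-18,-20],Q 1[6,-1,6,0,0,-5,38]][],D 8[H 3,Q 1[3,0,3,0,0,-2,18],Q 1[3,
3,-1,0,0,21,-6]][],C 2[H 3,Q 8[2,-3,9,2,8,3,1],Q 2[5,0,0,0,1,-6,-1],Q 2[5,0,-1,-5,1,0,0],Q 2[10,1,-2,-2,2,-4,-11]][]],D 3[L 2,Q 9[1,-5,10,55,8,9],Q 9[1,7,-9,
-50,-7,-8]][D 3[L 3][]],D 3[L 2,Q 1[7,1,7,1,-7,-1],Q 3[4,-1,-5,1,0,0],Q 2[5,0,0,1,-1,-6]][D 3[L 3][],D 3[L 3][],D 3[L 3][],D 3[L 3][],D 3[L 3][],D 3[L 3][]],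
C 0[Q 9[8,5,-20,-113,-17,-17],Q 8[4,9,3,18,4,3],Q 8[5,-5,0,0,-1,1]][D 3[L 3][],C 1[H 3,Q 8[2,9,-3,2,8,1,3],Q 2[5,-1,0,-5,1,0,0],Q 2[5,0,0,0,1,-1,-6],Q 2[10,
-2,1,-2,2,-11,-4]][],D 3[L 3][],D 3[L 3][],D 3[L 3][],D 3[L 3][]],C 0[Q 9[2,3,-6,-34,-5,-5]][],D 3[L 2][],D 3[L 2][],D 3[L 2][],D 3[L 2,Q 9[1,-5,16,88,13,14],
Q 2[4,-1,-5,1,0,0],Q 9[1,5,-10,-57,-8,-9]][],D 3[L 2,Q 9[1,-3,10,55,8,9],Q 2[5,0,0,1,-6,-1],Q 9[1,6,-17,-95,-14,-15]][],D 3[L 2][],D 3[L 2,Q 9[1,-1,8,43,7,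
7]][],D 3[L 2][]],C 0[Q 2[1,-6,0,8,8],L 1][D 7[L 2,Q 8[10,2,1,-5,1,1]][]],C 2[Q 2[1,6,0,-7,-1],Q 2[7,25,1,-32,0],Q 2[9,43,1,-53,-1],Q 2[6,22,1,-23,-7],Q 2[9,
43,1,-44,-10]][C 3[L 2,Q 2[2,-7,-36,0,41,8],Q 2[1,-2,-9,0,10,1]][],D 3[L 2][],C 4[L 2,Q 2[1,-5,-19,0,21,5],Q 2[1,-2,-7,0,8,1]][],C 2[L 2,Q 2[7,-27,-106,-1,98,
23]][D 3[L 3][]],D 3[L 2,L 1][],D 3[L 2,Q 9[1,0,6,32,5,5],Q 2[5,0,-1,1,0,-6]][],D 3[L 2,L 1,Q 9[1,0,8,43,7,7]][]]],C 0[Q 9[6,16,2,3],Q 9[1,7,1,1],Q 9[5,17,2,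
3]][C 2[Q 1[7,6,0,48,-5],Q 8[2,4,-5,-1,0],Q 8[1,4,-4,-1,0],Q 7[5,-6,6,1,1],Q 10[3,7,6,1,2]][],C 1[Q 8[3,6,-8,-1,0],Q 8[1,7,-8,-1,0],Q 7[2,-4,3,1,0],Q 10[8,18,
16,3,5]][],C 0[Q 8[10,24,-29,-4,-2],Q 8[1,5,-5,-1,0],Q 10[5,13,12,2,3],Q 7[3,-5,4,1,0]][D 8[H 3,Q 7[1,3,-4,4,1,0],Q 1[3,3,0,0,-2,18]][],D 8[H 3,Q 1[3,-1,3,0,
19,-3]][],D 3[Q 8[1,8,11,-16,-2,-1],Q 2[18,3,2,3,-2,-3]][],C 0[H 3,Q 1[4,-1,3,0,19,-2],Q 1[6,0,2,1,9,0]][]],C 3[Q 1[7,8,0,51,-8],Q 1[5,4,0,27,-2],Q 1[7,3,0,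
17,-3]][D 8[H 3][],C 3[Q 1[1,-4,-3,0,-21,4]][],C 1[Q 1[3,14,5,1,29,0]][]],C 3[Q 1[2,2,0,11,-2],Q 1[7,8,0,44,0],Q 1[6,2,1,8,-1],Q 1[6,7,0,39,-9]][C 1[Q 1[3,-6,
-7,1,-39,3]][],C 2[H 3,Q 3[5,0,1,1,0,-2]][C 0[Q 2[3,3,2,3,0,14,20]][],D 8[H 3,Q 9[7,-4,-2,2,5,1,2]][]],C 4[Q 1[1,-21,-18,0,-96,10],L 2][],C 3[L 2,Q 1[1,-5,-4,
0,-22,8]][]],C 2[Q 9[1,7,15,2,3],Q 9[7,30,63,9,13]][D 8[H 3][],C 4[Q 9[1,2,9,18,3,4],H 3][],C 0[H 3,Q 1[7,0,3,1,11,0]][]],C 3[Q 1[3,4,0,22,-3],Q 1[8,3,1,18,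
-2],Q 6[7,-9,3,1,0]][C 3[Q 1[1,-5,-6,0,-33,5]][],C 1[L 2,Q 1[1,6,2,1,10,0]][]],C 3[Q 1[9,4,1,13,0],Q 1[4,5,0,23,-3],Q 1[5,6,0,27,-8]][C 3[Q 1[2,-11,-13,0,-59,
14]][]],C 4[Q 1[6,7,0,33,-3],Q 9[5,-8,-27,-4,-4],Q 1[9,4,1,13,0]][C 3[Q 1[1,-5,-7,0,-33,3],Q 3[5,0,0,1,0,-3],Q 1[3,-6,-8,1,-37,1]][D 3[L 3][]],C 4[Q 1[3,-5,
-7,1,-31,5]][],C 2[H 3,Q 9[2,-6,17,57,8,9]][],C 3[Q 9[2,3,-8,-25,-3,-4]][],C 4[Q 1[5,-15,-18,1,-82,3]][]],C 2[Q 1[1,3,0,7,-3],L 1][],C 1[Q 9[2,-5,-33,-4,-5]][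
D 3[L 2][],D 3[L 2][],D 3[L 2][]],C 1[Q 3[2,9,0,-7,-1],L 1][],C 2[Q 3[2,9,0,-6,1],Q 9[1,-13,-85,-11,-13]][D 3[L 2][]]],C 0[Q 1[8,7,44,0],Q 1[3,1,5,0]][D 8[
Q 1[1,-8,-8,-54,6],Q 1[1,15,15,98,-6],Q 1[1,-10,-10,-67,1]][],C 1[Q 2[3,8,8,55,27],Q 9[5,-5,5,1,0],Q 2[5,5,4,27,9],Q 3[4,1,0,0,-2],Q 9[7,-9,11,1,0],Q 2[3,5,5,
34,18]][C 3[Q 2[2,3,7,6,46,22]][],C 2[Q 9[1,-2,6,-7,0,0]][],C 3[Q 2[2,3,5,5,35,15]][],D 3[L 2,Q 9[3,3,0,18,0,2],Q 9[1,-1,8,-8,0,0]][]],D 8[Q 2[1,-58,-58,-405,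
-167],Q 2[1,7,7,47,18]][],C 0[Q 1[2,-8,-7,-46,4],Q 1[4,-6,-5,-31,3]][C 3[L 2,Q 2[1,1,1,1,6,6]][],D 3[L 2][],D 3[L 2][],D 3[L 2,Q 1[3,3,-7,-6,-39,1]][],D 3[
L 2][]],C 1[Q 9[9,4,0,1,2],Q 6[7,-5,0,2,1],Q 2[7,0,1,-1,-7],Q 8[9,44,-54,1,0]][C 3[H 3,Q 2[1,0,1,1,7,3],Q 3[3,1,0,0,0,-2]][],C 2[Q 2[1,-1,4,3,22,12],Q 3[8,2,
0,0,1,-6]][],D 3[L 2][]],C 0[Q 1[2,-8,-6,-37,2]][D 3[L 2][],D 3[L 2][],D 3[L 2,L 1][],D 3[L 2][]],D 8[Q 9[6,2,-1,1,1]][C 2[H 3,Q 8[4,-24,-9,21,-3,2]][],C 2[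
Q 9[7,41,0,5,6,6],Q 9[4,9,0,0,2,1]][],C 1[Q 9[3,18,0,0,3,3],Q 9[3,4,1,0,1,1],Q 2[7,0,0,1,-1,-7]][D 3[L 3][],D 3[L 3][]],C 0[Q 10[4,4,0,0,1,1],Q 9[3,5,0,-1,1,
1],Q 9[5,26,-1,0,4,4]][D 3[L 3][],D 8[H 3][],D 3[L 3][]]],D 3[L 1][]],C 0[Q 1[6,5,33,0],Q 1[3,1,5,0],Q 1[1,1,6,-1],Q 1[4,3,21,-3]][C 4[Q 1[1,-3,-3,-21,2],Q 1[
4,-7,-7,-45,0]][C 3[Q 1[2,4,-7,-7,-47,8]][],C 1[L 2,Q 2[1,6,-1,-1,-7,-7],Q 1[2,3,-4,-4,-27,0]][]],C 1[Q 1[1,-2,-2,-13,3],Q 1[4,-3,-3,-19,5]][C 0[Q 1[1,3,-6,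
-6,-39,8]][],C 3[Q 2[1,3,2,2,14,7],L 2][D 3[L 3,L 2][]],C 2[L 2,Q 2[3,7,4,4,27,11]][],C 0[Q 1[4,1,-5,-5,-33,0],Q 6[5,0,-2,-2,1,0]][]],C 3[Q 1[3,-8,-8,-55,0],
Q 1[2,-3,-3,-19,0]][C 1[Q 2[1,6,-1,-1,-6,-8],L 2][]],C 1[Q 1[3,-6,-6,-37,5],Q 1[56,-58,-57,-371,83],Q 1[56,-57,-58,-371,83]][D 3[L 2][],C 0[L 2,Q 3[2,9,0,0,1,
-6]][],C 3[L 2,Q 1[1,4,-7,-7,-46,4],Q 1[1,10,-14,-14,-91,10]][],C 2[L 2,Q 3[2,9,0,0,1,-6]][]],D 8[Q 1[1,-8,-8,-54,6],Q 1[2,33,33,216,-9],Q 1[1,-10,-10,-67,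
1]][],C 0[Q 2[3,8,8,55,27],Q 9[5,5,-5,1,0],Q 2[5,4,5,27,9],Q 3[4,0,1,0,-2],Q 9[7,11,-9,1,0],Q 2[3,5,5,35,18]][C 3[Q 2[2,3,5,6,38,17]][],C 3[Q 2[2,3,5,5,34,
15]][],C 0[Q 9[1,-2,-7,6,0,0]][],D 3[L 2,Q 9[3,3,18,0,0,2],Q 9[1,-1,-8,8,0,0]][]],C 4[Q 1[2,-9,-8,-51,6]][D 3[L 2][]],C 1[Q 1[2,-5,-4,-28,7],Q 1[1,-1,-1,-6,
2]][C 3[L 2,Q 9[6,0,3,-1,1,1],Q 8[5,4,28,-24,0,1]][],D 3[L 2,Q 9[4,4,0,29,0,4],Q 8[9,0,44,-54,1,0]][],D 3[L 2][],C 4[L 2,Q 1[4,18,-9,-8,-50,39]][],D 3[L 2][],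
D 3[L 2,Q 1[3,4,-6,-5,-34,5]][],D 3[L 2,Q 9[7,6,3,34,1,5]][]],C 4[Q 1[3,-9,-8,-53,0]][D 3[L 2][],D 3[L 2][],C 4[L 2,Q 1[1,5,-8,-7,-47,1]][],D 3[L 2][]],C 3[
Q 6[17,-7,-6,4,1],Q 1[1,-1,-1,-6,0]][C 2[H 3,Q 8[2,4,9,-5,1,1]][],C 3[Q 2[5,0,3,3,17,7],Q 2[3,-4,9,8,53,31]][],D 3[L 2][],C 2[L 2,Q 1[2,5,-8,-7,-46,1],Q 9[8,
9,5,46,1,7]][D 3[L 3][]],D 3[L 2][]],C 1[Q 1[3,-7,-6,-39,6]][D 3[L 2][],D 3[L 2][],D 3[L 2][],D 3[L 2][]],C 1[Q 1[2,-8,-7,-46,4],Q 2[7,6,5,36,14],Q 1[5,-7,-6,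
-37,4]][C 4[Q 2[1,1,1,1,6,6],L 2][],D 3[L 2][],D 3[L 2][],D 3[L 2][],D 3[L 2,Q 9[5,5,0,30,0,4],Q 1[3,1,-6,-5,-34,0]][],D 3[L 2][]],C 1[Q 1[1,-4,-3,-18,5],Q 1[
2,-3,-2,-12,2]][D 3[L 2,L 1][],D 3[L 2][],C 3[L 2,Q 1[4,19,-21,-15,-96,31],Q 8[13,2,6,-5,2,2]][],D 3[L 2,Q 9[8,7,2,41,1,6]][],D 3[L 2][],D 3[L 2,Q 1[1,3,-5,
-4,-24,3]][],D 3[L 2,Q 1[3,2,-7,-5,-33,3]][]],C 4[Q 1[5,-16,-12,-77,4]][D 3[L 2][],D 3[L 2][],C 2[L 2,Q 2[1,5,-1,-1,-5,-6]][]],C 4[Q 1[5,-7,-5,-32,-3]][C 2[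
H 3,Q 9[1,5,1,9,1,2]][],D 3[L 2,Q 9[5,6,2,29,1,4]][],C 3[L 2,Q 1[1,5,-7,-5,-33,0]][],D 3[L 2][],D 3[L 2,Q 9[6,6,2,34,1,5]][],C 1[L 2,Q 2[1,5,-1,-1,-5,-7]][],
D 3[L 2][]],C 1[Q 1[3,-8,-6,-37,6]][D 3[L 2][]],C 1[Q 1[1,-5,-4,-24,2],Q 1[2,-7,-5,-32,1]][D 3[L 2][],D 3[L 2][],D 3[L 2][],D 3[L 2][],D 3[L 2][],D 3[L 2,
L 1][],D 3[L 2][]],C 0[L 1,Q 1[1,6,2,9,1]][],C 3[Q 1[1,6,2,9,0],L 1][]],C 0[Q 1[5,4,31,-3],Q 1[10,3,23,-4]][C 1[Q 1[1,-4,-4,-31,6],Q 3[5,1,0,0,-3],Q 1[4,-7,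
-8,-60,10]][],C 0[Q 2[1,2,2,16,6]][D 3[L 2][]],D 3[Q 2[2,-1,-1,-10,-3],Q 2[4,3,4,26,7],Q 3[4,0,1,0,-2],Q 2[4,4,3,26,7],Q 3[4,1,0,0,-2]][D 3[L 2][]],C 1[Q 1[4,
-7,-6,-45,6],Q 8[6,0,-6,1,-1],Q 9[5,13,24,0,4]][D 3[L 2,Q 9[1,2,6,9,0,2]][],D 3[L 2][]],C 0[Q 1[2,-10,-8,-66,7],Q 2[4,3,3,20,5],Q 3[4,0,1,0,-2]][C 2[L 2,Q 1[
1,1,-5,-4,-33,3]][],D 3[L 2][]],C 0[Q 2[1,3,3,21,8],Q 7[1,4,-3,0,0]][],C 1[Q 1[1,-6,-4,-33,5],Q 9[1,2,5,0,1],Q 1[3,-2,-1,-9,4]][D 3[L 2,Q 9[1,2,4,10,0,2]][],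
D 3[L 2,Q 1[1,3,-6,-4,-32,3]][],D 3[L 2][]],C 0[Q 1[1,-8,-5,-43,5],Q 3[4,0,1,0,-2],Q 1[1,-3,-2,-16,2]][D 3[L 2][]],C 1[Q 9[1,2,6,0,1],Q 1[2,-7,-5,-40,5],Q 8[
5,0,-5,1,-1]][C 3[Q 1[3,3,-7,-5,-37,8]][],D 3[L 2,Q 9[1,2,4,10,0,2]][]],C 1[L 1,Q 1[1,-6,-2,-14,5],Q 9[6,7,37,0,5]][],C 1[Q 9[7,5,24,0,3],Q 9[9,10,59,-1,8],
Q 9[12,6,27,1,4],L 1,Q 8[8,0,-9,1,-1]][C 1[Q 9[4,20,9,36,2,5]][],D 3[L 2,Q 9[1,5,4,18,0,3]][],C 3[L 2,Q 1[2,3,-3,-1,-6,11]][]]],C 0[Q 1[1,1,6,-1],Q 1[5,4,24,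
-4],Q 1[5,2,9,0],Q 1[6,5,33,0],Q 1[5,2,9,-3],Q 1[7,6,39,-9]][C 2[Q 1[2,-7,-7,-47,8]][C 0[Q 1[3,4,-8,-8,-51,5]][],C 0[Q 1[3,3,-7,-7,-45,4],L 2][]],C 3[Q 1[2,
-7,-7,-48,5],Q 1[5,-9,-9,-59,0]][C 4[Q 1[2,4,-7,-7,-47,8]][],C 0[L 2,Q 2[1,6,-1,-1,-7,-7],Q 1[2,3,-4,-4,-27,0]][]],D 8[Q 1[1,-8,-8,-54,6],Q 1[1,15,15,98,-6],
Q 1[1,-10,-10,-67,1]][],C 0[Q 1[2,-7,-6,-38,12],Q 3[5,0,1,0,-3],Q 1[3,-3,-2,-16,5]][C 1[H 3,Q 9[2,9,5,-6,1,0]][],C 3[L 2,Q 2[2,3,2,2,12,15]][],D 3[L 2,Q 1[2,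
1,-6,-5,-33,6]][],C 1[L 2,Q 1[2,2,-6,-5,-32,7]][],D 3[L 2,Q 1[1,0,-1,-1,-6,0]][]],C 0[Q 1[3,-11,-9,-61,11],Q 1[1,-6,-5,-33,8]][D 3[L 2][]],C 2[Q 1[2,-6,-5,
-34,0]][D 3[L 2][],D 3[L 2][],C 2[L 2,Q 2[1,5,-1,-1,-5,-6]][]],C 0[Q 1[2,-7,-5,-33,12],Q 3[5,0,1,0,-3],Q 1[2,-2,-1,-8,3]][C 1[Q 1[1,-1,4,3,18,-6],Q 9[1,6,2,
-2,1,0]][],C 1[L 2,Q 1[1,-1,6,4,25,-5]][],C 1[L 2,Q 1[1,-1,8,6,36,-9]][],D 3[L 2,L 1][],D 3[L 2,Q 1[4,0,-8,-6,-37,4]][]],C 2[Q 1[2,-4,-3,-17,0]][D 8[H 3][],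
D 3[L 2,Q 9[2,2,1,12,0,2]][],D 3[L 2,Q 9[2,2,1,12,0,2]][],C 0[Q 1[6,9,-17,-13,-80,-6]][],D 3[L 2,Q 9[2,2,1,12,0,2]][],C 2[L 2,Q 2[1,6,-1,-1,-5,-7]][]],C 3[
Q 1[4,-9,-7,-43,0],Q 1[1,-5,-4,-23,0]][D 3[L 2][],C 0[L 2,Q 2[1,4,-1,-1,-5,-5]][],C 2[L 2,Q 2[1,5,-1,-1,-5,-6]][]],C 2[L 1,Q 3[2,9,1,-6,0]][]],C 0[Q 1[8,7,53,
-7],Q 1[3,1,7,-1],Q 1[3,2,17,-2]][C 2[Q 1[1,-5,-5,-37,5]][],C 0[Q 1[1,-4,-4,-31,6],Q 3[5,0,1,0,-3],Q 1[4,-8,-7,-60,10]][],C 3[Q 1[2,-6,-5,-40,3],Q 9[2,5,8,0,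
2]][C 3[L 2,Q 1[1,5,-9,-7,-56,4]][]],C 2[Q 9[3,7,15,0,3],Q 1[2,-8,-7,-55,1],Q 10[9,4,10,1,3]][C 3[Q 2[3,0,2,2,13,4],Q 1[1,1,-6,-5,-39,1]][]],C 4[Q 1[3,-7,-5,
-40,3],Q 9[1,2,5,0,1],Q 7[4,0,-3,1,0]][C 2[Q 9[2,7,12,30,0,6],Q 1[1,4,-9,-6,-48,1]][]],C 2[Q 9[1,2,5,0,1],Q 7[4,0,-3,1,0]][],C 3[Q 9[3,7,21,0,4],Q 9[8,6,18,1,
4],Q 8[5,-2,-4,1,0]][C 2[H 3,Q 9[1,6,4,12,1,3]][],D 8[H 3][]],C 0[Q 1[1,-6,-2,-15,6],L 1][],C 3[Q 9[6,6,33,0,5],Q 9[9,4,19,1,4],Q 1[1,-3,-1,-7,0]][C 1[Q 9[4,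
13,7,27,2,6]][],D 7[L 2,Q 8[7,1,1,-2,1,1]][]],C 2[Q 1[1,6,2,13,0],L 1][]]],C 0[Q 0[1,4,4]][C 0[Q 2[1,-1,6,-7],Q 0[1,0,2,1]][],C 0[Q 1[1,1,7,8],Q 0[1,0,2,
2]][],C 0[Q 2[1,-1,5,-5],Q 0[1,0,2,1]][],C 0[Q 2[1,-1,4,-4],Q 0[1,0,2,2]][],C 0[Q 2[1,-2,8,-8],Q 0[1,0,2,1]][],C 0[Q 2[2,-2,9,-7],Q 0[1,0,2,2]][]]]]"

definition "cert_888887553222 =
D 2[][D 2[Q 0[1,1]][D 2[Q 0[1,1,1]][D 3[L 0][C 3[L 1,Q 2[1,5,-1,-2,-4]][],D 7[L 1][C 3[L 2,Q 8[6,-15,-2,-3,-2,-2]][]],C 3[L 1,Q 2[1,5,-6,0,-1]][],C 2[L 1,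
L 0][C 2[L 2,Q 1[4,4,-3,25,0,-1],Q 1[8,5,-4,29,0,0]][C 3[L 3,Q 9[6,0,-5,-1,1,0,0]][]],C 4[L 2,Q 9[11,6,3,2,1,1]][],C 2[L 2][C 3[L 3,Q 9[6,-5,0,-1,1,0,0]][]],
C 3[L 2,Q 1[1,1,-1,6,0,0]][],C 5[L 2,Q 9[48,12,10,7,2,2]][]],C 1[L 1,L 0,Q 9[31,6,1,5,5]][C 3[L 2,Q 9[7,5,2,1,1,1]][],C 2[L 2,Q 7[7,-9,-2,0,0,0]][],C 0[L 2,
Q 9[37,-3,0,6,5,5]][],D 5[L 2][],D 7[L 2,Q 8[15,0,4,3,3,3]][],D 7[L 2,Q 8[15,0,4,3,3,3]][]],C 2[Q 3[3,-8,-4,-3,-3],Q 8[5,1,1,1,1]][D 5[L 2][],D 5[L 2,Q 3[1,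
-2,7,5,3,3]][D 7[L 3,Q 8[6,3,2,1,2,2,2]][],D 7[L 3,Q 8[6,3,2,2,1,2,2]][]],C 3[Q 3[1,3,-8,-5,-4,-4]][],C 2[L 2,Q 9[17,1,4,1,3,3]][]],D 7[L 1][C 2[L 2,Q 8[2,
-29,-5,-5,-5,-5]][]]],C 2[L 0][C 1[L 1,Q 1[1,-1,6,0,-6]][],C 1[L 1,Q 1[4,-3,19,-8,-8]][],C 1[L 1,Q 1[1,-1,6,-3,-3]][],D 3[L 1][],C 1[L 1,Q 1[1,-1,6,0,-5]][],
D 3[L 1][],C 1[L 1,Q 1[1,-2,9,-5,-5]][],D 3[L 1][],D 3[L 1][]],D 3[L 0][D 7[L 1][C 0[L 2,Q 8[4,-8,-2,-1,-1,-1]][]]]],C 0[Q 0[1,0,1],Q 1[1,-1,1]][C 0[Q 1[1,-1,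
7,-8],Q 1[3,-1,8,-9],Q 1[1,0,1,-1]][],C 0[Q 1[1,-1,5,-7],Q 1[7,-3,18,-21],Q 0[1,0,1,0]][C 2[L 1,Q 2[3,15,2,-10,14]][]],C 0[Q 1[2,-1,11,-10],Q 1[3,-1,9,-9],
Q 1[1,0,1,-1]][],C 0[Q 1[3,-2,15,-14],Q 1[3,-1,6,-6],Q 0[1,0,1,0]][D 2[L 1][],D 2[L 1][],C 2[L 1,Q 2[1,7,1,-5,6],Q 2[2,8,1,-5,6]][],D 3[L 1][]],C 0[Q 1[1,-1,
6,-7],Q 1[3,-1,8,-9],Q 1[1,0,1,-1]][],C 0[Q 1[2,-2,9,-10],Q 1[2,-1,5,-6],Q 0[1,0,1,0]][D 2[L 1][],D 2[L 1][],C 0[L 1,Q 1[4,3,3,7,22],Q 1[5,-3,6,0,39],Q 7[3,0,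
-4,-1,0]][],D 3[L 1][]],C 0[Q 1[6,-5,34,-34],Q 1[3,-1,9,-9],Q 1[1,0,1,-1]][],C 0[Q 1[5,-4,25,-23],Q 1[2,-1,5,-5],Q 0[1,0,1,0]][D 2[L 1][],D 2[L 1][],D 2[
L 1][],C 2[L 1,Q 2[1,7,1,-5,6]][],D 3[L 1][]],C 0[Q 1[1,-2,7,-9],Q 1[5,-1,8,-9]][],C 0[Q 1[2,-3,9,-12],Q 1[1,-1,2,-3],Q 0[1,0,1,0]][D 2[L 1][],D 2[L 1][],D 2[
L 1][],D 2[L 1][],D 2[L 1][],D 3[L 1,L 0][],D 3[L 1][]],C 0[Q 1[5,-9,39,-36],L 0][],C 0[Q 1[6,-7,30,-25],L 0,Q 1[4,-2,9,-7]][D 2[L 1][],D 2[L 1][],D 2[L 1][],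
D 2[L 1][],D 3[L 1][]],D 2[L 0,Q 1[1,4,-5,7]][],D 2[L 0][C 4[L 1,Q 1[1,0,-3,5,-6]][],D 7[L 1,Q 8[32,6,6,6,5]][],C 4[L 1,Q 1[1,0,-3,5,-6]][],D 7[L 1,Q 8[32,6,
6,6,5]][]],D 2[L 0][],D 2[L 0][C 4[L 1,Q 1[1,0,-2,6,-4]][]],D 3[L 0][D 5[L 1,L 0][C 0[L 2,Q 9[49,2,9,7,1,7]][]],D 7[L 1,Q 8[32,7,5,6,5]][],C 4[L 1,L 0,Q 9[15,
3,2,0,2]][D 5[L 2][],C 3[L 2,Q 9[6,0,1,0,1,1]][]],D 7[L 1][C 3[L 2,Q 8[2,-24,-5,-4,-4,-4]][]]]],D 2[Q 0[1,0,1],Q 0[1,1,0]][D 3[L 0][D 7[L 1,Q 8[32,7,5,6,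
5]][],C 0[L 1,L 0,Q 9[6,1,1,1,0]][C 0[Q 2[2,3,-2,-10,7,13]][],D 5[L 2][]],D 5[L 1,L 0][C 0[L 2,Q 9[49,2,9,7,1,7]][]],D 7[L 1][C 4[L 2,Q 8[2,-24,-5,-4,-4,
-4]][]]],C 3[L 0,Q 0[1,4,-1,4]][C 0[L 1,Q 2[2,-1,9,0,-8]][],C 0[L 1,Q 2[2,-1,9,0,-8]][],C 0[Q 2[2,-2,9,0,-10],Q 0[1,0,2,0,2]][],D 3[L 1][],C 0[L 1,Q 2[1,-1,5,
0,-5]][],D 3[L 1][],C 0[L 1,Q 2[1,-1,5,0,-5]][],C 0[L 1,Q 2[1,-1,4,1,-4]][],D 3[L 1][],D 3[L 1][],D 3[L 1,L 0][]],D 3[L 0][C 2[L 1,Q 2[1,5,0,-1,-6]][],C 0[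
L 1,L 0,Q 9[31,6,5,5,1]][C 3[L 2,Q 7[7,-9,-2,0,0,0]][],C 1[L 2,Q 9[37,-3,0,5,5,6]][],C 0[L 2,Q 9[7,5,2,1,1,1]][],D 7[L 2,Q 8[15,0,4,3,3,3]][],D 5[L 2][],D 7[
L 2,Q 8[15,0,4,3,3,3]][]],C 1[Q 3[2,-6,-2,-3,-4],Q 8[5,1,1,1,1]][C 4[Q 3[1,3,-8,-4,-4,-5]][],C 3[L 2,Q 9[17,1,4,3,3,1]][],D 5[L 2,Q 3[1,-2,5,2,3,4]][D 7[L 3,
Q 8[6,3,2,1,2,2,2]][],D 7[L 3,Q 8[6,3,2,2,2,2,1]][]],D 5[L 2][]],D 7[L 1][C 5[L 2,Q 8[6,-15,-2,-2,-2,-3]][]],C 0[L 1,L 0][C 4[L 2,Q 1[4,4,-3,-2,-2,24],Q 1[5,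
3,-3,0,0,18]][C 1[L 3,Q 9[6,0,-5,-1,0,0,1]][]],C 5[L 2,Q 1[1,1,-1,0,0,6]][],C 4[L 2,Q 1[1,1,-1,0,0,6]][],C 4[L 2][C 1[L 3,Q 9[6,-5,0,-1,0,0,1]][]],C 5[L 2,
Q 1[2,3,-2,0,0,12]][]],C 2[L 1,Q 2[1,5,-2,-4,-1]][],D 7[L 1][C 3[L 2,Q 8[2,-29,-5,-5,-5,-5]][]]],C 0[L 0,Q 1[4,-5,7,1]][C 3[L 1,Q 1[2,2,-1,15,-1],Q 1[6,4,-3,
31,-4],Q 9[1,7,1,0,1],Q 9[3,12,2,0,2]][],C 1[Q 1[1,-1,6,-6,0],Q 1[3,-1,9,-9,1]][],C 1[Q 1[1,-1,5,-5,0],Q 1[3,-1,6,-6,0]][],C 2[L 1,Q 1[1,-1,6,-6,0]][],C 1[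
L 1,Q 1[1,-1,5,-6,0]][],C 1[Q 1[2,-1,5,-6,0],Q 9[13,7,1,2,3]][],C 2[L 1,Q 1[1,-1,5,-6,0]][],C 1[L 1,Q 1[1,-1,6,-5,0]][],C 1[L 1,Q 1[1,-1,5,-5,0],Q 1[2,-1,6,
-6,1]][],C 2[L 1,Q 1[1,-1,6,-5,0]][],D 3[L 1][],D 3[L 1][],C 3[L 1,Q 9[13,0,2,2,2]][],C 4[L 1,Q 1[1,2,0,8,-2],L 0][],C 5[L 1,Q 1[2,5,-5,20,-2],L 0][],C 2[L 1,
Q 1[2,-3,9,-12,1]][],C 1[L 1,Q 1[1,-2,6,-7,0]][],D 3[L 1][],C 1[L 1,Q 1[1,-1,5,-4,0]][],C 4[L 1,Q 9[13,0,2,2,2]][],C 2[L 1,Q 1[1,-1,5,-4,0]][],C 1[L 1,Q 1[1,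
-1,6,-5,0]][],D 3[L 1][],D 7[L 1,Q 8[32,6,6,5,6]][],C 1[L 1,Q 1[1,-3,5,-6,0]][],C 1[L 1,Q 1[1,-2,6,-4,0]][]],D 8[Q 9[6,1,1,1]][C 3[Q 1[4,3,-5,23,-5],Q 9[3,12,
2,0,2],Q 9[1,6,1,0,1],Q 1[3,1,-1,7,-1]][],C 4[Q 1[1,1,-1,6,-1],Q 1[8,5,-6,27,-6],Q 1[5,2,-2,9,-1],Q 1[3,1,0,5,-2]][D 3[L 2][],D 3[L 2,Q 9[7,2,35,6,1,6]][],
D 3[L 2,Q 9[7,2,35,6,1,6]][],D 8[Q 9[6,0,0,1,1,1],Q 9[7,1,-1,0,1,1],Q 9[7,1,-1,1,1,0]][]],C 4[L 1,Q 1[3,2,-1,11,-2],Q 1[5,2,0,9,0],Q 1[1,1,-1,7,-1],Q 1[7,6,0,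
39,-9],Q 1[7,6,-6,39,-2]][C 2[Q 1[1,-2,-2,2,-13,2]][],D 3[L 2,Q 9[7,1,44,6,1,7]][],D 3[L 2][],D 3[L 2][],D 3[L 2][],D 3[L 2][],D 3[L 2][],D 3[L 2,L 1][],D 5[
L 2,L 1][]],C 4[L 1,Q 1[3,2,-2,11,-1],Q 1[3,1,0,5,0],Q 1[1,1,-1,7,-1],Q 1[7,6,-9,39,0],Q 1[7,6,-2,39,-6]][C 3[Q 1[1,-2,-2,2,-13,2]][],D 3[L 2,Q 9[6,1,36,6,1,
5]][],D 3[L 2][],D 3[L 2][],D 3[L 2][],D 3[L 2][],D 3[L 2,L 1][],D 3[L 2][],D 5[L 2,L 1][]],C 1[L 1,Q 1[3,2,11,-1,-2],Q 1[5,2,9,0,0],Q 1[1,1,7,-1,-1],Q 1[7,6,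
39,0,-9],Q 1[7,6,39,-6,-2]][C 1[Q 1[1,-2,-2,-13,2,2]][],D 3[L 2,Q 9[7,1,44,1,6,7]][],D 3[L 2][],D 3[L 2][],D 3[L 2][],D 3[L 2][],D 3[L 2,L 1][],D 3[L 2][],
D 5[L 2,L 1][]],C 1[Q 1[5,4,26,-6,-6],Q 1[4,3,16,-3,-3],Q 1[8,3,14,-3,0],Q 1[5,2,9,0,-3]][D 3[L 2,Q 9[9,3,48,1,8,8]][],D 3[L 2][],D 3[L 2,Q 9[7,2,37,1,6,
6]][],D 8[Q 9[6,0,0,1,1,1],Q 9[7,1,-1,1,0,1],Q 9[7,1,-1,1,1,0]][]],C 1[Q 1[4,3,23,-5,-5],Q 9[3,11,0,2,2],Q 9[1,6,0,1,1],Q 1[3,1,6,-2,-2]][],C 2[L 1,Q 1[3,2,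
11,-2,-1],Q 1[3,1,5,0,0],Q 1[1,1,7,-1,-1],Q 1[7,6,39,-9,0],Q 1[7,6,39,-2,-6]][C 3[Q 1[1,-2,-2,-13,2,2]][],D 3[L 2,Q 9[6,1,36,1,6,5]][],D 3[L 2][],D 3[L 2][],
D 3[L 2][],D 3[L 2,L 1][],D 3[L 2][],D 3[L 2][],D 5[L 2,L 1][]],C 0[L 1,Q 1[3,2,-2,-1,11],Q 1[5,2,0,0,9],Q 1[1,1,-1,-1,7],Q 1[7,6,-9,0,39],Q 1[7,6,-2,-6,39]][
C 1[Q 1[1,-2,-2,2,2,-13]][],D 3[L 2,Q 9[7,1,44,7,6,1]][],D 3[L 2][],D 3[L 2][],D 3[L 2][],D 3[L 2][],D 3[L 2,L 1][],D 3[L 2][],D 5[L 2,L 1][]],C 0[Q 1[6,4,-5,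
-5,22],Q 1[5,2,0,-2,10],Q 1[3,1,-2,0,5],Q 1[1,1,-1,-1,6]][D 3[L 2,Q 9[9,3,48,8,8,1]][],D 3[L 2][],D 3[L 2,Q 9[7,2,37,6,6,1]][],D 8[Q 9[6,0,0,1,1,1],Q 9[7,1,
-1,1,0,1],Q 9[7,1,-1,0,1,1]][]],C 0[L 1,Q 1[3,2,-1,-2,11],Q 1[5,2,0,0,9],Q 1[1,1,-1,-1,7],Q 1[7,6,0,-9,39],Q 1[7,6,-6,-2,39]][C 3[Q 1[1,-2,-2,2,2,-13]][],D 3[
L 2,Q 9[6,1,36,5,6,1]][],D 3[L 2][],D 3[L 2][],D 3[L 2][],D 3[L 2,L 1][],D 3[L 2][],D 3[L 2][],D 5[L 2,L 1][]],C 0[Q 1[4,3,-5,-5,23],Q 9[3,11,2,2,0],Q 9[1,6,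
1,1,0],Q 1[3,1,-1,-1,7]][]],C 4[L 0][C 3[L 1,Q 1[1,-1,-6,4,0],Q 1[3,-1,-6,6,0]][],C 4[Q 1[4,-3,-22,22,1],L 1,Q 1[3,-1,-5,6,0]][],D 3[L 1][],C 4[L 1,Q 1[1,-1,
-6,6,0]][],C 2[L 1,Q 1[4,5,34,-3,2],Q 1[4,3,19,0,3],Q 2[1,1,5,2,3]][],C 4[L 1,Q 1[1,-1,-6,6,0]][],C 4[L 1,Q 1[1,-1,-6,6,0]][],C 3[L 1,Q 1[1,1,8,0,-1]][],D 3[
L 1][],C 0[L 1,Q 1[5,6,0,0,33],Q 1[4,3,-7,2,25],Q 1[2,2,-2,-1,13]][],D 3[L 1][],C 4[L 1,Q 1[1,-1,-6,6,0]][],C 3[L 1,Q 1[5,6,41,-3,0]][],C 2[L 1,Q 9[6,-1,1,1,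
1]][],C 4[L 1,Q 1[1,-1,-6,6,0]][],D 3[L 1,L 0][],D 3[L 1][],D 3[L 1][],D 3[L 1,L 0][]],C 3[L 0,Q 1[4,-5,1,7]][C 1[L 1,Q 1[1,-1,6,0,-6]][],C 1[Q 1[1,-1,7,0,
-7],Q 1[3,-1,9,0,-9]][],C 1[Q 1[1,-1,5,0,-5],Q 1[3,-1,6,0,-6]][],C 0[L 1,Q 1[2,2,-1,-1,15],Q 1[6,4,-3,-4,31],Q 9[1,7,1,1,0],Q 9[7,30,4,5,0]][],D 3[L 1][],C 1[
L 1,Q 1[1,-1,6,0,-5]][],D 3[L 1][],C 1[L 1,Q 1[1,-1,5,0,-6]][],C 1[L 1,Q 1[1,-1,6,0,-5]][],C 1[L 1,Q 1[1,-1,5,0,-5],Q 1[2,-1,6,1,-5]][],C 1[L 1,Q 1[1,-1,5,0,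
-6]][],C 1[Q 1[2,-1,5,0,-6],Q 9[13,7,1,3,2]][],C 1[L 1,Q 1[1,-1,6,0,-5]][],D 3[L 1][],C 1[L 1,Q 1[1,-2,6,0,-7]][],D 3[L 1][],C 3[L 1,Q 9[13,0,2,2,2]][],C 1[
L 1,Q 1[1,-1,5,0,-4]][],C 0[L 1,Q 1[2,5,-5,-3,21],L 0][],C 1[L 1,Q 1[2,-3,9,0,-11]][],C 1[L 1,Q 1[1,-1,5,0,-4]][],C 3[L 1,Q 9[13,0,2,2,2]][],C 0[L 1,Q 1[1,2,
0,-2,8],L 0][],C 1[L 1,Q 1[1,-2,6,0,-4]][],C 1[L 1,Q 1[1,-3,5,0,-6]][],D 7[L 1,Q 8[32,6,6,6,5]][]],D 3[L 0][D 7[L 1][C 0[L 2,Q 8[2,-29,-5,-5,-5,-5]][]],C 2[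
L 1,Q 2[1,5,-2,-1,-4]][],C 4[L 1,L 0][C 0[L 2,Q 1[4,4,-3,-2,24,-2],Q 1[5,3,-3,0,18,0]][C 3[L 3,Q 9[6,0,-5,-1,0,1,0]][]],C 4[L 2,Q 9[11,6,3,1,2,1]][],C 0[L 2][
C 3[L 3,Q 9[6,-5,0,-1,0,1,0]][]],C 0[L 2,Q 1[1,1,-1,0,5,-1]][],C 5[L 2,Q 9[48,12,10,2,7,2]][]],C 1[Q 3[3,-8,-3,-4,-3],Q 8[5,1,1,1,1]][D 5[L 2][],D 5[L 2,Q 3[
1,-2,7,3,5,3]][D 7[L 3,Q 8[6,3,2,2,2,1,2]][],D 7[L 3,Q 8[6,3,2,1,2,2,2]][]],C 0[L 2,Q 9[17,1,4,3,1,3]][],C 1[Q 3[1,3,-7,-3,-4,-4]][]],D 7[L 1][C 1[L 2,Q 8[6,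
-15,-2,-2,-3,-2]][]],C 3[L 1,L 0,Q 9[31,6,5,1,5]][C 3[L 2,Q 9[7,5,2,1,1,1]][],C 1[L 2,Q 9[37,-3,0,5,6,5]][],C 0[L 2,Q 7[7,-9,-2,0,0,0]][],D 7[L 2,Q 8[15,0,4,
3,3,3]][],D 5[L 2][],D 7[L 2,Q 8[15,0,4,3,3,3]][]],C 2[L 1,Q 2[1,5,0,-6,-1]][]],C 0[L 0,Q 0[1,4,4,-1]][C 1[L 1,Q 2[2,-1,9,-8,0]][],C 1[Q 2[2,-2,9,-10,0],Q 0[
1,0,2,2,0]][],C 2[L 1,Q 2[2,-1,9,-8,0]][],C 1[L 1,Q 2[1,-1,5,-5,0]][],C 1[L 1,Q 2[1,-1,4,-4,1]][],C 2[L 1,Q 2[1,-2,8,-9,0]][],D 3[L 1][],D 3[L 1][],D 3[L 1,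
L 0][],D 3[L 1][],D 3[L 1][]],D 3[L 0][D 5[L 1,L 0][C 4[L 2,Q 9[49,2,9,7,7,1]][]],D 7[L 1][C 0[L 2,Q 8[2,-24,-5,-4,-4,-4]][]],C 1[L 1,L 0,Q 9[15,3,2,2,0]][
D 5[L 2][],C 0[L 2,Q 9[6,0,1,1,0,1]][]],D 7[L 1,Q 8[32,7,5,5,6]][]]],C 0[Q 0[1,4,4]][C 0[Q 2[5,-4,22,-27],Q 0[1,1,4,4]][],C 0[Q 1[1,1,8,8],Q 0[4,1,8,6],Q 2[2,
-1,7,-7]][],C 0[Q 0[1,1,4,4],Q 2[1,-2,8,-9]][],C 0[Q 0[4,1,9,7],Q 2[2,-2,7,-8],Q 1[1,1,8,7],Q 1[7,5,37,37]][],C 0[Q 0[1,2,8,8],Q 2[1,-3,9,-9]][],C 0[Q 0[1,1,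
4,4],Q 2[1,-2,6,-6],Q 1[3,4,22,22]][D 2[L 1][]]]]]"

definition "cert_888877743222 =
D 2[][D 2[Q 0[1,1]][D 2[Q 0[1,1,1]][D 3[L 0][C 1[L 1,Q 2[1,-4,5,0,4]][],C 0[L 1,Q 2[1,-7,8,4,4]][],C 3[L 0,L 1,Q 2[1,5,-1,-2,-4]][],C 5[L 0,L 1][D 4[L 1,Q 9[
2,55,1,9,9,9]][C 3[L 3,Q 9[5,1,-6,0,-1,0,0]][],C 1[L 2,L 3][]],D 4[L 2,L 1][],D 4[L 1,L 2][D 7[L 3,Q 8[7,1,2,2,2,2,2]][]],D 4[L 2,L 1][],D 7[L 2,Q 8[21,-7,5,
3,3,3]][]],C 3[L 0,Q 2[1,5,-6,0,-1]][C 2[L 2,Q 9[17,4,3,3,1,1]][]],C 2[L 0,L 1][C 2[L 1,L 2,Q 1[4,4,-3,24,-2,-2]][D 4[L 2,Q 9[1,5,31,7,1,6,6]][]],D 4[L 2,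
L 1][],D 4[L 1,L 2][C 1[L 3,Q 9[7,2,4,1,1,1,1]][],C 1[L 3,Q 9[7,2,4,1,1,1,1]][]],D 4[L 1,L 2][],C 2[L 1,Q 8[13,-3,2,3,2,2]][],D 4[L 2,L 1][]],C 1[L 0,L 1,Q 9[
31,6,1,5,5]][C 2[L 2,Q 1[18,23,-13,130,-3,-4],Q 1[4,5,-2,27,-2,-2],Q 8[29,-28,-6,0,-1,-1]][],C 2[L 2,L 1,Q 1[2,2,-1,14,-1,-1]][],C 2[L 1,Q 8[5,-1,1,1,1,1]][],
C 1[L 2,Q 9[37,-3,0,6,5,5]][],C 4[L 2,Q 9[18,4,4,3,1,1]][]],D 8[Q 9[25,5,1,4,4]][C 3[L 2,Q 1[1,1,-1,-1,4,4]][],C 2[L 1,Q 9[5,27,5,4,1,1],Q 9[5,6,2,1,1,1]][],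
D 4[L 1,Q 9[5,22,5,4,1,1]][],C 0[L 1,Q 9[5,28,5,5,1,1],Q 9[5,7,1,2,1,1]][],C 1[Q 9[8,322,11,53,51,51],Q 8[9,0,2,2,2,2]][C 2[L 3,Q 9[5,0,-6,1,-1,0,0]][]]],D 4[
L 0,L 1][],C 3[L 1,Q 3[1,5,-3,0,0]][],D 4[L 0,L 1][C 3[L 2,Q 9[20,5,4,3,1,1]][],C 4[L 2,Q 9[19,5,4,3,1,1]][]],D 4[L 1,L 0][]],C 2[L 0][C 1[L 1,Q 1[3,-2,17,-8,
-8]][],C 1[L 1,Q 1[4,-3,18,-9,-9],Q 1[7,-2,17,-7,-7]][],C 1[L 1,Q 1[3,-3,17,-10,-10]][],C 1[Q 1[5,-2,11,-7,-7],Q 1[1,-1,4,0,-6]][],C 1[L 1,Q 1[1,-1,6,0,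
-6]][],C 1[L 1,Q 1[5,-4,23,-12,-12]][],C 1[L 1,Q 1[1,-2,9,-5,-5]][],C 1[L 1,Q 1[2,-2,9,-5,-5]][],D 3[L 0,L 1][]],D 3[L 0][D 4[L 0,L 1][],D 4[L 0,L 1][C 0[Q 8[
8,3,1,2,2,2]][]]]],C 0[Q 0[1,0,1],Q 1[1,-1,1]][C 0[Q 1[3,-1,9,-9],Q 1[1,0,1,-1],Q 1[1,-1,7,-8]][],C 0[Q 1[2,-1,5,-7],Q 0[1,0,1,0],Q 1[1,-1,7,-9],Q 1[3,-1,6,
-6]][C 2[Q 2[1,8,1,-5,8],Q 0[5,18,-1,16,-2]][]],C 0[Q 1[1,-1,6,-7],Q 1[3,-1,9,-8],Q 1[1,0,1,-1]][],C 0[Q 1[1,-1,5,-5],Q 1[2,-1,5,-6],Q 1[3,-1,8,-7],Q 0[1,0,1,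
0]][D 2[L 1][],C 3[L 1,Q 1[4,20,-6,39,-37],Q 9[1,1,8,1,0]][],C 2[L 1,Q 2[1,7,1,-5,6],Q 2[2,5,1,-4,5]][],C 0[L 1,Q 1[6,0,5,5,34],Q 1[6,7,4,13,26]][]],C 0[Q 1[
2,-1,6,-7],Q 1[1,-1,8,-9],Q 1[1,0,1,-1]][],C 0[Q 1[1,-1,6,-7],Q 1[2,-1,5,-6],Q 0[2,0,2,0]][D 2[L 1][],D 2[L 1][],C 2[L 1,Q 2[1,7,1,-5,7]][],D 3[L 1][]],C 0[
Q 1[1,-1,6,-6],Q 1[3,-1,9,-8],Q 1[1,0,1,-1]][],C 0[Q 1[1,-1,6,-6],Q 1[2,-1,5,-5],Q 0[1,0,1,0],Q 1[6,-3,20,-17]][D 2[L 1][],D 2[L 1][],C 4[L 1,Q 1[1,6,-2,11,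
-9]][],D 2[L 1][],C 2[L 1,Q 1[1,9,-1,9,-7]][],C 3[Q 2[1,6,1,-4,5],Q 0[2,7,0,6,-1]][]],C 0[Q 1[1,-3,8,-9],Q 1[2,-1,4,-4]][],C 0[Q 1[3,-7,18,-21],Q 1[1,-1,2,
-3],Q 0[1,0,1,0]][D 2[L 1][],D 2[L 0,L 1][],D 2[L 1][],D 3[L 0,L 1][],D 3[L 1,L 0][]],C 3[Q 1[1,3,-3,8],L 0][],C 0[L 0,Q 1[1,-2,7,-6],Q 1[3,-2,7,-6]][D 2[
L 1][],D 2[L 0][],D 2[L 1][],D 3[L 0,L 1][]],D 2[L 0,Q 1[1,4,-5,7],Q 1[1,-8,9,-13]][],C 0[L 0,Q 1[1,-3,6,-7],Q 1[1,-2,3,-4]][C 1[L 1,Q 1[4,-6,20,-37,39],Q 9[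
1,8,1,0,1]][],C 1[L 1,Q 1[1,-2,6,-9,11]][],D 2[L 1][],D 2[L 1][],D 2[L 1][],D 2[L 0,L 1][],D 2[L 1][],D 4[L 1,L 0][]],C 2[L 0,Q 1[1,6,-5,9]][],C 2[L 0,Q 3[1,
5,0,-3]][D 2[L 0][],D 2[L 1][],D 2[L 0][]],C 2[Q 0[2,8,-1,7]][D 3[L 1,Q 2[1,3,17,8,-11],Q 2[2,-3,-20,-9,13]][],D 8[Q 1[1,1,7,0,7],Q 2[1,1,7,6,-5],Q 9[28,-4,4,
4,3]][],C 0[Q 1[1,1,7,0,7],Q 0[2,1,6,1,7]][],D 3[L 1,Q 2[1,-4,-19,-9,13]][],D 3[L 1][],C 3[L 1,Q 2[1,2,9,6,-7]][],C 0[L 1,Q 1[1,1,7,0,8]][],D 3[L 0,L 1][]]],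
D 2[Q 0[1,0,1],Q 0[1,1,0]][C 3[Q 0[2,6,-1,7]][D 3[L 1,Q 2[1,3,-11,8,17],Q 2[1,-3,11,-9,-18]][],C 1[Q 1[1,1,7,0,7],Q 0[2,1,7,1,6]][],D 8[Q 1[1,1,7,0,7],Q 2[1,
1,-4,5,6],Q 9[28,-4,3,4,4]][],D 3[L 1][],D 3[L 1,Q 2[1,-4,13,-9,-19]][],C 2[L 1,Q 1[1,1,8,0,7]][],C 3[L 1,Q 2[1,2,-6,5,9]][],D 3[L 0,L 1][]],C 3[Q 0[1,5,-1,
5]][C 0[Q 2[1,-1,5,0,-5],Q 0[1,0,3,0,3]][],C 0[Q 2[1,-1,5,0,-5],Q 0[1,0,3,0,3]][],C 0[Q 0[1,0,4,-1,4],Q 1[1,1,7,0,8]][],D 3[L 1][],C 0[L 1,Q 2[1,-1,5,0,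
-5]][],D 3[L 1][],C 0[L 1,Q 2[1,-2,9,1,-9],L 0][],C 0[Q 0[2,1,6,0,5],Q 1[1,1,8,-1,8]][]],D 3[L 0][D 4[L 1,L 0][],C 2[L 0,Q 2[1,5,0,-1,-6]][C 2[L 2,Q 9[12,3,0,
2,2,0]][]],C 0[L 0,L 1,Q 9[31,6,5,5,1]][C 3[L 2,L 1,Q 1[2,2,-1,-1,-1,14]][],C 3[L 1,Q 8[5,-1,1,1,1,1]][],C 2[L 2,Q 9[37,-3,0,5,5,6]][],C 4[L 2,Q 1[18,23,-13,
-3,-4,130],Q 1[4,5,-2,-2,-2,27],Q 8[29,-28,-6,-1,-1,0]][],C 4[L 2,Q 9[11,3,1,2,2,0]][]],D 8[Q 9[25,5,4,4,1]][C 2[Q 9[8,322,11,51,51,53],Q 8[9,0,2,2,2,2]][C 1[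
L 3,Q 9[5,0,-6,1,0,0,-1]][]],C 3[L 1,Q 9[4,21,4,1,1,3],Q 9[5,6,2,1,1,1]][],D 4[L 1,Q 9[4,15,3,1,1,3]][],C 1[L 1,Q 9[4,21,4,1,1,4],Q 9[5,7,1,1,1,2]][],C 0[L 2,
Q 1[1,1,-1,3,4,-1]][]],C 2[L 1,Q 2[1,-4,0,5,4]][],C 3[L 0,L 1][D 4[L 1,Q 9[2,55,1,9,9,9]][C 1[L 3,Q 9[5,1,-6,0,0,0,-1]][],C 4[L 2,L 3][]],D 4[L 2,L 1][],D 7[
L 2,Q 8[21,-7,5,3,3,3]][],D 4[L 2,L 1][],D 4[L 1,L 2][D 7[L 3,Q 8[7,1,2,2,2,2,2]][]]],C 0[L 0,L 1][C 4[L 1,L 2,Q 1[4,4,-3,-2,-2,24]][D 4[L 2,Q 9[1,5,31,7,6,6,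
1]][]],D 4[L 1,L 2][],C 4[L 1,Q 8[13,-3,2,2,2,3]][],D 4[L 2,L 1][],D 4[L 2,L 1][],D 4[L 1,L 2][C 0[L 3,Q 9[19,1,4,5,4,4,1]][],C 0[Q 8[9,3,3,3,3,3,1]][]]],C 0[
L 1,Q 2[1,-4,0,4,5]][],C 2[L 0,L 1,Q 2[1,5,-2,-4,-1]][],C 2[L 1,Q 3[1,5,0,0,-3]][],D 4[L 0,L 1][C 3[Q 8[8,3,2,2,2,0]][],C 4[L 2,Q 9[18,1,4,3,3,0]][]],D 4[L 0,
L 1][]],C 0[Q 1[2,-3,4,-1],Q 1[4,-5,7,1]][C 3[Q 1[2,2,-1,15,-1],Q 1[7,3,-3,20,-4],Q 9[11,61,8,-1,9]][],C 1[Q 1[1,-1,7,-8,0],Q 1[3,-1,8,-8,0]][],C 1[Q 1[5,-2,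
11,-11,0],Q 1[1,-1,5,-5,0]][],C 2[Q 1[1,-1,6,-6,0],Q 1[3,-1,8,-8,0]][],C 1[Q 1[1,-1,5,-6,0],Q 1[2,-1,7,-7,1]][],C 1[Q 1[2,-1,4,-5,0],Q 1[1,-1,4,-5,0]][],C 2[
L 1,Q 1[1,-1,5,-6,0]][],C 1[L 1,Q 1[1,-1,6,-6,1],L 0][],C 1[L 1,Q 1[2,-1,5,-5,0],Q 1[1,-1,5,-4,0],Q 1[3,-1,7,-5,1]][],C 2[Q 1[3,-2,16,-14,0],L 1][],C 2[Q 1[2,
-1,5,-5,0],Q 1[1,-1,5,-4,0],L 1][D 4[L 2,L 1][]],C 1[L 1,Q 1[1,-1,6,-5,0]][],C 1[L 0,Q 1[1,-2,5,-5,0]][],C 4[L 0,Q 1[1,6,-9,13,-2]][],C 2[L 0,Q 1[1,-2,5,-5,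
0],L 1][],C 1[Q 1[2,-6,13,-17,-1]][],C 1[L 1,Q 1[1,-2,5,-5,0]][],D 3[L 0,L 1][],D 3[L 0,L 1][],D 3[L 0,L 1][],D 3[L 0,L 1][],D 3[L 1,L 0][],C 1[Q 1[1,-6,6,-9,
5]][],C 2[L 0,L 1,Q 1[1,-3,5,-6,0]][D 4[L 2,L 1][]],C 1[L 1,L 0,Q 1[1,-3,6,-7,-1]][],D 4[L 0,L 1][],D 4[L 0,L 1][],D 4[L 0,L 1][]],D 8[Q 9[6,1,1,1]][C 3[Q 9[
4,20,3,0,3],Q 1[2,1,-1,7,-1],Q 1[1,1,-1,7,-1],Q 1[3,1,-1,7,-1]][],C 2[Q 9[7,37,6,1,6],Q 9[5,8,2,1,2],Q 2[4,-1,-4,-5,0],Q 2[4,-1,0,-5,-4],Q 2[5,-1,-10,-11,-8],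
Q 2[5,-1,-8,-11,-10],Q 2[7,-1,-13,-9,-13],Q 2[13,-1,-19,-9,-12],Q 2[13,-1,-12,-9,-19]][C 0[L 1,Q 1[1,0,1,-1,6,-1],Q 9[1,9,40,7,1,7]][],C 0[L 1,Q 1[1,0,1,-1,6,
-1],Q 9[1,9,40,7,1,7]][],C 4[L 1,Q 2[1,-6,1,6,9,8]][]],C 4[Q 1[2,2,-1,13,-2],Q 1[2,1,-1,6,-1],Q 1[7,6,0,39,-9],Q 1[5,2,0,9,0],Q 1[5,2,0,9,-3],Q 1[7,6,-6,39,
-2]][C 2[Q 1[5,-8,-8,9,-51,7]][],D 3[L 2,Q 9[7,1,44,6,1,7],Q 1[3,-3,-2,0,-16,5],Q 2[9,-1,-1,-6,-20,-10]][D 4[L 3,L 2][],D 4[L 2,L 3][],D 4[L 2,L 3][]],D 3[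
L 2][],D 3[L 2][],D 3[L 1,L 2][],D 3[L 1,L 2][],D 4[L 1,L 2][],D 4[L 1,L 2][]],C 4[Q 1[2,2,-2,13,-2],Q 1[2,1,-1,6,-1],Q 1[7,6,-9,39,0],Q 1[5,2,-2,10,0],Q 1[7,
6,-2,39,-6]][C 3[Q 1[5,-8,-8,7,-51,9]][],D 3[L 2,Q 9[7,2,44,7,1,6],Q 1[3,-3,-2,5,-16,0],Q 2[9,-1,-1,-10,-20,-6]][D 4[L 3,L 2][],D 4[L 2,L 3][],D 4[L 2,
L 3][]],D 3[L 2][],D 3[L 2][],D 3[L 1,L 2][],D 3[L 1,L 2][],D 4[L 1,L 2][],D 4[L 1,L 2][]],C 1[Q 1[2,2,13,-1,-2],Q 1[2,1,6,-1,-1],Q 1[7,6,39,0,-9],Q 1[5,2,9,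
0,0],Q 1[5,2,9,0,-3],Q 1[7,6,39,-6,-2]][C 1[Q 1[5,-8,-8,-51,9,7]][],D 3[L 2,Q 9[7,1,44,1,6,7],Q 1[3,-4,-3,-20,2,6],Q 2[9,-1,-1,-20,-6,-10]][D 4[L 2,L 3][],
D 4[L 2,L 3][],D 4[L 3,L 2][]],D 3[L 2][],D 3[L 1,L 2][],D 3[L 2][],D 3[L 1,L 2][],D 4[L 1,L 2][],D 4[L 1,L 2][]],C 2[Q 9[7,37,1,6,6],Q 9[5,8,1,2,2],Q 2[4,-1,
-5,-4,0],Q 2[4,-1,-5,0,-4],Q 2[5,-1,-11,-10,-8],Q 2[7,-1,-9,-13,-13],Q 2[5,-1,-11,-8,-10],Q 2[13,-1,-9,-19,-12],Q 2[13,-1,-9,-12,-19]][C 3[L 1,Q 1[1,0,1,6,-1,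
-1],Q 9[1,9,40,1,7,7]][],C 4[L 1,Q 1[1,0,1,6,-1,-1],Q 9[1,9,39,1,7,6]][],C 4[L 1,Q 2[1,-6,1,9,6,8]][]],C 1[Q 9[8,39,0,6,6],Q 1[2,1,7,-2,-1],Q 1[1,1,7,-1,-1],
Q 1[6,2,15,-3,-6]][],C 2[Q 1[3,3,19,-4,-3],Q 1[2,1,6,-1,-1],Q 1[7,6,39,-9,0],Q 1[3,1,5,0,0],Q 1[5,2,9,-3,0],Q 1[7,6,39,-2,-6]][C 3[Q 1[3,-7,-7,-45,9,7]][],
D 3[L 2,Q 9[7,2,44,1,7,6],Q 1[3,-3,-2,-16,5,0],Q 2[9,-1,-1,-20,-10,-6]][D 4[L 3,L 2][],D 4[L 2,L 3][],D 4[L 2,L 3][]],D 3[L 2][],D 3[L 1,L 2][],D 3[L 2][],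
D 3[L 1,L 2][],D 4[L 1,L 2][],D 4[L 1,L 2][]],C 0[Q 1[2,2,-2,-2,13],Q 1[2,1,-1,-1,6],Q 1[7,6,-9,0,39],Q 1[5,2,-2,0,10],Q 1[7,6,-2,-6,39]][C 1[Q 1[5,-8,-8,7,9,
-51]][],D 3[L 2,Q 9[7,1,44,7,6,1],Q 1[3,-4,-3,5,1,-21],Q 2[9,-1,-1,-10,-6,-20]][D 4[L 2,L 3][],D 4[L 2,L 3][],D 4[L 3,L 2][]],D 3[L 2][],D 3[L 1,L 2][],D 3[
L 2][],D 3[L 1,L 2][],D 4[L 1,L 2][],D 4[L 1,L 2][]],C 2[Q 9[7,37,6,6,1],Q 9[5,8,2,2,1],Q 2[4,-1,0,-4,-5],Q 2[4,-1,-4,0,-5],Q 2[7,-1,-13,-13,-9],Q 2[5,-1,-8,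
-10,-11],Q 2[5,-1,-10,-8,-11],Q 2[13,-1,-12,-19,-9],Q 2[13,-1,-19,-12,-9]][C 5[L 1,Q 1[1,0,1,-1,-1,6],Q 9[1,9,40,7,7,1]][],C 5[L 1,Q 1[1,0,1,-1,-1,6],Q 9[1,9,
39,6,7,1]][],C 0[L 1,Q 2[1,-6,1,6,8,9]][]],C 0[Q 1[3,3,-3,-4,19],Q 1[2,1,-1,-1,6],Q 1[7,6,0,-9,39],Q 1[5,2,0,-2,10],Q 1[7,6,-6,-2,39]][C 3[Q 1[3,-7,-7,7,9,
-45]][],D 3[L 2,Q 9[7,2,44,6,7,1],Q 1[3,-3,-2,0,5,-16],Q 2[9,-1,-1,-6,-10,-20]][D 4[L 3,L 2][],D 4[L 2,L 3][],D 4[L 2,L 3][]],D 3[L 2][],D 3[L 1,L 2][],D 3[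
L 2][],D 3[L 1,L 2][],D 4[L 1,L 2][],D 4[L 1,L 2][]],C 0[Q 9[8,39,6,6,0],Q 1[2,1,-1,-2,7],Q 1[1,1,-1,-1,7],Q 1[6,2,-6,-3,15]][]],C 4[L 0][C 3[Q 1[3,-1,-6,6,
0],Q 1[1,-1,-6,4,0],Q 1[2,-1,-7,5,0]][],C 4[Q 1[2,-1,-6,5,-1],Q 1[1,-1,-5,5,0],L 1,Q 1[3,-1,-7,8,1]][D 4[L 1,L 2][]],C 2[L 1,Q 1[8,9,52,0,6],Q 1[7,6,41,4,0],
Q 2[9,8,28,22,24]][],C 4[Q 1[3,-1,-9,9,0],Q 1[1,-1,-6,6,0]][],C 2[L 1,Q 1[4,5,34,-3,2],Q 1[2,1,7,0,1],Q 2[1,1,5,2,3]][],C 4[Q 1[3,-1,-8,9,0],Q 1[1,-1,-6,6,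
0]][],C 4[L 1,Q 1[1,-1,-6,6,-1]][],C 4[L 1,Q 1[2,-1,-5,5,0],Q 1[1,-1,-8,7,1]][],D 3[L 1][],C 4[L 1,Q 1[1,-1,-6,6,1],Q 1[2,-1,-5,5,0]][],C 4[L 1,Q 1[3,-3,-12,
13,-4]][],C 3[L 1,Q 1[1,1,8,-1,-1],L 0][],C 4[L 1,Q 1[1,-2,-9,8,-1]][],C 0[L 1,Q 1[1,1,0,-1,6],L 0][],C 4[L 1,Q 1[1,-1,-6,6,0]][],D 3[L 0,L 1][],D 3[L 1,
L 0][],D 3[L 0,L 1][],D 3[L 0,L 1][],D 4[L 1,L 0][]],C 3[Q 1[2,-3,-1,4],Q 1[4,-5,1,7]][C 1[Q 1[1,-1,8,1,-9],Q 1[3,-1,8,0,-8]][],C 1[Q 1[3,-1,9,1,-8],Q 1[1,-1,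
8,1,-8]][],C 1[Q 1[5,-2,11,0,-11],Q 1[1,-1,5,0,-5]][],C 0[Q 1[2,2,-1,-1,15],Q 1[2,1,-1,-1,6],Q 9[11,60,8,9,-1]][],C 1[L 1,Q 1[1,-1,6,0,-5]][],C 1[Q 1[3,-2,16,
0,-14],L 1][],C 1[Q 1[2,-1,5,0,-5],Q 1[1,-1,5,0,-4],L 1][D 4[L 2,L 1][]],C 1[L 1,Q 1[1,-1,5,0,-6]][],C 1[L 1,Q 1[1,-1,6,1,-6],L 0][],C 1[L 1,Q 1[2,-1,5,0,-5],
Q 1[1,-1,5,0,-4],Q 1[3,-1,7,1,-5]][],C 1[Q 1[1,-1,5,0,-6],Q 1[2,-1,6,0,-7]][],C 1[Q 1[2,-1,4,0,-5],Q 1[1,-1,4,0,-5]][],D 3[L 0,L 1][],D 3[L 1,L 0][],C 1[Q 1[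
2,-6,13,-1,-17]][],C 1[L 1,Q 1[1,-2,5,0,-5]][],D 3[L 0,L 1][],D 3[L 0,L 1][],C 3[L 0,Q 1[1,6,-9,-3,13]][],C 1[L 0,Q 1[1,-2,5,0,-5],L 1][],D 3[L 0,L 1][],C 1[
L 0,Q 1[1,-2,5,0,-5]][],D 4[L 0,L 1][],D 4[L 0,L 1][],C 1[L 1,L 0,Q 1[1,-3,6,-1,-7]][],D 4[L 0,L 1][],C 1[L 0,L 1,Q 1[1,-3,5,0,-6]][D 4[L 2,L 1][]],C 1[Q 1[1,
-3,4,2,-5]][]],D 3[L 0][D 4[L 0,L 1][],D 4[L 0,L 1][C 4[L 2,Q 9[19,5,4,1,3,1]][],C 3[L 2,Q 9[20,5,4,1,3,1]][]],C 2[L 1,Q 3[1,5,0,-3,0]][],C 2[L 0,L 1,Q 2[1,5,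
-2,-1,-4]][],C 4[L 0,L 1][C 0[L 1,L 2,Q 1[4,4,-3,-2,24,-2]][D 4[L 2,Q 9[1,5,31,7,6,1,6]][]],D 4[L 2,L 1][],D 4[L 1,L 2][C 1[L 3,Q 9[7,2,4,1,1,1,1]][],C 1[L 3,
Q 9[7,2,4,1,1,1,1]][]],C 3[L 1,Q 8[13,-3,2,2,3,2]][],D 4[L 2,L 1][],D 4[L 1,L 2][]],D 8[Q 9[25,5,4,1,4]][C 3[L 2,Q 1[1,1,-1,3,-1,4]][],D 4[L 1,Q 9[5,22,4,1,4,
1]][],C 1[L 1,Q 9[4,22,4,1,4,1],Q 9[5,7,1,1,2,1]][],C 0[L 1,Q 9[5,27,5,1,4,1],Q 9[5,6,2,1,1,1]][],C 2[Q 9[8,322,11,51,53,51],Q 8[9,0,2,2,2,2]][C 3[L 3,Q 9[5,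
0,-6,1,0,-1,0]][]]],C 2[L 1,Q 2[1,-4,0,5,4]][],C 3[L 0,L 1][D 4[L 1,Q 9[2,55,1,9,9,9]][C 4[L 3,Q 9[5,1,-6,0,0,-1,0]][],C 1[L 2,L 3][]],D 4[L 2,L 1][],D 4[L 1,
L 2][D 7[L 3,Q 8[7,1,2,2,2,2,2]][]],D 7[L 2,Q 8[21,-7,5,3,3,3]][],D 4[L 2,L 1][]],C 3[L 0,L 1,Q 9[31,6,5,1,5]][C 0[L 2,Q 1[18,23,-13,-3,130,-4],Q 1[4,5,-2,-2,
27,-2],Q 8[29,-28,-6,-1,0,-1]][],C 3[L 1,Q 8[5,-1,1,1,1,1]][],C 2[L 2,Q 9[37,-3,0,5,6,5]][],C 0[L 2,L 1,Q 1[2,2,-1,-1,14,-1]][],C 4[L 2,Q 9[18,4,4,1,3,1]][]],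
C 0[L 1,Q 2[1,-7,4,8,4]][],C 2[L 0,Q 2[1,5,0,-6,-1]][C 2[L 2,Q 9[17,4,3,1,3,1]][]],D 4[L 1,L 0][]],C 0[Q 0[1,5,5,-1]][C 1[Q 2[1,-1,5,-5,0],Q 0[1,0,3,3,0]][],
C 1[Q 0[1,0,5,5,-1],Q 1[1,1,7,8,0]][],C 2[Q 2[1,-1,5,-5,0],Q 0[1,0,3,3,0]][],C 1[L 1,Q 2[1,-1,5,-5,0],L 0][],C 1[Q 0[2,1,6,5,0],Q 1[1,1,8,8,-1]][],C 2[L 1,
Q 2[1,-2,8,-9,0]][],D 3[L 1][],D 3[L 1][]],C 0[Q 0[2,7,8,-1]][D 8[Q 1[1,1,7,7,0],Q 2[1,1,-5,7,6],Q 9[28,-4,3,4,4]][],D 3[L 1,Q 2[1,3,-11,17,8],Q 2[2,-3,13,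
-20,-9]][],C 0[Q 1[1,1,7,7,0],Q 0[2,1,7,6,1]][],C 1[L 1,Q 2[1,2,-7,9,6]][],D 3[L 1,Q 2[1,-4,13,-19,-9]][],C 0[L 1,Q 1[1,1,9,9,0]][],D 3[L 1][],D 3[L 0,
L 1][]]],C 0[Q 0[1,3,3]][C 0[Q 0[1,0,3,3],Q 2[1,-1,7,-7]][],C 0[Q 0[3,1,9,8],Q 1[1,1,7,8]][],C 0[Q 2[1,-2,8,-9],Q 0[1,0,3,3]][],C 0[Q 0[2,1,8,7],Q 2[1,-1,4,
-4]][],C 0[Q 0[1,3,8,9]][]]]]"

definition "cert_988885554222 =
D 2[][D 9[][C 1[Q 10[3,15,2],Q 10[3,5,1],Q 10[1,8,1]][D 2[Q 8[1,5,-3,0],Q 1[8,1,1,-1]][],C 3[Q 10[2,-9,-43,-6]][],D 2[Q 1[8,2,1,-1]][C 1[Q 1[1,7,0,1,0],Q 1[2,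
6,0,1,0]][],C 2[Q 1[7,27,0,4,0],Q 1[7,46,0,6,-4],Q 1[2,6,0,1,0]][D 8[H 2,Q 1[1,-8,-54,1,-7,3],Q 10[3,-2,0,-6,-30,-4]][]],D 2[Q 10[1,1,9,41,6],Q 0[1,1,0,0,0],
Q 1[8,0,2,1,-1]][C 3[L 2,Q 1[4,28,-4,0,3,-5],Q 1[5,20,0,0,3,0]][],C 3[Q 1[4,-20,1,1,-2,20]][]]],C 3[Q 10[1,-5,-30,-4]][D 2[Q 1[7,1,0,1,0],Q 1[17,1,6,2,0]][],
D 2[Q 1[7,1,0,1,7],Q 1[7,1,0,1,0],Q 10[1,1,-12,-69,-9]][]],D 2[Q 1[7,2,1,-1]][C 1[Q 1[1,7,0,1,0],Q 1[2,6,0,1,0]][],C 2[Q 1[7,45,0,6,-5],Q 1[5,20,0,3,0]][D 8[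
H 2,Q 2[1,6,46,-5,6,18],Q 2[1,-2,-17,3,-2,-7]][]],C 3[Q 1[5,20,-2,3,0],Q 1[7,46,-3,6,-1],Q 0[1,1,0,0,0],Q 5[19,0,14,1,5]][D 2[L 2,Q 10[1,2,1,11,58,8]][],D 2[
L 2][]]],C 3[Q 10[2,-7,-53,-7]][D 2[Q 10[1,2,-8,-60,-8],Q 1[7,1,0,1,0],Q 1[6,-1,-7,1,0],Q 1[6,-1,0,1,-7]][C 1[L 2,Q 1[3,22,-2,-9,3,-9]][]]],C 1[Q 10[5,-9,-68,
-9],Q 4[5,-2,1,-2]][C 0[Q 10[3,3,-5,-36,-5]][D 2[Q 10[1,7,7,-8,-60,-8]][]],C 0[Q 10[1,1,-3,-21,-3]][],D 2[L 1][]]],C 0[Q 10[6,37,4],Q 0[1,0,1],Q 10[1,9,1]][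
D 2[Q 10[1,22,50,6],Q 1[37,5,4,0]][],D 2[Q 1[8,1,1,-1],Q 1[5,-1,1,-6],Q 10[1,7,15,2]][D 2[Q 8[1,1,6,-3,0],Q 1[8,0,1,1,-1]][]],C 2[Q 10[2,-8,-45,-5],Q 1[2,3,0,
10]][],C 2[Q 10[2,-7,-45,-5],Q 1[1,2,0,5]][]],C 0[Q 1[2,1,6],Q 1[1,1,7],Q 0[1,0,1],Q 1[5,3,20]][C 2[Q 1[4,-8,-7,-53],Q 1[6,-7,-6,-46]][C 2[H 2,Q 9[1,4,6,-6,
1]][],C 0[Q 1[2,3,-8,-7,-54]][],C 0[H 2,Q 1[4,3,-7,-6,-45],Q 10[6,9,4,46,1]][],C 0[Q 1[3,3,-7,-6,-46],Q 2[11,2,4,3,27]][],C 0[Q 1[1,2,-4,-4,-29],Q 10[11,15,8,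
90,1]][D 2[L 2][]],C 0[Q 1[4,9,-9,-8,-63],Q 10[1,1,0,9,0],Q 0[1,1,0,0,0]][D 2[L 2][]],C 0[H 2,Q 10[8,5,4,40,1],Q 10[15,11,8,90,1],Q 0[1,1,0,0,0],Q 2[5,9,5,4,
34]][],C 0[Q 1[4,3,-8,-7,-52],Q 10[3,3,2,21,0],Q 1[8,3,-9,-8,-57]][C 1[L 2,Q 10[4,-6,-6,-5,-41,0]][]]],C 2[Q 1[4,-9,-8,-61],Q 1[1,-4,-3,-24]][D 2[Q 1[6,3,3,2,
15],Q 1[9,5,3,4,22],Q 1[3,0,-5,-4,-32]][D 8[Q 8[6,1,0,0,-3,1],Q 9[38,6,5,-6,0,6],Q 1[2,-34,8,-10,-9,-35]][],C 0[L 2,Q 2[1,5,3,1,2,9]][],C 2[Q 1[5,32,-6,-5,-1,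
-40]][]],D 2[Q 10[1,1,0,8,0],Q 1[18,6,12,13,83]][C 1[L 2,Q 2[1,5,4,2,1,8]][],D 4[L 2,Q 10[8,1,6,0,42,1]][D 5[L 3,Q 4[6,-7,-1,0,0,1,0]][]]]],D 2[Q 1[2,-2,-1,
-8]][C 1[L 1,Q 1[3,9,-2,0,-7],Q 1[1,5,-1,0,-4],Q 1[5,18,2,3,9],Q 1[5,23,1,3,5]][D 2[L 2][],D 4[L 2,Q 10[9,7,0,0,51,1]][]],C 3[L 1,Q 1[4,15,-2,1,-8],Q 1[1,6,
-2,0,-6],Q 1[2,6,0,1,0]][D 2[L 2][]],D 2[L 1][D 4[L 2,Q 1[2,0,-10,-5,-3,-10]][]],C 0[Q 1[3,8,-9,-5,-34],L 1,Q 10[1,1,0,9,0]][],D 2[L 1,Q 10[1,1,0,9,0],Q 0[1,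
1,0,0,0],Q 1[2,0,-2,-1,-8]][D 4[L 2,Q 1[2,0,0,-8,-4,-30]][],D 4[L 2][],D 4[L 2][]],C 4[L 1,Q 1[2,9,-8,-4,-29]][],C 0[Q 1[3,0,-9,-5,-33],Q 10[1,1,0,8,0],Q 10[
9,6,2,39,1],Q 5[14,5,19,1,0],Q 10[4,3,1,21,0]][D 2[Q 10[1,9,6,2,39,1],Q 1[8,2,-1,0,1,0]][],D 2[L 2,Q 10[1,11,8,2,58,1]][],C 0[L 2,Q 10[1,-1,-1,0,-8,0]][D 4[
L 3][]],C 0[L 2,Q 1[1,-1,3,-2,-1,-8],Q 9[15,3,1,4,1,2]][],C 1[Q 10[2,-5,-5,0,-36,0]][]]],C 1[Q 1[1,7,3,19],Q 9[19,-1,-21,3]][C 2[Q 1[1,1,5,2,10]][],D 2[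
L 1][],C 2[Q 1[1,1,4,2,10]][],C 1[Q 1[1,1,7,3,17]][],C 1[L 1,Q 1[1,1,8,3,18]][],D 2[L 1][]]],C 0[Q 1[2,1,9],Q 1[6,5,44],Q 1[5,2,17]][C 2[Q 1[3,-7,-6,-54],H 2,
Q 10[1,3,5,0]][],C 2[Q 1[1,-4,-2,-18],Q 10[1,1,5,0],Q 10[15,23,111,-1],Q 8[5,0,-3,1]][],C 2[Q 10[1,1,5,0],Q 1[2,-8,-3,-26],Q 8[5,0,-3,1],Q 10[2,3,15,0]][C 2[
H 2,Q 10[4,29,25,131,1]][],D 2[L 1,Q 1[1,1,-3,-1,-10],Q 1[2,-2,2,1,6],Q 10[1,7,9,51,0]][]],C 1[Q 2[2,9,-1,-8],Q 0[1,3,0,3]][],C 1[Q 2[2,4,-1,-6],Q 1[1,7,1,8],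
Q 0[1,1,0,1]][]]]]"

definition "cert_999666654222 =
D 2[][D 9[][D 2[Q 10[1,8,1]][D 9[Q 1[1,7,1,8],Q 10[9,1,0,1]][],C 3[Q 10[3,-7,-52,-7]][C 1[Q 10[1,3,-4,-30,-4],Q 1[1,1,9,0,0]][],C 0[Q 10[1,3,-4,-30,-4],Q 1[1,
1,0,0,9]][],D 2[L 2][]],D 2[][C 1[L 2,Q 1[1,8,0,1,0]][],D 9[Q 10[9,1,-5,-38,-5],Q 9[6,1,2,14,2]][D 9[Q 1[1,-6,-46,4,-6,5]][]]],D 9[Q 10[8,1,0,1],Q 1[1,7,1,
-1],Q 10[6,1,-7,-1]][D 9[Q 1[1,-8,-59,-8,14],Q 10[8,0,1,0,1]][],C 0[Q 1[1,-6,-46,-6,7],Q 10[1,9,0,0,1]][],D 2[Q 10[5,-9,-1,40,5],Q 10[5,40,5,-9,-1],Q 1[8,1,0,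
1,0]][D 9[Q 9[6,2,3,1,8,1],Q 1[3,-3,0,21,3,-2]][],D 9[Q 9[5,2,9,1,3,1],Q 1[3,-3,3,-1,0,22]][]],D 2[Q 10[7,-9,-1,55,7],Q 0[1,0,1,0,0],Q 1[8,1,0,1,0]][],D 9[
Q 1[7,-1,55,7,-9],Q 0[1,1,0,0,0],Q 10[8,0,1,0,1]][]],D 9[Q 0[1,0,1,0],Q 10[8,1,0,1],Q 10[7,1,-6,-1]][D 9[Q 1[7,7,-9,-1,55],Q 0[1,0,0,1,0],Q 10[8,0,1,0,1]][],
D 2[L 2][]],C 2[Q 1[2,-8,-1,8],L 1,Q 1[1,-6,-1,7]][]],C 0[Q 10[6,37,4],Q 0[1,0,1],Q 10[2,9,1],Q 10[1,9,1]][D 9[H 2][],D 2[Q 10[1,7,8,1],Q 1[9,1,1,0]][],C 2[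
Q 10[1,-4,-17,-2],Q 1[2,2,0,9],Q 1[15,23,-1,111],Q 1[3,2,0,9]][],C 2[Q 10[3,-11,-60,-7],Q 1[4,7,0,27],Q 1[1,1,0,4]][],C 2[Q 10[2,-5,-34,-4],Q 1[1,2,0,6]][]],
D 9[Q 1[1,1,8]][D 9[][D 2[Q 1[9,1,-5,-5,-38],Q 2[6,1,2,2,14]][D 2[Q 10[1,-8,-60,7,7,-8]][]],C 1[Q 10[3,-19,9,9,-2]][]],C 2[Q 1[1,-3,-3,-23]][C 0[Q 1[1,7,-6,
-6,-46],Q 10[1,1,0,9,0]][],D 2[L 2][],C 3[Q 1[1,7,-6,-6,-46],Q 10[1,1,9,0,0]][]],D 2[Q 10[1,8,7,1],Q 1[9,1,1,0]][],C 2[Q 1[5,0,3,20],Q 10[3,17,-3,2],Q 1[1,0,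
1,8],Q 1[2,0,1,6],Q 0[1,0,0,1],Q 1[23,-1,15,111]][C 1[Q 9[1,-5,8,5,1]][]],C 2[Q 10[3,-19,19,-2],H 2][],D 2[Q 1[8,1,1,0],Q 10[1,7,-1,1],Q 1[6,1,-1,-7]][D 2[
Q 10[1,-6,-45,10,-6],Q 1[8,0,1,1,0]][],C 2[Q 10[1,-4,-29,4,-4],Q 1[1,9,0,1,0]][],D 2[Q 10[7,-1,55,-9,7],Q 0[1,1,0,0,0],Q 1[8,0,1,1,0]][],D 2[Q 10[5,5,-9,38,
-1],Q 10[5,-1,40,-9,5],Q 1[8,0,1,1,0]][D 9[Q 9[6,2,1,3,8,1],Q 1[3,-3,-1,0,3,22]][],D 9[Q 9[5,2,1,9,3,1],Q 1[3,-2,23,3,0,-1]][]],D 9[Q 1[7,-9,-1,7,55],Q 0[1,0,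
1,0,0],Q 10[8,1,0,0,1]][]]],C 0[Q 1[18,10,91],Q 0[1,1,0],Q 1[1,1,9],Q 1[5,2,17]][C 2[Q 1[1,-3,-2,-17],Q 10[4,7,27,0],Q 10[2,2,7,0]][],C 2[Q 1[2,-8,-4,-37],
Q 10[2,2,9,0],Q 10[15,23,111,-1]][],D 9[Q 10[8,1,-1,1],Q 10[5,-1,-6,1]][D 9[Q 1[1,1,7,3,23],Q 10[8,0,1,-1,1]][],D 9[H 2,Q 1[1,1,7,3,23]][]],D 9[Q 1[1,8,1,7],
Q 10[9,1,0,1]][],D 2[L 1][]]]]"

definition "cert_988777733322 =
D 2[][D 9[][C 1[Q 10[2,6,1],Q 10[2,15,2],Q 10[3,5,1]][D 2[Q 8[1,5,-3,0],Q 1[8,1,1,-1]][],D 2[Q 10[2,20,56,9],Q 1[17,3,2,-3]][],C 3[Q 10[3,-8,-52,-7]][D 2[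
Q 10[1,4,-12,-81,-11],Q 1[7,1,0,1,0]][]],D 2[Q 2[5,-5,1,5],Q 1[6,3,1,-2]][C 1[Q 1[6,40,0,5,0]][],C 1[Q 2[3,-3,17,0,-20],Q 2[5,-7,24,-1,-23]][C 0[Q 2[2,-2,9,
-9,1,9],Q 1[3,0,5,0,1,-1],Q 2[4,-6,4,-30,1,33]][],D 3[L 1][],D 3[L 1,Q 3[6,6,4,0,2,5]][],D 3[L 1][]]],C 3[Q 10[2,-7,-53,-7]][C 0[Q 10[1,4,-8,-61,-8],Q 7[4,-3,
1,0,0]][C 2[Q 10[2,3,5,-5,-43,-5]][]]],C 1[Q 10[3,-4,-29,-4]][C 0[Q 10[3,4,-5,-38,-5]][C 1[H 3,Q 10[1,6,6,-6,-48,-6]][]],C 0[Q 10[2,2,-5,-37,-5]][],C 0[Q 10[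
1,1,-5,-36,-5]][]]],C 0[Q 0[1,0,1],Q 10[1,9,1],Q 10[5,17,2],Q 10[6,44,5]][D 2[Q 10[1,22,50,6],Q 1[37,5,4,0]][],D 2[Q 1[8,1,1,-1],Q 1[5,-1,1,-6],Q 10[1,7,15,
2]][C 3[Q 10[1,1,7,14,2]][]],C 2[Q 1[6,7,0,38],Q 10[1,-5,-17,-2],Q 1[7,3,1,12]][],C 2[Q 10[3,-8,-61,-7]][]],D 2[Q 0[1,0,1]][C 2[Q 10[10,4,25,1],Q 10[1,1,7,0],
Q 2[4,-4,-1,-6]][C 2[Q 10[3,-8,-7,-52,0]][],C 3[Q 2[3,17,-20,0,-3],Q 2[5,24,-23,-1,-7]][C 3[Q 2[2,-2,-9,9,1,9],Q 1[3,0,0,-1,1,5],Q 2[4,-6,-30,33,1,4]][],D 3[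
L 1,Q 3[6,6,0,5,2,4]][],D 3[L 1][],D 3[L 1][]],C 2[Q 10[3,-9,-8,-60,0]][]],C 2[Q 10[8,3,24,1],Q 10[6,5,44,0],Q 10[7,2,16,1]][C 2[Q 10[1,7,2,14,1]][],C 1[Q 10[
1,-13,-5,-43,-1],Q 1[6,7,38,0,0]][],C 2[Q 10[1,7,3,23,1]][],C 0[Q 3[1,5,-3,0,0],L 1][],C 1[Q 10[3,-8,-7,-61,0]][]],C 1[Q 1[1,6,-1,-7],Q 1[4,9,-1,-9]][],C 1[
Q 1[1,5,-1,-6],Q 1[6,13,-2,-13]][],C 3[Q 1[4,-3,3,25],Q 1[3,-1,1,6],Q 9[173,25,-199,1]][C 0[Q 1[3,-8,1,-7,-54]][],C 2[Q 1[1,-1,6,0,-5],Q 1[4,-6,9,-3,-34],Q 1[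
5,0,9,2,1]][],C 1[Q 1[1,-2,6,-1,-13]][],C 1[Q 1[1,-1,6,0,-7],Q 1[3,0,5,1,0],Q 1[2,-1,3,0,-5]][],C 1[Q 1[2,-2,12,1,-4],L 0,L 1][]],C 2[Q 1[6,44,5,0],Q 1[5,12,
1,-4],Q 8[5,0,-3,1],Q 1[5,33,3,-5]][C 1[Q 1[3,-7,-48,-5,0]][],C 3[Q 1[1,7,15,2,1],Q 4[4,-4,2,1,0]][],C 1[Q 10[11,11,0,74,1],Q 1[1,-3,-8,-1,0],Q 7[6,1,1,-2,
1]][]],C 2[Q 1[7,24,6,24],Q 0[1,1,0,1]][C 0[Q 1[3,-8,-27,-7,-27]][D 8[Q 8[15,5,8,2,5,2],Q 8[6,0,0,1,-3,1],Q 1[2,5,-15,-49,-13,-49]][]],D 8[Q 8[6,-3,1,2,1],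
Q 9[5,-5,1,4,1]][C 2[Q 9[8,43,-5,7,5,7]][],C 2[Q 9[1,-1,5,0,-6,0],Q 9[1,-1,2,0,-2,0],Q 9[9,-2,15,1,-20,1]][C 1[H 3,Q 7[1,5,0,-1,1,1,1],Q 8[6,4,-4,-2,1,1,
1]][]]],C 0[Q 1[2,-7,-19,-5,-19]][D 8[Q 9[12,2,-1,2,-1,2],Q 1[1,3,-10,-28,-8,-29]][],D 8[Q 1[1,4,-10,-29,-8,-29],Q 9[12,2,-1,2,0,2]][]],C 0[Q 1[2,-3,-7,-2,
-8]][C 2[H 3,Q 10[2,5,0,1,14,1]][],C 3[Q 1[1,6,-8,-23,-6,-23]][],C 3[Q 10[7,7,2,1,41,1],Q 1[3,1,-5,-14,-4,-14]][D 3[L 2][]],C 3[Q 1[4,6,-7,-20,-6,-21]][],C 4[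
L 2,Q 10[10,10,3,1,72,1],Q 10[5,2,0,1,14,1],Q 1[3,2,-5,-14,-4,-14]][D 3[L 2][],D 3[L 2,L 3][]],D 8[Q 9[31,6,-2,5,3,5]][D 8[H 3][]]]]],C 0[Q 1[6,5,44]][C 2[
Q 1[3,-7,-6,-53],Q 0[5,7,9,0],Q 10[1,3,5,0]][],C 2[Q 1[3,-9,-7,-61],Q 10[1,2,6,0]][],C 2[Q 10[1,1,7,0],Q 10[11,5,29,1],Q 1[1,-3,-1,-8],Q 10[5,2,9,0]][D 2[
Q 10[4,75,76,508,-3],Q 10[3,-47,-48,-322,3]][],C 1[Q 10[3,-7,-8,-56,1]][]],C 1[Q 1[1,7,2,15],Q 4[4,-4,1,2]][D 8[Q 1[1,8,7,2,8],Q 8[17,2,3,4,2]][]],C 1[Q 1[1,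
7,1,8],Q 0[1,2,0,1]][],C 1[Q 1[1,7,1,8],Q 0[1,2,0,2]][]]]]"

definition "cert_997777653222 =
D 2[][D 9[][D 2[Q 10[1,8,1]][D 9[Q 1[1,7,1,8],Q 10[9,1,0,1]][],C 3[Q 10[3,-9,-68,-9]][C 1[Q 10[1,5,-7,-54,-7]][],C 0[Q 10[1,5,-7,-54,-7]][],D 2[Q 1[7,1,0,1,
7],Q 1[7,1,7,1,0],Q 1[8,1,0,1,0]][]],D 2[][D 9[Q 1[1,8,0,1,0],Q 1[1,-6,3,-1,4]][],D 9[Q 10[9,1,-5,-38,-5],Q 9[6,1,2,14,2]][C 1[Q 1[3,-23,-179,18,-23,18],Q 10[
1,-7,0,-2,-8,-2]][]]],D 9[Q 10[8,1,0,1],Q 1[1,7,1,-1],Q 10[6,1,-7,-1]][C 1[Q 1[1,-5,-37,-5,5]][C 1[Q 1[3,18,-23,-179,-23,18],Q 10[1,-2,-7,0,-8,-2]][]],C 0[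
Q 1[1,-4,-31,-4,6],Q 3[5,0,0,1,-3],Q 10[1,9,0,0,1],Q 10[6,44,0,0,5]][],D 2[Q 10[5,-9,-1,40,5],Q 10[5,40,5,-9,-1],Q 1[8,1,0,1,0]][D 3[Q 9[1,1,6,1,7,1],Q 10[3,
49,-47,-2,381,50],Q 1[6,0,2,0,1,8],Q 2[7,0,0,-1,1,-8],Q 2[7,-8,0,-1,1,0]][],D 3[Q 9[1,1,7,1,6,1],Q 10[3,49,381,50,-47,-2],Q 1[6,0,1,8,2,0],Q 2[7,-8,1,0,0,-1],
Q 2[7,0,1,-8,0,-1]][]],D 2[Q 10[7,-9,-1,55,7],Q 0[1,0,1,0,0],Q 1[8,1,0,1,0]][],C 0[Q 1[3,2,-3,0,17],Q 10[10,44,6,-5,-1],Q 10[8,54,7,-7,-1],Q 10[4,12,2,0,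
0]][]],C 1[Q 10[5,0,20,3],Q 1[3,17,2,-3],Q 10[2,0,15,2],Q 0[1,0,1,0],Q 10[2,0,6,1],Q 1[3,6,1,-2],Q 10[23,-1,111,15]][D 9[Q 10[5,-8,1,-55,-7]][],D 9[Q 1[1,7,7,
1,0],Q 2[1,-5,7,1,5]][]],C 2[Q 1[3,-16,-2,18],Q 1[4,-9,-1,9],Q 1[1,-1,0,1]][]],C 0[Q 10[18,91,10],Q 0[1,0,1],Q 10[1,9,1],Q 10[5,17,2],Q 10[6,44,5]][D 2[Q 1[9,
1,1,0],Q 1[8,1,1,8]][],D 2[Q 10[1,7,8,1],Q 1[9,1,1,0]][],D 2[Q 1[8,1,1,-1],Q 1[5,-1,1,-6]][D 2[Q 10[1,1,7,23,3],Q 1[8,0,1,1,-1]][],D 2[Q 10[1,1,7,23,3],Q 1[8,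
0,1,1,-1]][]],C 2[Q 10[1,-4,-17,-2],Q 1[2,2,0,9],Q 1[15,23,-1,111],Q 1[9,4,1,13]][],C 2[Q 10[3,-11,-60,-7],Q 1[4,7,0,27],Q 1[2,2,0,9]][],C 2[Q 10[3,-6,-44,
-5],Q 1[1,3,0,5]][]],D 9[Q 1[1,1,8]][D 3[Q 1[3,-4,-4,-29]][C 0[Q 1[2,-7,-9,-9,-63],Q 1[1,-1,-1,-1,-7]][C 1[Q 2[1,4,-1,1,1,8]][]],C 2[Q 2[3,8,1,1,-3],Q 2[4,18,
1,1,-14]][D 7[Q 2[1,16,77,0,0,-93],Q 2[1,-5,-23,0,0,27]][],D 7[Q 2[2,16,61,1,1,-68],Q 2[1,-7,-29,0,0,36]][],D 7[Q 2[1,5,12,0,0,-17],Q 2[1,-14,-41,0,0,53]][]],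
C 0[Q 1[1,4,-6,-6,-47],Q 10[5,6,22,22,0]][C 1[Q 2[2,7,1,3,3,23]][]]],C 2[Q 1[1,-3,-3,-23]][C 3[Q 1[2,6,-7,-7,-56],Q 1[8,4,-1,0,-7]][],C 0[Q 1[1,9,-8,-8,-61],
Q 3[5,-3,1,0,0],Q 10[1,1,0,9,0],Q 10[6,5,0,44,0]][],D 2[Q 1[7,3,4,3,24],Q 1[7,3,3,4,24]][D 3[Q 2[4,-6,-4,-1,-1,-7],Q 3[5,0,-3,0,1,0],Q 3[5,0,-3,1,0,0],Q 2[6,
16,9,4,5,17],Q 2[6,16,9,5,4,17]][C 2[L 2,Q 2[1,5,-3,-1,0,0,-3]][]]],C 3[Q 1[1,6,-4,-4,-31],Q 3[5,-3,0,1,0],Q 10[1,1,9,0,0],Q 10[6,5,44,0,0]][]],D 2[Q 10[1,8,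
7,1],Q 1[9,1,1,0]][],C 2[Q 1[23,-1,15,111],Q 10[2,9,-2,1],Q 10[2,17,-2,2],Q 1[3,0,1,5],Q 1[5,0,3,20]][D 2[Q 1[3,-9,1,-7,-54]][]],C 2[Q 10[2,-8,8,-1],Q 10[1,
-9,9,-1]][],D 2[Q 1[8,1,1,0],Q 10[1,7,-1,1],Q 1[6,1,-1,-7]][D 2[Q 10[1,-6,-45,10,-6],Q 1[8,0,1,1,0]][],C 2[Q 10[1,-7,-54,5,-7]][],D 2[Q 10[7,-1,55,-9,7],Q 0[
1,1,0,0,0],Q 1[8,0,1,1,0]][],D 2[Q 10[5,5,-9,38,-1],Q 10[5,-1,40,-9,5],Q 1[8,0,1,1,0]][D 3[Q 9[1,1,1,6,7,1],Q 10[3,49,50,-47,381,-2],Q 1[6,0,8,2,1,0],Q 2[7,0,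
-8,0,1,-1],Q 2[7,-8,0,0,1,-1]][],D 3[Q 9[1,1,1,6,7,1],Q 10[3,49,-2,381,-47,50],Q 1[6,0,0,1,2,8],Q 2[7,0,-1,1,0,-8],Q 2[7,-8,-1,1,0,0]][]],C 3[Q 1[5,28,3,0,
-7],Q 10[8,-1,54,-7,7],Q 10[13,-1,58,-6,8],Q 10[4,0,12,0,2]][]]],D 9[Q 0[1,1,0],Q 1[1,1,9]][D 2[Q 1[9,1,1,0],Q 1[8,1,1,8]][],C 2[Q 10[4,25,-6,3],Q 1[6,0,4,
37],Q 10[2,17,-1,2],Q 9[3,19,6,2],Q 1[2,0,1,9]][],C 2[Q 10[3,-16,17,-2],Q 10[2,-6,6,-1]][],D 2[Q 1[8,1,1,0],Q 1[7,1,1,7],Q 1[6,1,-1,-7]][D 2[Q 9[1,3,21,8,3],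
Q 1[8,0,1,1,0]][],D 2[Q 1[7,0,1,1,7],Q 1[7,7,1,1,0],Q 1[8,0,1,1,0]][],C 0[Q 10[1,-3,-24,3,-3]][],C 0[Q 1[5,-7,0,3,28],Q 10[6,5,-5,40,-1],Q 10[13,8,-6,58,-1],
Q 10[6,3,0,18,0]][],D 2[Q 1[7,0,1,1,7],Q 1[8,0,1,1,0],Q 1[7,7,1,1,0]][]]]]]"

definition "cert_998766663222 =
D 2[][D 9[][C 1[Q 10[2,6,1],Q 10[2,15,2],Q 0[1,1,0],Q 10[3,5,1],Q 10[5,20,3]][D 2[Q 8[1,5,-3,0],Q 1[8,1,1,-1]][],D 2[Q 10[2,20,56,9],Q 1[17,3,2,-3]][],D 2[
Q 1[9,2,1,-2]][D 2[Q 10[1,1,9,31,5],Q 1[9,0,2,1,-2]][],D 2[Q 10[1,1,7,24,4],Q 1[9,0,2,1,-2]][],D 2[Q 10[1,1,7,24,4],Q 1[9,0,2,1,-2]][]],C 3[Q 10[4,-9,-61,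
-8]][D 2[Q 1[8,1,0,1,0],Q 1[15,1,7,2,0]][],D 2[Q 1[7,1,0,1,7],Q 1[8,1,0,1,0],Q 10[1,5,-9,-59,-8]][],D 2[L 2][]],D 2[Q 2[5,-5,1,5],Q 1[6,3,1,-2]][D 9[Q 1[1,8,
0,1,0],Q 1[1,-6,0,-1,7],Q 10[6,1,-1,-6,0]][],D 9[Q 10[6,0,-6,-38,-5],Q 10[8,1,0,0,1],Q 9[15,2,5,33,4],Q 1[2,15,-1,2,-1]][D 2[Q 1[8,1,0,0,1,0],Q 9[1,7,1,1,6,
1]][]]],C 3[Q 10[3,-9,-68,-9]][C 1[Q 10[1,6,-7,-54,-7],Q 1[6,5,44,0,0],Q 8[5,-3,0,0,1]][],C 0[Q 10[1,6,-7,-54,-7],Q 1[6,5,0,0,44],Q 8[5,-3,1,0,0]][],D 2[Q 1[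
7,1,0,1,7],Q 1[7,1,7,1,0],Q 1[8,1,0,1,0]][],C 0[Q 10[2,5,-7,-57,-7],Q 1[5,6,0,0,44],Q 7[4,-3,1,0,0]][]],D 2[][D 9[Q 1[1,8,0,1,0],Q 1[1,-6,3,-1,4]][],D 9[Q 10[
9,1,-5,-38,-5],Q 9[6,1,2,14,2]][D 8[Q 1[1,-9,-68,6,-9,7],Q 9[12,-3,2,1,-3,1]][]]]],D 2[Q 0[1,0,1],Q 10[1,9,1]][D 9[Q 1[1,8,1,8],Q 9[19,2,6,3]][],D 2[Q 10[1,0,
9,1],Q 0[1,1,0,0],Q 0[1,0,0,1]][D 9[Q 1[1,9,0,1,0],Q 1[1,-7,0,-1,6],Q 1[5,6,38,6,-7]][],D 9[Q 1[6,43,-3,5,2],Q 1[6,-6,45,5,0]][],C 0[Q 10[8,0,0,60,7],Q 10[9,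
1,1,25,3],Q 10[35,3,3,148,17]][C 3[Q 10[3,-6,0,0,-44,-5]][],D 8[Q 1[1,3,-1,-1,0,5],Q 3[1,5,0,0,0,-3]][]],D 9[Q 10[8,1,0,0,1],Q 10[8,0,1,0,1],Q 10[7,1,1,-1,
0]][],D 9[Q 1[3,7,24,4,3]][]],C 2[Q 1[1,-6,-1,5],Q 1[6,-13,-2,13],Q 0[1,0,0,1],Q 10[1,0,9,1]][],C 1[Q 1[1,-7,-1,6],Q 1[3,-8,-1,7],Q 1[1,-1,0,1]][]],D 9[Q 1[1,
1,8]][D 8[H 2][D 2[Q 1[9,1,-6,-6,-47],Q 2[5,1,2,2,15]][D 2[Q 1[9,-19,1,-5,-5,-19],Q 2[5,7,1,2,2,8]][D 3[L 1][C 2[Q 8[2,1,2,2,11,2,3,2]][]]]],C 1[H 2,H 3,Q 1[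
9,1,-7,-7,-56],Q 2[5,1,1,1,7]][D 3[H 2,Q 2[17,0,3,1,1,-12]][],C 3[H 2,Q 3[3,-5,-1,0,0,0],Q 10[2,2,-1,8,9,0]][]],D 2[Q 9[1,130,0,-143,19]][]],C 2[Q 1[1,-3,-3,
-23]][C 3[Q 1[2,7,-9,-9,-67],Q 1[8,4,-1,0,-7]][],C 0[Q 1[1,6,-4,-4,-31],Q 3[5,-3,1,0,0],Q 10[1,1,0,9,0],Q 10[6,5,0,44,0]][],D 2[Q 1[7,3,4,3,24],Q 1[7,3,3,4,
24]][D 8[Q 8[5,1,0,-2,1,1],Q 8[14,2,3,3,4,2],Q 8[6,1,0,0,-3,1]][]],C 3[Q 1[1,6,-4,-4,-31],Q 3[5,-3,0,1,0],Q 10[1,1,9,0,0],Q 10[6,5,44,0,0]][]],D 2[Q 10[1,8,7,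
1],Q 1[9,1,1,0]][],D 2[Q 1[8,1,1,0],Q 0[1,0,0,1],Q 1[7,1,-1,-6]][D 2[Q 0[1,0,0,0,1],Q 0[1,1,0,0,0],Q 1[8,0,1,1,0]][],D 2[Q 10[7,7,-9,55,-1],Q 0[1,0,0,0,1],
Q 1[8,0,1,1,0]][]],C 2[Q 10[3,-16,18,-2],Q 10[4,-10,10,-1]][],D 2[Q 1[8,1,1,0],Q 10[1,7,-1,1],Q 1[6,1,-1,-7]][D 2[Q 10[1,-6,-45,10,-6],Q 1[8,0,1,1,0]][],C 2[
Q 10[1,-7,-54,6,-7],Q 1[6,44,0,5,0],Q 8[5,0,0,-3,1]][],D 2[Q 10[7,-1,55,-9,7],Q 0[1,1,0,0,0],Q 1[8,0,1,1,0]][],D 2[Q 10[5,5,-9,38,-1],Q 10[5,-1,40,-9,5],Q 1[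
8,0,1,1,0]][D 8[Q 1[7,0,46,6,0,-6],Q 1[3,-4,-6,-1,3,21],Q 8[5,0,1,-3,0,0],Q 9[7,1,1,0,-1,1]][],D 8[Q 1[7,0,-6,0,6,46],Q 1[2,-5,14,2,-1,-4],Q 9[7,1,1,-1,0,1],
Q 8[5,0,0,0,-3,1]][]],C 3[Q 1[4,27,3,0,-4],Q 10[6,-1,39,-5,5],Q 10[8,-1,29,-3,4],Q 10[3,0,5,0,1],Q 10[4,0,12,0,2]][]]],D 9[Q 0[1,1,0],Q 1[1,1,9]][D 2[Q 1[9,1,
1,0],Q 1[8,1,1,8]][],C 2[Q 10[2,9,-2,1],Q 1[6,0,4,37],Q 10[2,17,-1,2],Q 1[5,0,4,38],Q 9[4,27,7,3]][],C 2[Q 10[3,-15,17,-2],Q 10[6,-13,13,-2]][],D 2[Q 1[8,1,1,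
0],Q 1[7,1,1,7],Q 1[6,1,-1,-7]][D 2[Q 9[1,3,21,8,3],Q 1[8,0,1,1,0]][],D 2[Q 1[7,0,1,1,7],Q 1[7,7,1,1,0],Q 1[8,0,1,1,0]][],C 0[Q 10[1,-7,-54,6,-7],Q 8[5,1,0,
-3,0],Q 1[5,0,0,4,37]][],C 0[Q 1[4,-4,0,3,27],Q 10[6,5,-5,40,-1],Q 10[8,4,-3,29,-1],Q 10[3,1,0,5,0],Q 10[4,2,0,12,0]][],D 2[Q 1[7,0,1,1,7],Q 1[8,0,1,1,0],Q 1[
7,7,1,1,0]][]]]]]"

definition "cert_988877544222 =
D 2[][D 9[][D 2[Q 10[1,8,1]][C 2[Q 2[2,-8,-1,9],Q 0[1,3,0,3]][],C 3[Q 10[2,-7,-53,-7]][D 2[Q 10[1,2,-8,-60,-8],Q 1[7,1,0,1,0],Q 1[6,-1,-7,1,0],Q 1[6,-1,0,1,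
-7]][D 8[Q 1[3,22,-2,-9,3,-9],Q 10[5,1,7,-7,-58,-7],Q 9[7,1,0,1,-1,1]][]]],D 8[Q 10[3,-4,-29,-4]][D 2[Q 9[4,26,1,-22,1],Q 1[31,5,-3,4,-3]][],C 1[Q 10[2,-5,-7,
-48,-7],Q 10[5,-7,-8,-54,-8]][],C 0[Q 10[3,3,-5,-36,-5]][D 2[Q 10[1,7,7,-8,-60,-8]][]]],D 2[Q 10[1,0,8,1],Q 0[1,1,0,0]][C 0[Q 1[2,-9,0,-1,9],Q 1[1,-6,0,-1,
7]][],C 1[Q 10[7,0,1,34,5],Q 1[2,8,0,1,-1],Q 1[3,19,-2,2,-2],Q 10[16,-1,1,90,12]][],C 1[Q 10[8,1,1,42,6],Q 7[6,1,1,-2,1],Q 10[9,1,1,42,6]][C 0[Q 10[1,8,1,1,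
34,5],Q 10[2,9,1,1,39,6]][],D 8[Q 1[7,-3,23,23,6,-1],Q 10[10,-23,-1,-1,-132,-18]][C 1[Q 9[5,-57,1,-9,-9,7,-7],Q 10[3,-3,8,0,0,44,6]][],C 0[Q 10[2,3,-8,0,0,
-44,-6]][]],C 2[L 2,L 1,Q 1[8,0,26,26,7,-5]][D 4[L 3,L 2][],D 4[L 3,L 2][]]],C 2[Q 1[7,-7,44,5,-5],Q 1[9,0,25,4,-4],Q 1[4,0,21,3,-3],Q 1[7,-7,25,3,0],Q 1[4,
-1,15,2,-1]][C 0[L 2,Q 1[1,-1,5,-4,0,0]][],C 4[Q 1[2,-9,0,-34,-5,9]][],C 0[L 2,Q 1[1,-2,5,-5,0,0]][]],D 8[Q 10[1,-1,0,-8,-1],Q 9[12,1,2,-6,1],Q 1[6,-3,38,5,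
-3]][D 8[Q 10[3,5,-5,1,-38,-5],Q 9[6,5,2,1,8,2],Q 9[12,0,1,2,-6,1]][],D 8[Q 10[5,5,-7,1,-53,-7],Q 1[5,0,-3,31,4,-3],Q 9[12,0,1,2,-6,1],Q 10[5,-4,6,0,41,6]][],
D 8[Q 1[1,-4,3,-25,-3,3],Q 10[4,-5,-6,0,-41,-6],Q 9[12,0,1,2,-6,1]][]],C 1[Q 10[2,-8,0,-61,-8],Q 1[1,6,-7,-1,0]][],C 1[Q 10[1,-3,0,-22,-3]][D 8[Q 1[2,-1,-3,
15,2,-5],Q 10[5,7,-7,1,-58,-7],Q 9[7,0,1,1,-1,1]][]],C 0[Q 2[2,-8,0,-1,9],Q 0[1,3,0,0,3]][]],C 1[Q 10[23,-1,111,15],Q 10[2,0,6,1],Q 1[2,8,1,-1],Q 1[5,35,4,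
-3],Q 10[3,0,5,1],Q 10[1,0,8,1]][D 8[Q 10[2,-9,1,-54,-7],Q 1[1,9,27,3,-5],Q 1[1,-9,-29,-3,8],Q 9[9,1,1,-3,1]][],D 8[Q 10[3,-6,1,-47,-6],Q 2[1,-3,6,1,5],Q 9[
15,1,2,-8,1]][]],C 2[Q 1[5,-5,0,6],Q 1[1,-7,-1,6],Q 1[2,-8,-1,7]][]],C 0[Q 10[6,37,4],Q 0[1,0,1],Q 10[1,9,1],Q 10[5,17,2]][D 2[Q 10[1,22,50,6],Q 1[37,5,4,
0]][],D 2[Q 1[8,1,1,-1],Q 1[5,-1,1,-6],Q 10[1,7,15,2]][D 2[Q 8[1,1,6,-3,0],Q 1[8,0,1,1,-1]][]],C 2[Q 1[6,7,0,38],Q 10[1,-5,-17,-2],Q 1[3,2,0,10]][D 2[Q 10[1,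
-1,8,25,3],Q 1[8,0,1,1,-1]][]],C 2[Q 10[2,-8,-45,-5],Q 1[2,3,0,10]][],C 2[Q 10[2,-7,-45,-5],Q 1[1,2,0,5]][]],D 2[Q 0[1,0,1]][D 2[Q 10[1,1,8,0],Q 0[1,0,0,1]][
C 1[Q 10[8,1,6,42,1],Q 7[6,1,1,-2,1],Q 10[9,1,6,42,1]][C 0[Q 10[1,8,1,5,34,1],Q 10[2,9,1,6,39,1]][],D 8[Q 1[7,-3,23,-1,6,23],Q 10[10,-23,-1,-18,-132,-1]][C 0[
Q 9[5,-57,1,-9,-7,7,-9],Q 10[3,-3,8,0,6,44,0]][],C 1[Q 10[2,3,-8,0,-6,-44,0]][]],C 3[L 2,L 1,Q 1[7,0,22,-5,6,23]][D 4[L 3,L 2][],D 4[L 3,L 2][]]],C 1[Q 10[7,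
0,5,34,1],Q 1[2,8,-1,1,0],Q 1[3,19,-2,2,-2],Q 10[16,-1,12,90,1]][],C 2[Q 1[2,-9,9,-1,0],Q 1[1,-7,6,-1,0]][],C 0[Q 1[4,-1,-1,2,15],Q 1[4,-4,-3,3,24],Q 1[7,0,
-3,3,20],Q 1[6,0,-5,5,34],Q 1[5,-5,0,2,18]][C 0[L 2,Q 1[1,-1,5,0,0,-4]][],C 3[Q 1[1,-4,0,4,-2,-15]][],C 0[L 2,Q 1[1,-2,5,0,0,-5]][]],C 2[Q 2[2,-8,9,-1,0],Q 0[
1,3,3,0,0]][],C 2[Q 10[2,-5,-5,-36,0],Q 1[1,6,0,-1,-7]][],D 8[Q 10[1,-1,-1,-8,0],Q 9[12,1,1,-6,2],Q 1[6,-3,-3,5,38]][D 8[Q 1[1,-4,3,3,-3,-25],Q 10[4,-5,-6,-6,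
-41,0],Q 9[12,0,1,1,-6,2]][],D 8[Q 10[3,5,-5,-5,-38,1],Q 9[6,5,2,2,8,1],Q 9[12,0,1,1,-6,2]][],D 8[Q 10[5,5,-7,-7,-53,1],Q 1[5,0,-2,-4,4,31],Q 9[12,0,1,1,-6,
2],Q 10[5,-4,6,6,41,0]][]],C 2[Q 10[1,-3,-3,-22,0]][D 8[Q 1[2,-1,-3,-5,2,15],Q 10[1,3,-7,-7,-54,0],Q 9[7,0,1,1,-1,1]][]]],C 2[Q 10[6,4,37,0],Q 10[8,3,24,1],
Q 10[1,1,9,0],Q 0[1,1,0,0],Q 10[7,2,16,1]][D 2[Q 8[1,6,0,-3,1],Q 1[8,1,-1,1,0]][],D 2[Q 10[1,7,3,23,1],Q 1[8,1,-1,1,0]][],D 2[Q 10[1,7,3,23,1],Q 1[8,1,-1,1,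
0]][],C 1[Q 10[2,-8,-5,-43,0],Q 1[2,3,10,0,0]][],C 1[Q 10[2,-8,-5,-43,0],Q 1[2,3,10,0,0]][],C 1[Q 10[3,-9,-7,-59,0],Q 1[1,2,5,0,0]][],C 1[Q 10[2,-5,-4,-34,0],
Q 1[1,2,5,0,0]][]],C 1[Q 1[2,2,0,-2],Q 1[2,8,-1,-9],Q 1[1,7,-1,-6]][],C 1[Q 1[2,8,-1,-8],Q 1[1,5,-1,-6],Q 0[1,1,0,0],Q 10[1,1,9,0]][],C 3[Q 1[5,-3,4,32],Q 1[
2,0,1,6],Q 1[8,-8,3,28],Q 0[5,0,1,4],Q 1[5,0,3,20],Q 9[220,32,-251,1]][C 2[Q 1[2,-4,8,-2,-25],Q 1[2,0,6,1,0],Q 0[1,0,1,0,0]][],C 2[Q 1[2,-3,8,-1,-17],Q 1[2,0,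
6,1,0],Q 0[1,0,1,0,0]][],C 1[Q 1[1,-2,6,-1,-13]][],C 1[Q 1[5,-2,15,1,-9],Q 0[1,0,1,0,0],Q 1[1,-1,6,0,-5]][],C 1[Q 1[1,-2,7,0,-7],Q 1[3,-1,9,1,-3],Q 0[1,0,1,0,
0]][D 2[L 2][]],D 8[Q 1[1,8,-2,3,21],Q 1[1,-2,6,0,-5]][C 2[Q 1[8,1,-8,42,3,-18],Q 1[6,1,-3,21,2,-8]][]]],C 2[Q 1[6,44,5,0],Q 1[6,23,2,-6],Q 1[2,9,1,0],Q 8[5,
0,-3,1],Q 1[5,17,2,0],Q 1[1,1,0,-1],Q 1[5,33,3,-5]][C 1[Q 1[3,-7,-44,-5,0],Q 10[1,2,0,6,0]][],C 1[Q 1[2,-8,-37,-4,0],Q 10[6,9,0,43,1]][],C 1[Q 1[2,-8,-26,-3,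
0],Q 10[6,5,0,27,1],Q 10[10,13,-1,75,1],Q 7[5,1,1,-2,1]][],C 0[L 1,Q 1[1,1,2,1,6],Q 1[5,4,8,4,21],Q 1[5,6,12,6,34]][],C 3[Q 2[2,9,-8,-1,0],Q 0[1,3,3,0,0]][]],
D 2[][C 0[L 1,Q 1[2,4,5,2,5]][D 8[Q 9[13,-6,2,2,4,2]][],C 2[Q 1[2,-9,-21,-21,-8,-21]][],D 4[L 2,L 1,Q 1[2,-4,-7,-7,-3,-8]][]],C 2[Q 1[6,23,-3,2,-3],Q 1[6,44,
0,5,0],Q 1[2,9,0,1,0],Q 1[5,17,0,2,0],Q 1[5,32,-2,3,-3]][C 2[Q 1[1,-4,-18,0,-2,0]][],C 3[L 2,Q 1[1,-3,-9,3,0,3]][]],C 3[L 1,Q 1[4,25,-1,3,-2],Q 1[7,27,0,4,0],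
Q 1[2,8,-1,1,-1]][C 3[L 2,Q 1[1,-1,-5,2,0,3]][],D 8[Q 1[2,-1,-5,6,1,6],Q 1[1,12,67,-7,7,-8]][],C 3[L 2,Q 1[1,-2,-9,4,0,4]][],D 4[L 1,L 2,Q 1[2,-6,-17,0,-3,
0]][]],C 1[Q 1[2,8,-4,-1,-4],Q 8[6,0,1,-3,1]][],C 3[Q 1[2,9,-5,-1,-5],Q 1[1,6,0,-1,-7]][],C 1[Q 10[8,3,1,24,1],Q 10[6,4,0,37,0]][D 8[Q 10[3,-7,-4,0,-39,0],
Q 1[2,-1,-2,7,2,7],Q 10[4,8,5,1,36,1]][],C 0[Q 10[2,-8,-5,0,-43,0]][],C 0[Q 10[2,-5,-4,0,-35,0]][],C 2[L 2,Q 10[8,-9,-5,1,-57,1]][]],C 1[Q 10[8,6,1,44,1],Q 7[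
6,1,1,-2,1],Q 10[9,6,1,41,1]][C 1[Q 10[1,8,5,1,34,1],Q 10[2,9,6,1,39,1]][],D 8[Q 1[7,-3,-1,23,6,23],Q 10[10,-23,-18,-1,-132,-1]][C 3[Q 10[2,3,-8,-6,0,-44,
0]][],C 0[Q 9[3,-39,0,-5,-6,4,-6],Q 10[3,-3,8,6,0,44,0]][]],C 3[L 2,L 1,Q 1[8,0,-5,26,7,26]][D 4[L 3,L 2][],D 4[L 3,L 2][]]]]],C 0[Q 1[6,5,44],Q 1[2,1,9],Q 1[
5,2,17]][C 2[Q 1[4,-9,-8,-72],H 2,Q 10[1,3,6,0]][],C 2[Q 1[3,-9,-7,-61],Q 10[1,2,6,0]][],C 2[Q 1[3,-16,-8,-72],Q 10[2,3,13,0],Q 1[1,-2,-1,-8],Q 10[15,23,111,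
-1]][],C 2[Q 10[1,1,5,0],Q 1[2,-8,-3,-26],Q 10[9,4,19,1],Q 10[2,3,15,0]][D 2[Q 7[1,7,1,-2,1],Q 1[5,1,-1,0,-4]][],D 8[Q 1[2,-5,25,9,81],H 2,Q 1[1,3,-17,-7,
-60]][],D 8[Q 10[3,-9,-12,-70,1],Q 1[1,-1,8,3,25],Q 1[1,4,-7,-3,-24],Q 9[8,1,1,-2,1]][]],C 1[Q 2[2,9,-1,-8],Q 0[1,3,0,3]][],C 1[Q 1[1,8,1,9],Q 2[2,5,-1,-7],
Q 0[1,2,0,2]][]]]]"

definition "cert_988886543322 =
D 2[][D 9[][D 2[Q 10[1,8,1]][C 2[Q 2[2,-8,-1,9],Q 0[1,3,0,3]][],C 3[Q 10[2,-7,-53,-7]][C 0[Q 10[1,4,-8,-61,-8]][D 3[Q 8[1,-5,4,-1,0,0],Q 1[3,-1,0,6,0,-6],Q 2[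
12,1,1,0,2,-7]][]]],D 8[Q 10[3,-4,-29,-4]][C 1[Q 9[4,14,1,-10,1],Q 9[4,22,1,-18,1]][D 3[][D 3[][D 8[Q 10[2,0,0,-5,-5,-2,-5,-2]][D 4[L 5][]]]],D 3[Q 9[1,5,12,
0,-18,0],Q 9[1,-10,-29,0,37,0]][],D 3[Q 9[1,7,25,0,-32,0],Q 9[1,-7,-26,0,31,0]][],D 3[L 2,Q 9[1,11,52,0,-63,0]][],D 3[Q 2[1,-20,0,10,-3,13]][]],C 1[Q 10[2,-5,
-7,-48,-7],Q 10[5,-7,-8,-54,-8]][],C 0[Q 10[3,4,-5,-38,-5]][D 3[Q 10[1,6,6,-6,-48,-6],Q 2[12,1,1,-3,2,-3]][]]],C 1[Q 1[9,59,8,-8],Q 1[3,5,1,-1],Q 1[9,33,5,0],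
Q 1[11,31,5,-5],Q 1[6,27,4,-7]][C 2[Q 1[3,-8,-55,-7,3],Q 10[6,2,0,38,5]][C 3[L 2,Q 1[2,6,-9,-60,-8,7]][]],D 8[Q 1[2,-9,-62,-8,9],Q 8[5,0,1,-3,0],Q 9[6,-1,1,
-7,0]][C 3[Q 1[1,2,-8,-56,-7,9]][],C 3[Q 9[2,-8,9,-1,0,0],Q 1[1,0,-8,-53,-7,4]][D 8[H 3][]],D 3[Q 10[5,-2,0,0,32,4],Q 3[5,1,0,0,1,-2],Q 8[5,33,19,4,8,9],Q 8[
5,31,14,4,9,8],Q 2[5,1,0,-6,0,-1],Q 9[3,17,-3,3,-3,2]][]],C 2[Q 1[2,-7,-35,-5,3],Q 10[15,3,1,97,13]][D 3[L 2,Q 10[1,7,1,1,31,5],Q 1[1,6,-30,-144,-20,13]][],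
D 3[L 2][],C 4[L 2,Q 1[1,0,-8,-37,-5,5]][]],D 8[Q 1[1,-14,-66,-9,2],Q 1[1,10,47,7,0],Q 8[5,0,1,-3,0]][],C 1[Q 1[3,-8,-37,-5,0],Q 10[8,2,1,49,7],Q 10[8,2,1,37,
5]][C 3[L 2,Q 1[2,7,-15,-74,-10,0]][],D 3[L 2,Q 10[1,8,2,1,41,6],Q 1[3,3,-6,-30,-4,0]][],C 1[L 2,Q 2[2,12,-2,-9,-1,-14]][],D 3[L 2][]],C 0[L 1,Q 1[2,-8,-29,
-4,9]][],C 1[Q 1[4,-16,-61,-9,0],Q 10[15,2,1,96,13],Q 10[6,1,1,22,3],Q 5[14,19,0,1,5]][C 3[L 2,Q 1[3,7,-17,-65,-9,-7],Q 9[15,1,4,2,0,3]][D 3[L 3][]],C 1[L 2,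
Q 2[1,6,-2,-6,-1,-8]][],C 2[L 2,Q 2[2,9,-2,-7,-1,-12],Q 1[2,4,-8,-30,-4,-4]][]],C 1[Q 10[9,1,1,34,5],Q 10[10,1,1,66,9],Q 1[2,-9,-25,-4,0],Q 10[9,1,1,42,6],
Q 1[3,-7,-19,-3,-2]][C 0[Q 10[2,17,2,2,75,11]][],D 3[L 2,Q 10[1,9,1,1,58,8]][],C 2[L 2,Q 2[6,24,-4,-8,-1,-28],Q 9[21,0,4,3,-2,3],Q 1[1,2,-3,-8,-1,-2]][]],C 3[
L 1,Q 1[1,6,11,2,0]][]],C 1[Q 10[5,0,20,3],Q 1[6,20,2,-5],Q 10[5,0,33,4],Q 1[5,34,4,-5],Q 10[3,0,6,1],Q 10[23,-1,112,15]][D 3[L 1,Q 10[3,43,-2,245,33],Q 1[2,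
-8,-27,-3,6],Q 2[7,0,-1,1,-8],Q 1[2,7,22,3,-3]][],C 1[Q 10[2,-9,1,-61,-8]][]],C 2[Q 1[5,-25,-3,26],Q 1[7,-20,-2,20]][]],C 0[Q 10[6,44,5],Q 10[18,91,10],Q 10[
1,9,1],Q 0[6,0,6]][D 2[Q 10[1,22,50,6],Q 1[37,5,4,0]][],D 2[Q 1[8,1,1,-1],Q 1[5,-1,1,-6],Q 10[1,7,15,2]][C 0[Q 10[2,-3,-31,-68,-8]][]],C 2[Q 10[2,-10,-46,-5],
Q 1[2,3,0,13],Q 1[3,2,0,9]][],C 2[Q 10[2,-8,-43,-5],Q 1[6,8,0,30]][],C 2[Q 10[2,-7,-45,-5],Q 1[1,2,0,5]][],C 2[Q 10[3,-8,-61,-7]][]],D 2[Q 0[1,0,1]][C 3[Q 1[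
8,-7,7,52],Q 1[3,-1,1,5],Q 1[7,-3,3,20],Q 1[7,0,4,27],Q 1[6,-4,4,27]][D 8[Q 1[1,-7,3,-6,-46],Q 8[5,0,0,-3,1],Q 9[6,-1,0,-7,1]][C 2[Q 1[1,2,-8,9,-7,-56]][],
C 2[Q 9[2,-9,9,0,2,-1],Q 1[1,0,-8,5,-7,-56]][D 8[H 3][]],D 3[Q 10[5,-2,0,4,32,0],Q 3[5,1,0,-2,1,0],Q 8[5,31,14,8,9,4],Q 8[5,33,19,9,8,4],Q 2[5,1,0,-1,0,-6],
Q 9[3,17,-3,2,-3,3]][]],C 0[Q 1[3,-8,3,-7,-55],Q 10[6,2,5,38,0]][C 3[L 2,Q 1[2,6,-9,7,-8,-60]][]],D 8[Q 1[1,-14,2,-9,-66],Q 1[1,10,0,7,47],Q 8[5,0,0,-3,1]][],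
C 0[Q 1[2,-7,3,-5,-35],Q 10[15,3,13,97,1]][D 3[L 2,Q 10[1,7,1,5,31,1],Q 1[1,6,-30,13,-20,-144]][],D 3[L 2][],C 4[L 2,Q 1[1,0,-8,5,-5,-37]][]],C 0[Q 1[3,-8,0,
-5,-37],Q 10[8,2,7,49,1],Q 10[8,2,5,37,1]][C 3[L 2,Q 1[2,7,-15,0,-10,-74]][],D 3[L 2,Q 10[1,8,2,6,41,1],Q 1[3,3,-6,0,-4,-30]][],C 1[L 2,Q 2[2,12,-2,-14,-1,
-9]][],D 3[L 2][]],C 1[L 1,Q 1[2,-8,9,-4,-29]][],C 0[Q 1[4,-16,0,-9,-61],Q 10[15,2,13,96,1],Q 10[6,1,3,22,1],Q 5[14,19,5,1,0]][C 3[L 2,Q 1[3,7,-17,-7,-9,-65],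
Q 9[15,1,4,3,0,2]][D 3[L 3][]],C 1[L 2,Q 2[1,6,-2,-8,-1,-6]][],C 2[L 2,Q 2[2,9,-2,-12,-1,-7],Q 1[2,4,-8,-4,-4,-30]][]],C 0[Q 10[9,1,5,34,1],Q 10[10,1,9,66,1],
Q 1[2,-9,0,-4,-25],Q 10[9,1,6,42,1],Q 1[3,-7,-2,-3,-19]][C 0[Q 10[2,17,2,11,75,2]][],D 3[L 2,Q 10[1,9,1,8,58,1]][],C 2[L 2,Q 2[6,24,-4,-28,-1,-8],Q 9[21,0,4,
3,-2,3],Q 1[1,2,-3,-2,-1,-8]][]],C 3[L 1,Q 1[1,6,0,2,11]][]],C 2[Q 10[9,5,45,1],Q 10[6,5,44,0],Q 10[7,2,16,1]][C 1[Q 10[2,-31,-8,-68,-3]][],C 1[Q 10[2,-14,-7,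
-62,-1],Q 1[4,5,23,0,0]][],C 1[Q 10[2,-12,-6,-52,-1],Q 1[4,5,23,0,0]][],C 1[Q 10[2,-8,-5,-43,0],Q 1[2,3,10,0,0]][],C 1[Q 10[2,-8,-5,-43,0],Q 1[3,4,15,0,0]][],
C 1[Q 10[3,-9,-7,-59,0],Q 1[1,2,5,0,0]][],C 1[Q 10[2,-7,-5,-45,0],Q 1[1,2,5,0,0]][],C 0[L 1,Q 3[1,5,-3,0,0]][],C 1[Q 10[3,-8,-7,-61,0]][]],C 1[Q 1[5,26,-3,
-25],Q 1[7,20,-2,-20]][],C 1[Q 1[2,10,-1,-9],Q 1[6,13,-2,-13]][],C 3[Q 1[2,-2,1,8],Q 1[7,-3,6,48],Q 1[7,-3,3,20],Q 1[5,0,3,20],Q 1[6,-2,2,11],Q 1[4,-5,2,19],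
Q 9[173,25,-199,1]][C 0[Q 1[2,-8,1,-7,-54]][],D 8[Q 1[1,10,0,7,47],Q 1[2,-52,5,-33,-251],Q 8[6,0,1,-2,1]][],C 1[Q 1[7,-2,22,2,-9],Q 1[1,-1,5,0,-4],Q 1[6,-2,
14,1,-9]][D 3[L 2][]],C 1[L 1,Q 1[2,-1,11,1,-3],Q 1[3,-1,9,1,-3]][D 3[L 2][],D 3[L 2][]],C 1[L 1,Q 1[5,-4,27,2,-11],Q 1[3,-2,12,1,-6]][D 3[L 2][]],C 3[L 1,
Q 1[1,6,0,2,9]][]],C 2[Q 1[7,27,2,-7],Q 1[18,91,10,0],Q 1[5,37,4,0],Q 1[8,18,1,-7],Q 1[7,24,3,1],Q 8[5,0,-3,1],Q 1[4,21,2,-4]][C 1[Q 1[1,-3,-17,-2,0],Q 10[5,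
7,0,24,1]][],C 1[Q 1[2,-8,-37,-4,0],Q 10[4,5,0,22,1]][],C 1[Q 1[2,-9,-33,-4,0],Q 10[6,7,0,36,1],Q 10[6,5,0,27,1]][],C 3[L 1,Q 1[1,7,15,2,1]][],C 0[L 1,Q 1[3,
-3,-4,2,19],Q 1[6,-8,-15,2,27],Q 1[4,1,4,3,18]][D 3[L 2][],D 3[L 2][],D 3[L 2][]]],C 2[Q 1[5,10,3,10],Q 1[2,7,2,7],Q 1[2,3,1,3],Q 0[1,1,0,1]][C 0[Q 1[3,-7,
-24,-6,-24]][D 3[L 2][]],D 3[Q 9[11,62,1,-74,1],Q 1[3,-4,-13,-4,-14]][C 2[L 2,Q 1[1,5,-6,-20,-5,-20]][],C 3[Q 1[4,6,-8,-26,-7,-26],L 2][],D 3[L 2,Q 10[3,3,2,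
0,21,0]][],D 3[L 2,Q 1[4,1,-6,-20,-5,-20],Q 9[5,19,110,1,-99,1]][],D 3[L 2][],D 8[Q 2[4,24,2,-7,2,-7],Q 9[6,1,-3,1,2,1]][],D 3[L 2,Q 1[3,-2,-4,-13,-4,-13]][],
D 3[L 2,Q 1[2,0,-2,-7,-2,-7]][]],C 3[L 1,Q 1[1,8,20,6,20]][],C 2[L 1][C 2[Q 9[7,37,-3,6,0,6],Q 9[2,6,0,1,0,1]][],D 8[Q 1[4,4,30,69,20,69],Q 9[11,-3,3,1,-1,
1]][C 3[Q 1[1,1,1,4,8,3,9]][],C 4[Q 1[1,1,1,6,12,4,12]][]],C 1[L 2,Q 1[1,1,8,17,5,18]][],C 0[L 2,Q 9[11,3,-2,2,-1,2]][],D 3[L 2][],D 3[L 2][],D 3[L 2][]],D 3[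
L 1][C 0[L 2,Q 1[1,-2,5,9,3,9]][],D 3[L 2][],D 3[L 2][],D 3[L 2][]],C 2[L 1,Q 1[3,17,22,7,22]][]]],D 2[][C 1[Q 2[2,9,-1,-8],Q 0[1,3,0,3]][],C 1[Q 2[5,18,-3,
-21],Q 10[6,5,44,0]][],C 2[Q 10[23,15,112,-1],Q 1[3,-3,1,10],Q 1[5,-5,4,34],Q 10[3,1,6,0],Q 10[4,4,28,0],Q 10[9,5,33,0]][D 3[L 1,Q 10[3,43,33,245,-2],Q 1[2,
-9,6,-3,-29],Q 2[7,0,-8,1,-1],Q 1[2,7,-3,3,22]][],C 1[Q 10[2,-9,-8,-61,1]][]],C 2[Q 1[5,-6,3,24],Q 10[6,5,44,0],Q 1[8,0,7,60],Q 1[6,0,4,33],Q 1[2,0,1,9]][],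
C 3[Q 1[6,-6,2,23],Q 1[18,0,10,91],Q 1[6,0,5,44],Q 1[9,-8,1,19],Q 1[8,1,3,27],Q 8[7,1,-4,0],Q 1[7,-6,3,35]][C 0[Q 1[1,-3,0,-2,-17],Q 10[5,7,1,24,0]][],C 0[
Q 1[2,-8,0,-4,-37],Q 10[4,5,1,22,0]][],C 0[Q 1[2,-9,0,-4,-33],Q 10[6,7,1,36,0],Q 10[6,5,1,27,0]][],C 3[L 1,Q 1[1,8,0,2,17]][],C 1[L 1,Q 1[4,1,18,3,4],Q 1[6,
-8,27,2,-15],Q 1[5,-5,33,4,-6]][D 3[L 2][],D 3[L 2][],D 3[L 2][]]],C 2[Q 1[2,-1,1,10],Q 1[5,0,4,37],Q 2[2,7,3,17],Q 1[3,-1,1,9],Q 1[4,-1,1,9]][C 0[Q 1[2,-7,1,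
-4,-38],Q 10[2,3,0,10,0]][],C 0[Q 1[2,-5,5,-2,-21],Q 10[5,6,0,28,0]][],C 0[Q 1[1,-2,5,0,-5],L 1,Q 10[2,2,0,9,0],Q 10[5,6,0,33,0]][],C 0[L 1,Q 10[4,3,0,19,0],
Q 1[1,-2,4,0,-4],Q 10[6,5,0,35,0],Q 2[2,0,17,3,7]][]],C 2[Q 1[4,8,2,9],Q 1[5,8,2,9],Q 1[5,18,4,19],Q 1[5,13,3,13]][C 0[Q 1[4,-8,-32,-7,-32]][],C 0[Q 1[1,-3,
-9,-2,-9],Q 10[2,3,0,10,0]][],C 0[Q 1[1,-4,-9,-2,-9],Q 10[4,5,0,23,0],Q 10[1,1,0,4,0]][],D 3[L 1,Q 10[5,6,0,33,0]][D 3[L 2][]],D 3[L 1][],D 3[L 1,Q 10[1,1,0,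
6,0]][]]]]]"

definition "cert_998866643322 =
D 2[][D 9[][D 2[Q 10[1,8,1]][D 9[Q 1[1,7,1,8],Q 10[9,1,0,1]][],C 3[Q 10[3,-9,-68,-9]][C 1[Q 10[1,5,-7,-53,-7],Q 1[6,5,44,0,0],Q 8[5,-3,0,0,1]][],C 0[Q 10[1,5,
-7,-53,-7],Q 1[6,5,0,0,44],Q 8[5,-3,1,0,0]][],D 3[Q 1[11,3,2,1,24],Q 1[11,3,24,1,2],Q 2[7,0,-8,1,-1],Q 2[7,0,-1,1,-8]][D 8[Q 9[6,1,9,5,37,5],Q 9[2,0,-4,-1,
-11,-1],Q 9[5,1,-1,0,-6,0]][D 3[L 3,Q 9[6,34,0,0,1,-33,1]][]]],C 0[Q 10[1,4,-8,-61,-8],Q 1[5,6,0,0,44]][D 3[L 3,Q 1[2,-8,-9,-4,0,-64]][]]],D 9[][C 0[Q 10[3,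
-19,-5,-19,-5],Q 4[5,1,-1,1,-1]][C 2[Q 10[2,2,-15,-4,-15,-4]][D 4[H 3,Q 10[4,-34,-34,194,51,194,51]][]],C 2[Q 10[1,1,-7,-2,-7,-2]][]],D 3[Q 10[1,14,-9,-67,
-9],Q 10[2,-48,35,267,35],Q 2[61,1,-33,9,-33]][],C 1[Q 9[3,15,6,43,6],Q 9[2,7,3,22,3]][D 8[H 3,Q 1[7,0,6,26,0,26]][]]],D 9[Q 10[8,1,0,1],Q 1[1,7,1,-1],Q 10[6,
1,-7,-1]][D 8[Q 1[1,-6,-47,-6,12],Q 1[2,33,249,33,-42],Q 9[61,-33,9,-33,1]][],C 0[Q 1[1,-6,-46,-6,7],Q 3[5,0,0,1,-3],Q 10[6,44,0,0,5]][],C 0[Q 1[8,7,-7,0,55],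
Q 1[3,2,-2,0,15],Q 1[10,4,-3,1,25]][C 2[Q 1[6,-8,-7,23,3,-58],Q 1[6,0,1,8,2,0]][],C 3[Q 1[2,-5,-3,8,1,-24]][],C 3[Q 1[8,-18,-11,32,3,-90],Q 1[6,0,1,8,2,
0]][]],C 2[Q 10[4,27,3,-4,0],Q 10[2,8,1,-1,0],Q 1[7,0,21,3,-2],Q 1[3,0,6,1,0],Q 1[7,-1,46,6,-6],Q 1[9,-1,43,6,-2]][],C 0[Q 1[4,3,-4,0,27],Q 10[7,46,6,-6,-1],
Q 1[14,5,-3,1,44],Q 10[10,40,6,0,0],Q 2[9,7,22,3,66]][]],C 1[Q 1[2,9,1,-2],Q 1[2,17,2,-2],Q 10[5,0,20,3],Q 10[5,0,30,4],Q 10[3,0,5,1],Q 1[3,9,1,-3]][D 9[Q 10[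
3,-8,1,-47,-6]][],D 9[Q 10[5,-8,1,-55,-7]][]],C 2[Q 1[1,-8,-1,8],Q 1[4,-11,-1,12]][]],D 2[Q 0[1,0,1],Q 10[1,9,1]][D 9[Q 1[1,8,1,8],Q 9[19,2,6,3]][],C 3[Q 10[
6,0,44,5],Q 10[2,0,9,1],Q 10[7,1,15,2],Q 10[7,1,7,1]][D 9[Q 1[6,7,-7,-1,45],Q 1[6,-1,46,6,-2],Q 10[3,30,3,66,8],Q 10[8,0,1,0,1]][],C 0[Q 10[3,-19,-1,-82,-9],
Q 1[5,7,-6,-1,33]][],D 9[Q 10[6,-9,0,-39,-4],Q 1[5,7,-4,-1,34],Q 1[2,-1,14,2,-2]][],C 0[Q 10[4,-12,0,-79,-9],Q 1[2,4,0,0,12]][],C 0[Q 10[3,-9,0,-61,-7],Q 1[2,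
4,0,0,12]][],D 9[Q 1[1,3,-2,0,5],Q 3[1,5,0,0,-3]][],C 0[L 2,Q 10[4,-9,0,-69,-8],Q 1[1,3,0,0,5]][]],C 2[Q 1[1,-6,-1,5],Q 1[6,-13,-2,13]][],C 1[Q 1[1,-7,-1,6],
Q 1[3,-11,-1,9]][]],D 9[Q 1[1,1,8]][D 2[][D 3[Q 1[1,-4,-1,-1,-4]][C 2[Q 1[3,5,-22,-6,-6,-22]][D 8[Q 1[1,5,5,-27,-7,-7,-27]][]],D 8[Q 2[4,22,-9,1,1,-9]][C 1[
L 3,Q 2[4,0,22,-9,1,1,-9],Q 2[7,1,25,-8,1,1,-17]][]],D 3[L 2,Q 1[1,0,-4,-1,-1,-4],Q 1[7,-9,-37,-11,-11,-37]][]],C 2[Q 2[1,6,2,2,16],Q 2[1,3,1,1,7],Q 4[5,-2,1,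
1,0]][D 3[L 2,Q 1[4,6,11,0,0,-4]][]],D 8[Q 1[1,12,-7,-7,-54],Q 1[2,-48,35,35,267],Q 9[61,1,-33,-33,9]][]],C 2[Q 1[1,-3,-3,-23]][C 3[Q 1[2,5,-7,-7,-57],Q 4[4,
-3,0,1,0],Q 1[8,4,-1,0,-7]][D 8[H 2,Q 10[2,-8,-9,-63,-5,0]][]],C 0[Q 1[1,7,-6,-6,-46],Q 3[5,-3,1,0,0],Q 10[6,5,0,44,0]][],D 3[Q 2[2,-3,-1,-1,-10],Q 3[5,-3,1,
0,0],Q 2[5,9,5,4,34],Q 2[5,9,4,5,34],Q 3[5,-3,0,1,0]][D 8[Q 2[6,34,0,1,1,-33],Q 8[5,1,0,-2,1,1],Q 8[5,1,0,1,-2,1]][D 3[Q 2[5,1,0,7,5,4,31],Q 2[5,1,0,7,4,5,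
31],Q 2[5,1,0,-1,0,0,-6]][]]],C 3[Q 1[1,7,-6,-6,-46],Q 3[5,-3,0,1,0],Q 10[6,5,44,0,0]][]],D 2[Q 10[1,8,7,1],Q 1[9,1,1,0]][],C 2[Q 10[8,63,-9,7],Q 1[2,0,1,6],
Q 10[3,10,-3,1],Q 1[23,-1,15,111],Q 1[1,0,1,7],Q 1[3,0,1,7]][D 2[Q 1[5,-8,1,-7,-55]][]],C 2[Q 10[3,-17,19,-2],Q 10[4,-9,9,-1]][],D 2[Q 1[8,1,1,0],Q 10[1,7,-1,
1],Q 1[6,1,-1,-7]][D 3[Q 10[1,-9,-67,14,-9],Q 10[2,35,267,-48,35],Q 2[61,-33,9,1,-33]][],C 2[Q 10[1,-7,-53,5,-7],Q 1[6,44,0,5,0],Q 8[5,0,0,-3,1]][],C 1[Q 10[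
5,4,-3,35,0],Q 1[8,54,7,-1,-7],Q 1[6,28,4,-1,-4],Q 1[4,12,2,0,0],Q 1[3,5,1,0,0],Q 10[2,1,-3,9,0]][],C 0[Q 1[10,-2,1,4,25],Q 1[3,-2,0,2,13],Q 1[9,-8,0,8,59]][
C 1[Q 1[6,-8,23,3,-7,-58],Q 1[6,0,8,2,1,0]][],C 1[Q 1[8,-18,32,3,-11,-90],Q 1[6,0,8,2,1,0]][],C 1[Q 1[2,-5,8,1,-3,-24]][]],C 3[Q 10[6,-1,39,-5,5],Q 1[4,27,3,
0,-4],Q 10[5,0,20,0,3],Q 10[3,0,5,0,1],Q 1[11,35,4,1,-1]][]]],D 9[Q 0[1,1,0],Q 1[1,1,9]][D 2[Q 1[9,1,1,0],Q 1[8,1,1,8]][],C 2[Q 10[6,44,0,5],Q 10[2,9,0,1],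
Q 10[1,9,0,1],Q 1[6,0,5,44],Q 10[2,7,-1,1]][],C 2[Q 10[3,-15,17,-2],Q 10[6,-13,13,-2]][],C 3[Q 1[8,1,3,24],Q 1[6,0,5,44],Q 1[3,0,2,17],Q 1[7,1,1,7],Q 1[7,1,2,
16]][D 2[Q 8[1,5,0,-3,0],Q 10[1,3,-2,5,0]][],C 0[H 2,Q 1[5,-9,0,-8,-68],Q 10[1,3,0,5,0]][],C 0[Q 1[3,-11,0,-7,-60],Q 10[4,7,0,27,0]][],D 2[Q 1[2,-2,0,-1,-11],
Q 10[5,9,0,33,0],Q 10[2,-1,14,-2,2]][],C 0[Q 1[2,-16,-1,-6,-53],Q 10[4,5,-3,30,-1],Q 10[2,2,0,9,0]][],D 2[Q 1[5,-17,-1,-6,-55],Q 10[2,-1,14,-2,2]][],D 2[Q 10[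
5,6,-6,38,-1],Q 10[4,-1,33,-8,4],Q 1[4,32,3,8,70],Q 1[8,0,1,1,0]][]]]]]"

definition "cert_998776644222 =
D 2[][D 9[][D 2[Q 10[1,8,1]][D 9[Q 1[1,7,1,8],Q 10[9,1,0,1]][],C 3[Q 10[3,-7,-52,-7]][C 1[Q 10[1,6,-7,-54,-7],Q 1[6,5,44,0,0],Q 8[5,-3,0,0,1]][],C 0[Q 10[1,6,
-7,-54,-7],Q 1[6,5,0,0,44],Q 8[5,-3,1,0,0]][],D 2[Q 1[7,1,0,1,7],Q 1[7,1,7,1,0],Q 1[8,1,0,1,0]][],C 0[Q 10[2,5,-7,-57,-7],Q 1[5,6,0,0,44],Q 7[4,-3,1,0,0]][]],
D 2[][D 9[Q 1[1,8,0,1,0],Q 1[1,-6,3,-1,4]][],D 9[Q 10[9,1,-5,-38,-5],Q 9[6,1,2,14,2]][D 8[Q 1[1,-9,-68,6,-9,7],Q 9[12,-3,2,1,-3,1]][]]],D 9[Q 10[8,1,0,1],Q 1[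
1,7,1,-1],Q 10[6,1,-7,-1]][D 8[Q 1[1,-6,-47,-6,12],Q 1[2,33,249,33,-42],Q 9[61,-33,9,-33,1]][],C 0[Q 1[1,-6,-46,-6,7],Q 10[1,9,0,0,1]][],D 2[Q 10[5,-9,-1,40,
5],Q 10[5,40,5,-9,-1],Q 1[8,1,0,1,0]][D 8[Q 1[7,0,6,-6,0,46],Q 1[2,-5,-1,14,2,-4],Q 9[7,1,0,1,-1,1],Q 8[5,0,-3,0,0,1]][],D 8[Q 1[7,0,0,46,6,-6],Q 1[2,-5,2,-4,
-1,14],Q 9[7,1,-1,1,0,1],Q 8[5,0,0,1,-3,0]][]],D 2[Q 10[7,-9,-1,55,7],Q 0[1,0,1,0,0],Q 1[8,1,0,1,0]][],C 0[Q 1[4,3,-4,0,27],Q 1[11,4,-1,1,35],Q 10[7,26,4,-4,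
-1],Q 10[4,28,4,-7,-1],Q 10[3,5,1,0,0],Q 10[4,12,2,0,0]][]],C 1[Q 10[2,0,6,1],Q 1[8,63,7,-9],Q 1[2,9,1,-2],Q 10[3,0,5,1],Q 10[1,0,8,1],Q 10[5,0,20,3],Q 10[4,
0,20,3]][D 9[Q 10[3,-8,1,-47,-6]][],D 9[Q 1[1,7,7,1,0],Q 2[1,-5,7,1,5]][]],C 2[Q 1[1,-8,-1,8],Q 1[2,-8,-1,7],Q 1[1,-1,0,1]][]],D 2[Q 0[1,0,1],Q 10[1,9,1]][
D 9[Q 1[1,8,1,8],Q 9[19,2,6,3]][],D 9[Q 10[8,1,0,1],Q 10[7,1,7,1],Q 10[6,1,-7,-1]][C 0[Q 1[1,-6,-46,-6,7],Q 10[1,0,0,9,1]][],D 2[Q 1[7,4,24,3,3],Q 1[7,3,24,4,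
3]][D 8[Q 8[14,2,3,2,4,3],Q 8[5,1,-2,1,1,0],Q 8[6,1,0,1,-3,0]][]],C 1[Q 2[1,2,16,2,6],Q 2[1,1,7,1,3],Q 4[5,1,0,1,-2]][],D 2[Q 10[7,55,7,-9,-1],Q 0[1,0,0,0,1],
Q 1[8,1,0,1,0]][],D 2[Q 0[1,0,0,0,1],Q 0[1,0,1,0,0],Q 1[8,1,0,1,0]][]],C 2[Q 1[1,-6,-1,5],Q 1[2,-8,-1,8],Q 0[1,0,0,1],Q 10[1,0,9,1]][],C 1[Q 1[1,-7,-1,6],Q 1[
2,-7,-1,6],Q 1[1,-1,0,1]][]],D 9[Q 1[1,1,8]][D 2[][D 8[][D 2[Q 2[5,1,7,2,2,7],Q 1[6,1,-15,-4,-4,-16],Q 1[9,-1,-26,-7,-7,-26]][C 2[Q 2[1,6,0,8,2,2,8],Q 2[1,3,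
0,3,1,1,4]][]],D 2[Q 1[9,1,-19,-5,-5,-19],Q 2[5,1,7,2,2,8]][C 0[Q 6[8,2,0,2,-1,-1,2],Q 1[1,-5,0,-5,-2,-2,-5]][D 4[L 2,Q 8[2,2,4,25,4,5,6,4],Q 1[6,-6,33,1,33,
14,14,33]][]]]],C 2[Q 2[1,6,2,2,16],Q 2[1,3,1,1,7],Q 4[5,-2,1,1,0]][],D 8[Q 1[1,12,-7,-7,-54],Q 1[2,-48,35,35,267],Q 9[61,1,-33,-33,9]][]],C 2[Q 1[1,-3,-3,
-23]][C 0[Q 1[1,7,-6,-6,-46],Q 10[1,1,0,9,0]][],D 2[Q 1[7,3,4,3,24],Q 1[7,3,3,4,24]][D 8[Q 8[5,1,0,-2,1,1],Q 8[14,2,3,3,4,2],Q 8[6,1,0,0,-3,1]][]],C 3[Q 1[1,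
7,-6,-6,-46],Q 10[1,1,9,0,0]][]],D 2[Q 10[1,8,7,1],Q 1[9,1,1,0]][],D 2[Q 1[8,1,1,0],Q 0[1,0,0,1],Q 1[7,1,-1,-6]][D 2[Q 0[1,0,0,0,1],Q 0[1,1,0,0,0],Q 1[8,0,1,
1,0]][],D 2[Q 10[7,7,-9,55,-1],Q 0[1,0,0,0,1],Q 1[8,0,1,1,0]][]],C 2[Q 10[6,-37,36,-4],Q 10[4,-12,11,-1]][],D 2[Q 1[8,1,1,0],Q 10[1,7,-1,1],Q 1[6,1,-1,-7]][
D 2[Q 10[1,-6,-45,10,-6],Q 1[8,0,1,1,0]][],C 2[Q 10[1,-7,-54,6,-7],Q 1[6,44,0,5,0],Q 8[5,0,0,-3,1]][],D 2[Q 10[7,-1,55,-9,7],Q 0[1,1,0,0,0],Q 1[8,0,1,1,0]][],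
D 2[Q 10[5,5,-9,38,-1],Q 10[5,-1,40,-9,5],Q 1[8,0,1,1,0]][D 8[Q 1[7,0,46,6,0,-6],Q 1[3,-4,-6,-1,3,21],Q 8[5,0,1,-3,0,0],Q 9[7,1,1,0,-1,1]][],D 8[Q 1[7,0,-6,0,
6,46],Q 1[2,-5,14,2,-1,-4],Q 9[7,1,1,-1,0,1],Q 8[5,0,0,0,-3,1]][]],C 3[Q 1[4,27,3,0,-4],Q 1[11,35,4,1,-1],Q 10[8,-1,29,-3,4],Q 10[4,-1,28,-7,4],Q 10[3,0,5,0,
1],Q 10[4,0,12,0,2]][]]],C 0[Q 1[6,5,44],Q 0[1,1,0],Q 1[1,1,9],Q 1[6,4,37],Q 1[5,2,17]][C 2[Q 1[3,-7,-6,-55],Q 10[1,3,5,0]][],C 2[Q 1[3,-9,-7,-61],Q 10[1,2,6,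
0]][],C 2[Q 1[3,-11,-7,-63],Q 10[4,7,27,0]][],C 2[Q 1[1,-5,-2,-17],Q 10[9,6,31,0],Q 10[1,1,6,0],Q 8[9,1,-3,1],Q 10[4,5,26,0]][D 9[H 2,Q 1[1,-1,8,3,25]][],D 9[
Q 10[3,-7,-9,-54,1]][]],D 9[Q 1[1,8,1,7],Q 10[9,1,0,1]][],D 9[Q 1[1,8,1,8],Q 9[19,3,6,2]][]]]]"

definition "cert_998866554222 =
D 2[][D 9[][D 2[Q 10[1,8,1]][D 9[Q 1[1,7,1,8],Q 10[9,1,0,1]][],C 3[Q 10[3,-7,-52,-7]][C 1[Q 10[1,5,-7,-53,-7],Q 1[6,5,44,0,0],Q 8[5,-3,0,0,1]][],C 0[Q 10[1,5,
-7,-53,-7],Q 1[6,5,0,0,44],Q 8[5,-3,1,0,0]][],D 2[Q 1[7,1,0,1,7],Q 1[7,1,7,1,0],Q 1[8,1,0,1,0]][],D 2[L 2,Q 1[6,-1,-7,1,0],Q 1[6,-1,0,1,-7]][D 9[Q 2[2,17,3,8,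
2,9]][]]],D 2[][D 9[Q 1[1,8,0,1,0],Q 1[1,-6,3,-1,4]][],D 9[Q 10[9,1,-5,-38,-5],Q 9[6,1,2,14,2]][D 8[Q 1[1,-9,-68,6,-9,7],Q 9[12,-3,2,1,-3,1]][]]],D 9[Q 10[8,
1,0,1],Q 1[1,7,1,-1],Q 10[6,1,-7,-1]][D 8[Q 1[1,-6,-47,-6,12],Q 1[2,33,249,33,-42],Q 9[61,-33,9,-33,1]][],C 0[Q 1[1,-6,-46,-6,7],Q 10[1,9,0,0,1]][],D 2[Q 10[
5,-9,-1,40,5],Q 10[5,40,5,-9,-1],Q 1[8,1,0,1,0]][D 8[Q 1[7,0,6,-6,0,46],Q 1[2,-5,-1,14,2,-4],Q 9[7,1,0,1,-1,1],Q 8[5,0,-3,0,0,1]][],D 8[Q 1[7,0,0,46,6,-6],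
Q 1[2,-5,2,-4,-1,14],Q 9[7,1,-1,1,0,1],Q 8[5,0,0,1,-3,0]][]],D 2[Q 10[7,-9,-1,55,7],Q 0[1,0,1,0,0],Q 1[8,1,0,1,0]][],C 0[Q 1[4,2,-5,0,18],Q 10[13,58,8,-6,-1],
Q 1[6,6,-4,0,49],Q 10[7,38,5,-4,-1],Q 1[10,1,0,1,8],Q 10[3,6,1,0,0]][]],C 1[Q 1[2,9,1,-2],Q 10[23,-1,111,15],Q 1[2,17,2,-2],Q 10[3,0,5,1],Q 10[1,0,8,1],Q 10[
5,0,20,3]][D 9[Q 10[3,-8,1,-47,-6]][],D 9[Q 1[1,7,7,1,0],Q 2[1,-5,7,1,5]][]],C 2[Q 1[2,-9,-1,9],Q 2[8,7,2,-7],Q 1[1,-7,-1,7]][]],D 2[Q 0[1,0,1],Q 10[1,9,1]][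
D 9[Q 1[1,8,1,8],Q 9[19,2,6,3]][],D 9[Q 10[8,1,0,1],Q 10[7,1,7,1],Q 10[6,1,-7,-1]][C 0[Q 1[1,-6,-46,-6,7],Q 10[1,0,0,9,1]][],D 2[Q 1[7,4,24,3,3],Q 1[7,3,24,4,
3]][D 8[Q 8[14,2,3,2,4,3],Q 8[5,1,-2,1,1,0],Q 8[6,1,0,1,-3,0]][]],C 1[Q 2[1,2,16,2,6],Q 2[3,4,29,4,9],Q 4[5,1,0,1,-2]][],D 2[Q 10[7,55,7,-9,-1],Q 0[1,0,0,0,
1],Q 1[8,1,0,1,0]][],D 2[Q 0[1,0,0,0,1],Q 0[1,0,1,0,0],Q 1[8,1,0,1,0]][]],C 2[Q 1[2,-7,-1,7],Q 1[1,-5,-1,6],Q 0[6,0,0,6],Q 10[8,0,69,8]][],C 1[Q 1[1,-7,-1,6],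
Q 1[2,-8,-1,8],Q 1[1,-1,0,1]][]],D 9[Q 1[1,1,8]][D 2[][D 2[][D 8[Q 1[1,11,-26,-7,-7,-27],Q 1[1,-11,33,9,9,33]][],C 1[L 2,Q 2[4,22,23,6,6,23]][],D 8[][D 8[][
D 4[Q 1[1,0,0,-5,-5,-2,-2,-5]][D 5[L 2,Q 6[9,4,1,2,3,3,1,1,3]][],C 0[Q 8[2,1,6,6,2,2,3,3,2]][]]]]],C 2[Q 2[1,6,2,2,16],Q 2[3,9,4,4,29],Q 4[5,-2,1,1,0]][],D 8[
Q 1[1,12,-7,-7,-54],Q 1[2,-48,35,35,267],Q 9[61,1,-33,-33,9]][]],C 2[Q 1[1,-3,-3,-23]][C 0[Q 1[1,7,-6,-6,-46],Q 10[1,1,0,9,0]][],D 2[Q 1[7,3,4,3,24],Q 1[7,3,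
3,4,24]][D 8[Q 8[5,1,0,-2,1,1],Q 8[14,2,3,3,4,2],Q 8[6,1,0,0,-3,1]][]],C 3[Q 1[1,7,-6,-6,-46],Q 10[1,1,9,0,0]][]],D 2[Q 10[1,8,7,1],Q 1[9,1,1,0]][],C 2[Q 1[5,
0,3,20],Q 10[3,17,-3,2],Q 1[1,0,1,7],Q 1[2,0,1,6],Q 0[1,0,0,1],Q 10[3,6,-2,1],Q 1[23,-1,15,111]][D 2[Q 1[5,-8,1,-7,-55]][]],C 2[Q 10[3,-19,19,-2],Q 10[4,-9,9,
-1]][],D 2[Q 1[8,1,1,0],Q 10[1,7,-1,1],Q 1[6,1,-1,-7]][D 2[Q 10[1,-6,-45,10,-6],Q 1[8,0,1,1,0]][],C 2[Q 10[1,-7,-53,5,-7],Q 1[6,44,0,5,0],Q 8[5,0,0,-3,1]][],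
D 2[Q 10[7,-1,55,-9,7],Q 0[1,1,0,0,0],Q 1[8,0,1,1,0]][],D 2[Q 10[5,5,-9,38,-1],Q 10[5,-1,40,-9,5],Q 1[8,0,1,1,0]][D 8[Q 1[7,0,46,6,0,-6],Q 1[3,-4,-6,-1,3,21],
Q 8[5,0,1,-3,0,0],Q 9[7,1,1,0,-1,1]][],D 8[Q 1[7,0,-6,0,6,46],Q 1[2,-5,14,2,-1,-4],Q 9[7,1,1,-1,0,1],Q 8[5,0,0,0,-3,1]][]],C 3[Q 1[2,9,1,0,-3],Q 10[10,-1,44,
-5,6],Q 1[4,32,4,0,-3],Q 10[7,-1,40,-4,5],Q 10[3,0,5,0,1],Q 1[7,8,1,1,0]][]]],C 0[Q 1[18,10,91],Q 0[1,1,0],Q 1[1,1,9],Q 1[6,5,44],Q 1[5,2,17]][C 2[Q 1[3,-7,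
-6,-55],H 2,Q 10[1,3,6,0]][],C 2[Q 1[4,-14,-9,-81],Q 10[4,7,28,0],Q 10[1,1,4,0]][],C 2[Q 1[1,-4,-2,-18],Q 10[2,2,9,0],Q 10[15,23,111,-1],Q 8[5,0,-3,1]][],D 9[
Q 10[8,1,-1,1],Q 10[5,-1,-6,1]][C 0[Q 1[2,-1,-16,-6,-53],Q 10[3,-6,4,23,-1],Q 10[2,0,2,9,0]][],D 2[Q 1[5,-1,-17,-6,-55],Q 10[2,14,-1,-2,2]][]],D 9[Q 1[1,8,1,
7],Q 10[9,1,0,1]][],D 9[Q 1[1,8,1,8],Q 9[19,3,6,2]][]]]]"

definition "cert_988876653222 =
D 2[][D 9[][C 1[Q 10[5,20,3],Q 10[2,15,2],Q 10[3,5,1],Q 10[2,6,1]][D 2[Q 8[1,5,-3,0],Q 1[8,1,1,-1]][],D 2[Q 10[2,20,56,9],Q 1[17,3,2,-3]][],D 2[Q 1[9,2,1,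
-2]][D 2[Q 10[1,1,9,31,5],Q 1[9,0,2,1,-2]][],D 2[Q 10[1,1,7,24,4],Q 1[9,0,2,1,-2]][],D 2[Q 10[1,1,7,24,4],Q 1[9,0,2,1,-2]][]],C 3[Q 10[2,-9,-43,-6]][],D 2[
Q 1[8,2,1,-1]][C 1[Q 1[5,30,0,4,0]][],D 2[Q 1[8,0,2,1,-1]][D 8[Q 10[9,-4,-3,-44,-205,-29],Q 1[4,-3,25,0,3,0],Q 9[13,2,2,0,0,2],Q 1[3,21,0,-1,3,0]][],C 0[Q 10[
1,1,1,8,34,5],Q 10[2,1,1,9,39,6],Q 5[7,0,-1,-9,2,0]][],C 0[Q 10[2,2,2,14,61,9],Q 5[7,0,-1,-9,2,0]][],C 0[Q 10[1,1,1,9,41,6],Q 10[2,1,1,8,34,5],Q 5[7,0,-1,-9,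
2,0]][]],D 2[Q 10[1,1,9,41,6],Q 0[1,1,0,0,0],Q 1[8,0,2,1,-1]][D 8[Q 10[9,-3,-4,-44,-205,-29],Q 1[5,32,-3,0,4,0],Q 9[13,2,2,0,0,2],Q 1[3,0,21,-1,3,0]][],C 1[
Q 10[2,2,2,14,61,9]][]]],C 3[Q 10[3,-8,-52,-7]][D 8[H 2][]],D 2[Q 2[5,-5,1,5],Q 1[6,3,1,-2]][C 1[Q 1[4,20,0,3,0],Q 1[1,7,0,1,0]][],D 2[Q 0[1,1,0,0,0],Q 1[6,0,
3,1,-2],Q 2[4,1,-5,1,6]][D 8[Q 1[2,7,7,-1,2,-2],Q 10[2,0,0,-3,-21,-3],Q 2[1,0,-1,5,0,-6]][C 1[Q 10[3,-5,0,0,-7,-43,-6]][],C 0[Q 10[3,4,0,0,-9,-59,-8]][],C 3[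
L 3,Q 1[5,-1,16,16,-2,4,-7],Q 9[6,-6,-1,-1,1,0,1]][]],C 3[Q 2[5,-7,-7,19,-1,-23],L 2,Q 2[6,-8,-2,18,-1,-18],Q 2[6,-2,-8,18,-1,-18]][],C 3[Q 1[4,-19,0,2,-2,
19]][]]],C 3[Q 10[2,-7,-53,-7]][D 2[Q 10[1,2,-8,-60,-8],Q 1[7,1,0,1,0],Q 1[6,-1,-7,1,0],Q 1[6,-1,0,1,-7]][D 8[Q 1[3,22,-2,-9,3,-9],Q 10[5,1,7,-7,-58,-7],Q 9[
7,1,0,1,-1,1]][]]],D 8[Q 10[3,-4,-29,-4]][D 2[Q 9[4,26,1,-22,1],Q 1[31,5,-3,4,-3]][],C 1[Q 10[5,-7,-9,-63,-9]][],C 0[Q 10[3,4,-5,-38,-5]][D 2[Q 10[1,7,7,-8,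
-60,-8]][]]]],C 0[Q 10[18,91,10],Q 0[1,0,1],Q 10[1,9,1],Q 10[5,17,2],Q 10[6,44,5]][D 2[Q 10[1,22,50,6],Q 1[37,5,4,0]][],D 2[Q 1[8,1,1,-1],Q 1[5,-1,1,-6],Q 10[
1,7,15,2]][D 2[Q 8[1,1,6,-3,0],Q 1[8,0,1,1,-1]][]],C 2[Q 1[4,3,0,15],Q 10[1,-5,-17,-2],Q 1[5,6,0,33],Q 1[7,3,1,12]][D 2[Q 10[1,-4,23,78,9],Q 1[8,0,1,1,
-1]][]],C 2[Q 10[2,-10,-44,-5],Q 1[2,2,0,9],Q 1[2,3,0,13]][],C 2[Q 10[2,-8,-45,-5],Q 1[2,3,0,10]][],C 2[Q 10[3,-6,-45,-5]][]],D 2[Q 0[1,0,1]][D 2[Q 10[1,1,8,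
0],Q 0[1,0,0,1]][C 1[Q 10[7,1,4,25,1],Q 10[10,1,9,66,1],Q 10[9,1,6,42,1],Q 2[4,-3,-4,-1,-3]][C 0[Q 10[1,9,1,6,40,1],Q 10[2,9,1,6,39,1],Q 5[7,-9,0,0,2,-1]][],
D 8[Q 1[2,-1,7,-2,2,7],Q 10[2,-3,0,-3,-21,0],Q 2[1,5,0,-6,0,-1]][C 0[L 3,Q 1[2,0,-1,7,-2,2,7],Q 10[1,-1,2,0,2,13,0]][],C 0[L 3,Q 1[5,-1,-2,16,-7,4,16],Q 9[6,
-6,1,-1,1,0,-1]][],C 1[Q 10[3,-5,-7,0,-6,-43,0]][]],C 3[Q 10[1,-4,0,-4,-29,0]][]],C 1[Q 10[8,0,5,36,1],Q 1[3,17,-3,2,0],Q 10[1,0,1,7,0],Q 10[7,0,3,17,1],Q 1[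
4,9,-1,1,-1]][C 3[Q 10[2,-9,1,-8,-61,0]][]],C 2[Q 1[2,-9,11,-1,0],Q 1[4,-9,9,-1,0]][],C 0[Q 1[4,-4,-3,3,24],Q 1[4,-1,-1,2,15],Q 1[5,0,-4,4,27],Q 1[3,-1,0,1,
6],Q 1[8,0,-4,3,14],Q 1[7,-7,0,3,25],Q 1[8,-9,-1,4,39]][D 3[L 2,Q 10[8,1,1,7,50,1],Q 2[5,0,-5,-5,-1,0],Q 1[2,-5,2,2,-3,-24]][],D 3[L 2][],C 0[L 2,Q 1[1,-1,5,
0,0,-4]][],D 3[L 2,L 0,Q 10[9,1,1,8,57,1],Q 1[1,-2,1,1,-1,-8],Q 2[4,0,-6,-4,-1,0]][],C 0[L 2,Q 1[2,-4,11,0,0,-7]][]],C 2[Q 2[2,-8,9,-1,0],L 1][],C 2[Q 1[2,11,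
0,-1,-9],L 1][],D 8[Q 10[1,-1,-1,-8,0],Q 9[12,1,1,-6,2],Q 1[6,-3,-3,5,38]][D 8[Q 1[1,-4,3,3,-3,-25],Q 10[4,-5,-6,-6,-41,0],Q 9[12,0,1,1,-6,2]][],D 8[Q 10[3,5,
-5,-5,-38,1],Q 9[6,5,2,2,8,1],Q 9[12,0,1,1,-6,2]][],D 8[Q 10[5,5,-7,-7,-53,1],Q 1[5,0,-2,-4,4,31],Q 9[12,0,1,1,-6,2],Q 10[5,-4,6,6,41,0]][]],C 2[Q 10[1,-3,-3,
-22,0]][D 8[Q 1[2,-1,-3,-5,2,15],Q 10[1,3,-7,-7,-54,0],Q 9[7,0,1,1,-1,1]][]]],C 2[Q 10[8,4,32,1],Q 10[1,1,9,0],Q 10[7,2,16,1],Q 10[3,2,17,0],Q 10[6,5,44,0],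
Q 0[1,1,0,0]][D 2[Q 8[1,6,0,-3,1],Q 1[8,1,-1,1,0]][],D 2[Q 10[1,7,3,23,1],Q 1[8,1,-1,1,0]][],D 2[Q 10[1,7,3,23,1],Q 1[8,1,-1,1,0]][],D 2[Q 10[5,61,30,260,5],
Q 1[8,1,-1,1,0],Q 1[5,-1,-4,1,1]][],D 2[Q 10[1,10,5,42,1],Q 1[8,1,-1,1,0]][],C 1[Q 10[2,-8,-5,-43,0],Q 1[2,3,10,0,0]][],C 1[Q 10[2,-8,-5,-43,0],Q 1[2,3,11,0,
0]][],D 8[Q 3[1,5,-3,0,0],Q 1[1,3,5,0,-2],Q 9[19,1,1,-14,3]][],C 1[Q 10[3,-6,-5,-44,0]][]],C 1[Q 1[4,21,-2,-19],Q 1[4,9,-1,-9],Q 1[1,1,0,-1]][],C 1[Q 1[2,10,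
-1,-9],Q 1[6,13,-2,-13],Q 0[1,1,0,0],Q 10[1,1,9,0]][],C 3[Q 1[4,-3,3,25],Q 1[3,-1,1,6],Q 0[1,0,0,1],Q 1[2,-2,1,8],Q 1[5,0,3,20],Q 1[6,-7,3,29],Q 9[173,25,
-199,1]][C 2[Q 1[2,-6,7,-4,-39],Q 1[3,0,5,1,0],Q 0[1,0,1,0,0]][],C 2[Q 1[1,-1,5,0,-6],Q 1[4,-6,9,-3,-34],Q 0[6,0,5,1,0],Q 1[5,2,9,3,9]][],C 1[Q 1[1,-2,6,-1,
-13]][],C 1[Q 1[1,-1,5,0,-6],Q 1[3,0,5,1,0],Q 0[1,0,1,0,0],Q 1[2,-1,3,0,-5]][],D 8[Q 1[1,10,0,7,47],Q 1[2,-52,5,-33,-251],Q 8[6,0,1,-2,1]][],C 1[Q 1[1,-1,5,0,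
-5],Q 1[8,-1,15,2,-4],Q 1[2,0,6,1,0],Q 0[1,0,1,0,0]][D 2[L 2][]],C 1[Q 1[2,-1,11,1,-3],Q 1[4,-1,7,1,-3],Q 0[1,0,1,0,0]][D 2[L 2][]],C 3[Q 1[1,6,0,2,9],
L 1][]],C 2[Q 1[6,44,5,0],Q 1[18,91,10,0],Q 1[5,12,1,-4],Q 8[5,0,-3,1],Q 1[1,1,0,-1],Q 1[2,11,1,-2],Q 1[5,33,3,-5],Q 1[5,23,2,-5]][C 1[Q 1[3,-7,-48,-5,0],
Q 10[1,2,0,6,0]][],C 1[Q 1[1,-3,-17,-2,0],Q 10[3,5,0,18,1]][],C 1[Q 1[1,-4,-17,-2,0],Q 10[5,7,0,33,1]][],C 3[Q 1[1,7,15,2,1],L 1][],D 8[Q 1[4,-3,-3,3,25],Q 1[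
1,7,15,2,0],Q 9[39,6,5,-3,6]][D 2[L 2,Q 10[6,-2,7,0,46,0]][],D 2[Q 10[4,-5,6,-1,38,0],Q 1[7,1,-2,-7,0,0]][],D 8[Q 1[1,1,5,7,1,0],Q 1[5,0,-5,-9,3,32],Q 9[8,-1,
1,1,-1,1]][]],C 0[L 1,Q 1[6,0,3,4,27],Q 1[1,1,2,1,6],Q 1[2,3,6,2,9],Q 1[5,6,12,6,34]][],C 3[Q 2[2,9,-8,-1,0],L 1][]],D 2[][C 0[L 1,Q 1[2,4,5,2,5]][D 8[Q 9[13,
-6,2,2,4,2]][],D 3[L 2,Q 1[4,-9,-21,-21,-8,-21]][],D 3[L 2,Q 1[2,-4,-7,-7,-3,-7]][]],C 2[L 1,Q 1[18,91,0,10,0],Q 1[6,44,0,5,0],Q 1[7,30,0,3,-4],Q 1[7,37,-4,3,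
-4],Q 1[7,44,-4,4,-4]][D 3[L 2,Q 10[3,5,0,1,18,1]][],D 3[L 2,Q 1[1,-2,-9,0,-1,0]][],C 3[L 2,Q 1[2,-5,-9,7,1,7]][]],C 3[L 1,Q 1[4,25,-1,3,-2],Q 1[4,16,0,2,-3],
Q 1[5,20,0,3,0],Q 1[6,28,-3,3,-4]][D 3[L 2,Q 1[1,-6,-36,0,-5,0]][],D 3[L 2,Q 1[2,-7,-41,3,-5,3]][],C 2[L 2,Q 1[1,-1,-4,2,0,3]][],D 8[Q 1[1,-1,-4,2,0,3],Q 1[1,
9,40,0,6,0]][],D 3[L 2,Q 1[8,-19,-74,1,-10,1]][]],C 1[Q 1[2,10,0,-1,-8],Q 1[6,13,-6,-2,-7]][],C 3[Q 1[2,11,0,-1,-9],L 1][],C 1[Q 10[9,6,1,50,1],Q 10[7,6,0,52,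
0],Q 10[8,3,1,24,1],L 1,Q 10[35,17,3,149,3]][D 3[L 2,Q 10[1,9,6,1,48,1],Q 10[1,-14,-9,-1,-77,-1]][],C 0[Q 10[3,-18,-11,-1,-97,-1]][],C 2[L 2,Q 3[1,5,-3,0,0,
0]][]],C 1[Q 10[7,4,1,25,1],Q 10[10,9,1,66,1],Q 10[9,6,1,41,1],Q 2[4,-4,-3,-1,-3]][C 1[Q 10[1,9,6,1,40,1],Q 10[2,9,6,1,39,1],Q 5[7,-9,0,0,2,-1]][],D 8[Q 1[2,
-1,-2,7,2,7],Q 10[2,-3,-3,0,-21,0],Q 2[1,5,-6,0,0,-1]][C 0[L 3,Q 1[5,-1,-2,-7,16,4,16],Q 9[6,-6,1,1,-1,0,-1]][],C 0[L 3,Q 1[2,0,-1,-2,7,2,7],Q 10[3,-4,5,5,0,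
32,0]][],C 3[Q 10[3,-5,-8,-7,0,-50,0]][]],C 1[Q 10[1,-3,-3,0,-21,0]][]]]],D 2[][C 1[Q 2[2,9,-1,-8],Q 0[1,2,0,1]][],C 1[Q 2[3,13,-2,-12],Q 0[1,2,0,2]][],C 2[
Q 10[5,3,20,0],Q 1[5,-5,4,34],Q 1[3,-3,1,10],Q 10[2,2,15,0],Q 10[3,1,5,0],Q 10[2,1,6,0],Q 10[23,15,111,-1]][D 8[Q 10[2,-9,-8,-62,1],Q 1[1,9,-1,2,19],Q 1[1,-5,
6,-1,-11],Q 9[8,1,1,-2,1]][],D 8[Q 2[1,-7,6,2,11],Q 1[4,32,0,4,32],Q 9[30,3,3,-9,4]][]],C 2[Q 1[6,0,5,44],Q 1[2,0,1,9],Q 1[6,-1,4,35],Q 10[7,6,55,-1],Q 1[2,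
-3,1,8]][],C 3[Q 1[6,0,5,44],Q 1[18,0,10,91],Q 1[5,-4,1,12],Q 8[5,1,-3,0],Q 1[1,-1,0,1],Q 1[2,-2,1,11],Q 1[5,-5,3,33],Q 1[5,-5,2,23]][C 0[Q 1[3,-7,0,-5,-48],
Q 10[1,2,0,6,0]][],C 0[Q 1[1,-3,0,-2,-17],Q 10[3,5,1,18,0]][],C 0[Q 1[1,-4,0,-2,-17],Q 10[5,7,1,33,0]][],C 3[Q 1[1,8,0,2,17],L 1][],D 8[Q 1[3,-3,19,2,-4],Q 1[
1,7,0,2,15],Q 9[39,6,6,-3,5]][D 2[Q 10[4,-5,6,0,38,-1],Q 1[7,1,-2,0,0,-7]][],D 2[L 2,Q 10[6,-2,7,0,46,0]][],D 8[Q 1[1,1,5,0,1,7],Q 1[5,0,-5,32,3,-9],Q 9[8,-1,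
1,1,-1,1]][]],C 1[L 1,Q 1[6,0,27,4,3],Q 1[1,1,6,1,2],Q 1[2,3,9,2,6],Q 1[5,6,34,6,12]][],C 3[Q 2[2,9,0,-1,-8],L 1][]],C 2[Q 1[6,0,5,44],Q 1[2,-1,1,10],Q 2[2,7,
3,17],Q 1[4,-1,1,9],Q 1[1,-1,0,1]][C 1[Q 1[2,-9,-6,-7,-60],Q 2[2,-9,-28,-10,-62],Q 7[1,5,1,-2,0],Q 2[3,2,7,3,15]][],C 0[Q 1[2,-7,1,-4,-38],Q 10[4,7,0,27,
0]][],C 0[Q 1[2,-5,5,-2,-21],Q 10[15,23,0,111,-1]][],C 0[Q 10[6,4,0,27,0],L 1,Q 1[1,-2,5,0,-4],Q 2[6,4,44,7,20],Q 10[1,1,0,7,0]][],C 2[Q 2[2,9,-1,-1,-8],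
L 1][]],C 2[Q 1[6,22,5,22],Q 1[4,8,2,9],Q 0[1,1,0,1],Q 1[6,18,4,19]][C 0[Q 1[4,-9,-35,-8,-35],Q 10[1,3,0,5,0]][],C 0[Q 1[3,-7,-23,-5,-23],Q 10[1,2,0,6,0]][],
C 0[Q 1[5,-19,-54,-12,-54],Q 10[3,5,0,20,0],Q 10[2,2,0,7,0]][],C 0[Q 1[1,-4,-9,-2,-9],Q 10[8,12,-1,59,-1],Q 10[4,3,0,11,0]][],D 2[L 1][],D 2[L 1,Q 10[1,1,0,7,
0]][]]]]]"

definition "cert_998876444322 =
D 2[][D 9[][D 2[Q 10[1,8,1]][D 9[Q 1[1,7,1,8],Q 10[9,1,0,1]][],C 3[Q 10[3,-9,-68,-9]][C 1[Q 10[1,6,-7,-54,-7],Q 1[6,5,44,0,0],Q 8[5,-3,0,0,1]][],C 0[Q 10[1,6,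
-7,-54,-7],Q 1[6,5,0,0,44],Q 8[5,-3,1,0,0]][],D 3[Q 1[11,3,2,1,24],Q 1[11,3,24,1,2],Q 2[7,0,-8,1,-1],Q 2[7,0,-1,1,-8]][D 8[Q 9[6,1,9,5,37,5],Q 9[2,0,-4,-1,
-11,-1],Q 9[5,1,-1,0,-6,0]][D 8[Q 9[6,0,1,9,5,37,5],Q 8[28,9,4,13,6,6,6]][]]],C 0[Q 10[1,4,-8,-61,-8],Q 1[5,6,0,0,44],Q 7[4,-3,1,0,0]][D 3[L 3,Q 1[2,-8,-9,-4,
0,-64]][]]],D 8[Q 10[3,-4,-29,-4]][D 3[Q 9[4,22,1,-18,1]][D 9[Q 9[2,-5,-28,0,32,0]][],C 2[Q 9[11,1,52,0,-63,0],Q 9[5,1,12,0,-18,0]][],D 9[Q 10[9,1,0,-6,-47,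
-6],Q 9[5,1,0,2,15,2]][],C 1[Q 9[5,1,12,0,-18,0],Q 9[10,1,47,0,-58,0]][]],C 1[Q 10[5,-7,-8,-54,-8],Q 10[2,-5,-7,-48,-7]][C 0[Q 9[1,4,-2,1,9,1],H 3][]],C 0[
Q 10[3,4,-5,-38,-5],Q 1[5,6,22,0,22]][D 3[Q 9[1,7,0,3,22,3],Q 8[1,-5,8,0,1,0],Q 2[12,1,1,-3,2,-3]][],D 3[L 3,Q 10[1,6,6,-6,-48,-6]][]]],D 9[Q 10[8,1,0,1],Q 1[
1,7,1,-1],Q 10[6,1,-7,-1]][D 8[Q 1[1,-6,-47,-6,12],Q 1[2,33,249,33,-42],Q 9[61,-33,9,-33,1]][],C 0[Q 1[1,-6,-46,-6,7],Q 3[5,0,0,1,-3],Q 10[6,44,0,0,5]][],D 8[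
Q 1[8,7,-7,0,55],Q 1[8,0,55,7,-7],Q 8[5,0,1,-3,0],Q 8[5,-3,0,0,1],Q 9[7,-1,1,-8,0],Q 9[7,-8,0,-1,1]][C 2[Q 1[6,-8,-7,23,3,-58],Q 1[6,0,1,8,2,0]][],C 3[Q 1[4,
-5,2,-33,-4,15],Q 1[6,0,2,0,1,8]][],C 4[Q 1[4,0,3,-3,0,21],Q 1[10,0,4,-2,1,25],Q 1[8,0,7,-7,0,52],Q 9[3,7,-2,1,0,1],Q 9[3,8,-4,1,-2,1],Q 9[7,22,-6,3,1,3]][],
C 2[Q 1[4,0,0,21,3,-3],Q 1[10,0,1,25,4,-2],Q 1[8,0,0,52,7,-7],Q 9[13,44,0,6,-11,6],Q 9[3,7,0,1,-2,1]][],D 3[Q 10[8,0,52,7,-7,0],Q 10[7,0,-6,0,46,6],Q 2[7,0,0,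
-1,1,-8],Q 2[7,0,1,-8,0,-1],Q 9[3,15,-2,2,-2,2],Q 2[14,3,2,-3,2,-3]][C 3[Q 10[4,0,0,21,3,-3,0],Q 10[4,0,-1,14,2,-1,0],Q 9[1,-6,-33,9,-4,0,-5]][],C 1[Q 10[4,0,
0,-3,0,21,3],Q 10[6,1,-1,-3,0,21,3],Q 9[1,-6,-33,0,-5,9,-4]][]]],C 2[Q 10[5,35,4,-3,0],Q 10[8,26,3,-8,0],Q 1[6,0,18,3,0],Q 1[3,0,6,1,0],Q 1[9,-1,51,7,-6],Q 1[
9,-1,41,6,-4],Q 1[7,-1,46,6,-6]][],C 0[Q 1[4,3,-4,0,27],Q 10[6,39,5,-5,-1],Q 1[11,4,-1,1,35],Q 10[8,30,4,-3,-1],Q 10[3,6,1,0,0],Q 10[9,27,4,-3,0]][]],C 1[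
Q 10[9,0,34,5],Q 1[4,27,3,-5],Q 1[3,9,1,-3],Q 10[6,0,36,5],Q 0[5,0,5,0],Q 10[3,0,6,1],Q 10[2,0,6,1]][D 9[Q 10[3,-8,1,-47,-6]][],D 9[Q 10[5,-8,1,-55,-7]][]],
C 2[Q 1[1,-8,-1,8],Q 1[4,-11,-1,12]][]],D 2[Q 0[1,0,1],Q 10[1,9,1]][D 9[Q 1[1,8,1,8],Q 9[19,2,6,3]][],D 9[Q 10[8,1,0,1],Q 10[7,1,7,1],Q 10[6,1,-7,-1]][C 0[
Q 1[1,-6,-46,-6,7],Q 3[5,1,0,0,-3],Q 10[5,0,0,37,4]][],D 3[Q 2[2,-1,-11,-1,-4],Q 3[5,1,0,0,-3],Q 3[5,0,0,1,-3],Q 2[7,9,65,8,16],Q 2[7,8,65,9,16]][D 8[Q 2[6,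
34,1,-33,1,0],Q 8[5,1,-2,1,1,0],Q 8[5,1,1,1,-2,0]][C 1[Q 10[2,-1,0,8,0,1,1],Q 10[7,-3,0,44,0,2,5],Q 8[5,0,1,-2,1,1,0]][]]],C 1[Q 2[1,2,16,2,6],Q 2[1,1,7,1,3],
Q 4[5,1,0,1,-2]][C 1[Q 1[1,2,0,-1,0,5]][]],C 0[Q 10[4,-6,0,28,3],Q 10[7,-7,0,23,3],Q 1[6,3,0,0,18],Q 1[3,1,0,0,5],Q 1[9,6,-5,-1,43],Q 1[8,7,-6,-1,54],Q 1[6,5,
-5,-1,36]][],C 0[Q 10[3,-4,0,10,1],Q 1[6,5,-4,-1,38],Q 1[8,3,-6,-1,22],Q 10[4,-4,0,27,3],Q 1[8,6,-7,-1,45]][]],C 2[Q 1[1,-6,-1,5],Q 1[6,-13,-2,13]][],C 1[Q 1[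
1,-7,-1,6],Q 1[3,-11,-1,9]][]],D 9[Q 1[1,1,8]][D 2[][D 3[Q 1[1,-4,-1,-1,-4]][C 2[Q 1[1,2,-8,-2,-2,-8]][],D 8[Q 2[4,22,-9,1,1,-9]][C 1[L 3,Q 2[4,0,22,-9,1,1,
-9],Q 2[7,1,25,-8,1,1,-17],Q 8[4,-5,-1,0,-2,-2,0]][]],C 1[Q 1[1,-1,-7,-2,-2,-7]][]],C 2[Q 2[1,6,2,2,16],Q 2[1,3,1,1,7],Q 4[5,-2,1,1,0]][C 1[Q 1[1,2,5,0,0,
-1]][]],D 8[Q 1[1,12,-7,-7,-54],Q 1[2,-48,35,35,267],Q 9[61,1,-33,-33,9]][]],C 2[Q 1[1,-3,-3,-23]][C 3[Q 1[2,6,-7,-7,-56],Q 4[4,-3,0,1,0],Q 1[8,4,-1,0,-7]][],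
C 0[Q 1[1,7,-6,-6,-46],Q 3[5,-3,1,0,0],Q 10[6,5,0,44,0]][],D 3[Q 2[2,-3,-1,-1,-10],Q 3[5,-3,1,0,0],Q 2[5,9,5,4,34],Q 2[5,9,4,5,34],Q 3[5,-3,0,1,0]][D 8[Q 2[6,
34,0,1,1,-33],Q 8[5,1,0,-2,1,1],Q 8[5,1,0,1,-2,1]][C 1[Q 9[4,-76,-13,-14,-9,-11,-11],Q 3[3,0,19,8,3,3,4],L 3][]]],C 3[Q 1[1,7,-6,-6,-46],Q 3[5,-3,0,1,0],Q 10[
6,5,44,0,0]][]],D 2[Q 10[1,8,7,1],Q 1[9,1,1,0]][],C 2[Q 1[5,0,4,30],Q 10[3,10,-3,1],Q 10[8,63,-9,7],Q 1[2,0,1,6],Q 1[3,0,1,7],Q 1[23,-1,15,111]][D 2[Q 1[5,-8,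
1,-7,-55]][],D 2[Q 1[3,-9,1,-7,-54]][]],C 2[Q 10[1,-8,7,-1],Q 10[4,-11,12,-1]][],D 2[Q 1[8,1,1,0],Q 10[1,7,-1,1],Q 1[6,1,-1,-7]][D 3[Q 10[1,-9,-67,14,-9],
Q 10[2,35,267,-48,35],Q 2[61,-33,9,1,-33]][],C 2[Q 10[1,-7,-54,6,-7],Q 1[6,44,0,5,0],Q 8[5,0,0,-3,1]][],C 1[Q 10[3,1,-3,10,0],Q 10[5,4,-3,35,0],Q 1[6,36,5,-1,
-5],Q 1[6,17,3,0,-1],Q 1[3,5,1,0,0],Q 10[8,2,0,15,1],Q 1[9,43,6,-1,-2]][],D 8[Q 1[9,-8,0,8,59],Q 1[8,55,7,0,-7],Q 8[5,0,0,-3,1],Q 8[5,1,-3,0,0],Q 9[7,0,-1,-8,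
1],Q 9[7,1,-8,-1,0]][C 1[Q 1[6,-8,23,3,-7,-58],Q 1[6,0,8,2,1,0]][],C 4[Q 1[4,0,-3,0,3,21],Q 1[10,0,-3,1,4,25],Q 1[8,0,-7,0,7,52],Q 9[13,44,6,0,-11,6],Q 9[3,7,
1,0,-2,1]][],D 3[Q 10[8,0,0,52,-7,7],Q 10[7,0,6,-6,46,0],Q 2[7,0,-1,1,0,-8],Q 2[7,0,-8,0,1,-1],Q 9[3,15,2,-2,-2,2],Q 2[14,3,-3,2,2,-3]][C 4[Q 10[4,0,0,0,21,
-3,3],Q 10[6,1,-1,0,21,-3,3],Q 9[1,-6,-33,-5,9,0,-4]][],C 1[Q 10[4,0,0,3,-3,21,0],Q 10[4,0,-1,2,-1,14,0],Q 9[2,-8,-45,-5,0,16,-7]][]],C 1[Q 1[4,0,21,3,0,-3],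
Q 1[10,0,25,4,1,-2],Q 1[8,0,52,7,0,-7],Q 9[3,7,1,-2,0,1],Q 9[3,8,1,-4,-2,1],Q 9[7,22,3,-6,1,3]][],C 3[Q 1[6,-8,-58,-7,3,23],Q 1[6,0,0,1,2,8]][]],C 3[Q 1[5,34,
4,-1,-9],Q 10[8,-1,54,-7,7],Q 10[9,-1,35,-4,5],Q 1[11,36,4,1,-3],Q 10[3,0,6,0,1],Q 10[4,0,12,0,2]][]]],D 9[Q 0[1,1,0],Q 1[1,1,9]][D 2[Q 1[9,1,1,0],Q 1[8,1,1,
8]][],C 2[Q 10[6,44,0,5],Q 10[2,9,-2,1],Q 1[6,0,5,44],Q 10[1,9,0,1],Q 1[6,0,4,37]][],C 2[Q 10[3,-15,17,-2],Q 10[6,-13,13,-2]][],D 2[Q 1[8,1,1,0],Q 1[7,1,1,7],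
Q 1[6,1,-1,-7]][C 1[Q 9[3,6,43,15,6],Q 9[3,4,29,9,4],Q 7[5,1,0,-2,1]][C 1[Q 10[1,3,0,-3,5,0],Q 1[7,0,26,0,6,26]][]],D 3[Q 1[11,2,1,3,24],Q 1[11,24,1,3,2],Q 2[
7,-8,1,0,-1],Q 2[7,-1,1,0,-8]][D 8[Q 9[2,0,-1,-11,-4,-1],Q 1[5,0,37,0,4,0],Q 1[5,0,0,0,4,37],Q 9[5,1,0,-6,-1,0]][D 8[Q 9[6,0,1,5,37,9,5],Q 8[28,9,4,6,6,13,
6]][]]],C 0[Q 10[1,-7,-54,6,-7],Q 8[5,1,0,-3,0],Q 1[5,0,0,4,37]][],C 0[Q 1[8,-13,-1,6,53],Q 10[7,6,-6,46,-1],Q 1[11,-2,1,4,35],Q 10[8,4,-3,29,-1],Q 10[3,1,0,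
5,0],Q 10[4,2,0,12,0]][],C 0[Q 1[4,-4,0,3,27],Q 1[3,-4,0,1,9],Q 10[8,3,-6,22,-1],Q 10[6,5,-4,38,-1],Q 10[5,3,0,20,0]][]]]]]"

lemma check_977777772222: "check ([], [(12, [])], [9, 7, 7, 7, 7, 7, 7, 7, 2, 2, 2, 2]) cert_977777772222"
  by code_simp

lemma check_888888433332: "check ([], [(12, [])], [8, 8, 8, 8, 8, 8, 4, 3, 3, 3, 3, 2]) cert_888888433332"
  by code_simp

lemma check_888777762222: "check ([], [(12, [])], [8, 8, 8, 7, 7, 7, 7, 6, 2, 2, 2, 2]) cert_888777762222"
  by code_simp

lemma check_888887633322: "check ([], [(12, [])], [8, 8, 8, 8, 8, 7, 6, 3, 3, 3, 2, 2]) cert_888887633322"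
  by code_simp

lemma check_888887553222: "check ([], [(12, [])], [8, 8, 8, 8, 8, 7, 5, 5, 3, 2, 2, 2]) cert_888887553222"
  by code_simp

lemma check_888877743222: "check ([], [(12, [])], [8, 8, 8, 8, 7, 7, 7, 4, 3, 2, 2, 2]) cert_888877743222"
  by code_simp

lemma check_988885554222: "check ([], [(12, [])], [9, 8, 8, 8, 8, 5, 5, 5, 4, 2, 2, 2]) cert_988885554222"
  by code_simp

lemma check_999666654222: "check ([], [(12, [])], [9, 9, 9, 6, 6, 6, 6, 5, 4, 2, 2, 2]) cert_999666654222"
  by code_simp

lemma check_988777733322: "check ([], [(12, [])], [9, 8, 8, 7, 7, 7, 7, 3, 3, 3, 2, 2]) cert_988777733322"
  by code_simp

lemma check_997777653222: "check ([], [(12, [])], [9, 9, 7, 7, 7, 7, 6, 5, 3, 2, 2, 2]) cert_997777653222"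
  by code_simp

lemma check_998766663222: "check ([], [(12, [])], [9, 9, 8, 7, 6, 6, 6, 6, 3, 2, 2, 2]) cert_998766663222"
  by code_simp

lemma check_988877544222: "check ([], [(12, [])], [9, 8, 8, 8, 7, 7, 5, 4, 4, 2, 2, 2]) cert_988877544222"
  by code_simp

lemma check_988886543322: "check ([], [(12, [])], [9, 8, 8, 8, 8, 6, 5, 4, 3, 3, 2, 2]) cert_988886543322"
  by code_simp

lemma check_998866643322: "check ([], [(12, [])], [9, 9, 8, 8, 6, 6, 6, 4, 3, 3, 2, 2]) cert_998866643322"
  by code_simp

lemma check_998776644222: "check ([], [(12, [])], [9, 9, 8, 7, 7, 6, 6, 4, 4, 2, 2, 2]) cert_998776644222"
  by code_simp

lemma check_998866554222: "check ([], [(12, [])], [9, 9, 8, 8, 6, 6, 5, 5, 4, 2, 2, 2]) cert_998866554222"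
  by code_simp

lemma check_988876653222: "check ([], [(12, [])], [9, 8, 8, 8, 7, 6, 6, 5, 3, 2, 2, 2]) cert_988876653222"
  by code_simp

lemma check_998876444322: "check ([], [(12, [])], [9, 9, 8, 8, 7, 6, 4, 4, 4, 3, 2, 2]) cert_998876444322"
  by code_simp

definition solved :: "nat list list" where
  "solved = [[9, 7, 7, 7, 7, 7, 7, 7, 2, 2, 2, 2],
    [8, 8, 8, 8, 8, 8, 4, 3, 3, 3, 3, 2],
    [8, 8, 8, 7, 7, 7, 7, 6, 2, 2, 2, 2],
    [8, 8, 8, 8, 8, 7, 6, 3, 3, 3, 2, 2],
    [8, 8, 8, 8, 8, 7, 5, 5, 3, 2, 2, 2],
    [8, 8, 8, 8, 7, 7, 7, 4, 3, 2, 2, 2],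
    [9, 8, 8, 8, 8, 5, 5, 5, 4, 2, 2, 2],
    [9, 9, 9, 6, 6, 6, 6, 5, 4, 2, 2, 2],
    [9, 8, 8, 7, 7, 7, 7, 3, 3, 3, 2, 2],
    [9, 9, 7, 7, 7, 7, 6, 5, 3, 2, 2, 2],
    [9, 9, 8, 7, 6, 6, 6, 6, 3, 2, 2, 2],
    [9, 8, 8, 8, 7, 7, 5, 4, 4, 2, 2, 2],
    [9, 8, 8, 8, 8, 6, 5, 4, 3, 3, 2, 2],
    [9, 9, 8, 8, 6, 6, 6, 4, 3, 3, 2, 2],
    [9, 9, 8, 7, 7, 6, 6, 4, 4, 2, 2, 2],
    [9, 9, 8, 8, 6, 6, 5, 5, 4, 2, 2, 2],
    [9, 8, 8, 8, 7, 6, 6, 5, 3, 2, 2, 2],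
    [9, 9, 8, 8, 7, 6, 4, 4, 4, 3, 2, 2]]"

lemma degseqs_solved:
  "list_all (\<lambda>R. R \<in> set solved \<or> map (\<lambda>d. 11 - d) (rev R) \<in> set solved)
     (degseqs [9, 8, 7, 6, 5, 4, 3, 2] 12 66 440)"
  by code_simp

lemma solved_refuted: "\<forall>R\<in>set solved. \<exists>c. check ([], [(12, [])], R) c"
  unfolding solved_def list.set ball_simps
  by (intro conjI TrueI exI) (rule check_977777772222 check_888888433332 check_888777762222 check_888887633322 check_888887553222
      check_888877743222 check_988885554222 check_999666654222 check_988777733322 check_997777653222
      check_998766663222 check_988877544222 check_988886543322 check_998866643322 check_998776644222
      check_998866554222 check_988876653222 check_998876444322)+

theorem mainTheorem4:
  shows "\<not> (\<exists>G :: 'a pair_pre_digraph. pair_graph G \<and> card (pverts G) = 12 \<and>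
           laplacian_spectrum G = image_mset real (mset_set {0..11}))"
proof (rule no_integral_spectrum)
  fix R assume "R \<in> set (degseqs [9, 8, 7, 6, 5, 4, 3, 2] 12 66 440)"
  then have "R \<in> set solved \<or> map (\<lambda>d. 11 - d) (rev R) \<in> set solved"
    using degseqs_solved by (simp add: list_all_iff)
  then show "\<exists>c. check ([], [(12, [])], R) c \<or> check ([], [(12, [])], map (\<lambda>d. 11 - d) (rev R)) c"
    using solved_refuted by blast
qed

end
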